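(* The graph theory $T_{\mathcal{L}_G}(\mathbb{S}_L)$ of a circle $\mathbb{S}_L$, $L>2$, determines $L$: if $L_1,L_2>2$ are distinct reals then $T_{\mathcal{L}_G}(\mathbb{S}_{L_1})\neq T_{\mathcal{L}_G}(\mathbb{S}_{L_2})$. Similarly, the graph theory $T_{\mathcal{L}_G}(S_r)$ of the sphere $S_r$ determines $r$ for $r>1/\pi$: if $r_1,r_2>1/\pi$ are distinct then $T_{\mathcal{L}_G}(S_{r_1})\neq T_{\mathcal{L}_G}(S_{r_2})$.
   Context: For real $L>2$, $\mathbb{S}_L=\mathbb{R}/L\mathbb{Z}$ with the metric $d_L(a,b)=\min\{|x-y|,L-|x-y|\}$, where $x,y\in[0,L)$ represent $a,b$. A subset $S\subseteq\mathbb{S}_L$ is integer-distance free if there are no $u\ne v$ in $S$ and $n\in\mathbb{Z}$ with $d_L(u,v)=n\pmod L$. $S_r\subseteq\mathbb{R}^3$ is the 2-sphere of radius $r$ with its geodesic metric. A (simple, undirected) graph with vertex set a dense subset $S$ of a separable metric space $(X,d)$ without isolated points is g.e.c. if (i) any two adjacent $u,v\in S$ satisfy $d(u,v)<1$; and (ii) for any $s\in S$, any disjoint finite $A,B\subseteq S$ contained in the open unit ball $B_1(s)$, and any $\epsilon>0$, there is $v\in S\setminus(A\cup B)$ with $d(s,v)<\epsilon$ adjacent to every vertex in $A$ and to no vertex in $B$. $\mathcal{L}_G=\{E\}$ is the language of graphs. $T_{\mathcal{L}_G}(\mathbb{S}_L)$ is the common complete $\mathcal{L}_G$-theory of all g.e.c.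 graphs on dense integer-distance free subsets of $\mathbb{S}_L$ (all such graphs are elementarily equivalent). $T_{\mathcal{L}_G}(S_r)$ is the common complete $\mathcal{L}_G$-theory of all g.e.c. graphs on dense independent subsets of $S_r$ (all such graphs are elementarily equivalent), where independence is with respect to the structure $M_r=(\mathbb{R},+,\cdot,0,1,<,r,\cos(1/r))$, in which $S_r\subseteq\mathbb{R}^3$ and the relation $d(x,y)<1$ are definable without parameters: $Y\subseteq S_r$ is independent if for every formula $\varphi(x,y)$ in the language of $M_r$ with $|x|=3$, $|y|=3m$, and every $\bar b\in Y^m$, if the set $\varphi(S_r,\bar b)=\{x\in S_r: M_r\models\varphi(x,\bar b)\}$ contains no non-empty open ball of $S_r$, then $Y\cap\varphi(S_r,\bar b)\subseteq\bar b$ (the set of entries of $\bar b$). *)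

theory Defs
  imports "HOL-Analysis.Analysis" "HOL-Library.Real_Mod"
begin

section \<open>First-order formulas\<close>

text \<open>
  The syntax is parametric in the type of atomic formulas; a language is given by its atoms, their
  free variables and their interpretation. Variables are natural numbers.
\<close>

datatype 'a fm = Atom 'a | Neg "'a fm" | Conj "'a fm" "'a fm" | Ex nat "'a fm"

primrec fvars :: "('a \<Rightarrow> nat set) \<Rightarrow> 'a fm \<Rightarrow> nat set" where
  "fvars va (Atom a) = va a"
| "fvars va (Neg \<phi>) = fvars va \<phi>"
| "fvars va (Conj \<phi> \<psi>) = fvars va \<phi> \<union> fvars va \<psi>"
| "fvars va (Ex n \<phi>) = fvars va \<phi> - {n}"

primrec sat :: "('a \<Rightarrow> (nat \<Rightarrow> 'm) \<Rightarrow> bool) \<Rightarrow> 'm set \<Rightarrow> 'a fm \<Rightarrow> (nat \<Rightarrow> 'm) \<Rightarrow> bool" where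
  "sat I D (Atom a) e \<longleftrightarrow> I a e"
| "sat I D (Neg \<phi>) e \<longleftrightarrow> \<not> sat I D \<phi> e"
| "sat I D (Conj \<phi> \<psi>) e \<longleftrightarrow> sat I D \<phi> e \<and> sat I D \<psi> e"
| "sat I D (Ex n \<phi>) e \<longleftrightarrow> (\<exists>u\<in>D. sat I D \<phi> (e(n := u)))"


subsection \<open>The language of graphs\<close>

datatype graph_atom = EqV nat nat | Adj nat nat

primrec graph_atom_vars :: "graph_atom \<Rightarrow> nat set" where
  "graph_atom_vars (EqV i j) = {i, j}"
| "graph_atom_vars (Adj i j) = {i, j}"

primrec graph_atom_holds :: "'v rel \<Rightarrow> graph_atom \<Rightarrow> (nat \<Rightarrow> 'v) \<Rightarrow> bool" where
  "graph_atom_holds E (EqV i j) e \<longleftrightarrow> e i = e j"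
| "graph_atom_holds E (Adj i j) e \<longleftrightarrow> (e i, e j) \<in> E"

definition graph_sentences :: "graph_atom fm set" where
  "graph_sentences = {\<phi>. fvars graph_atom_vars \<phi> = {}}"

definition graph_theory :: "'v set \<Rightarrow> 'v rel \<Rightarrow> graph_atom fm set" where
  "graph_theory S E =
     {\<phi> \<in> graph_sentences. \<forall>e. range e \<subseteq> S \<longrightarrow> sat (graph_atom_holds E) S \<phi> e}"

text \<open>
  The common theory of a class of graphs \<open>(S, E)\<close>: the sentences true in all of them. If the class
  is non-empty and its members are elementarily equivalent, this is the complete theory of any of
  them.
\<close>

definition common_graph_theory :: "('v set \<Rightarrow> 'v rel \<Rightarrow> bool) \<Rightarrow> graph_atom fm set" where
  "common_graph_theory K =
     {\<phi> \<in> graph_sentences. \<forall>S E. K S E \<longrightarrow> \<phi> \<in> graph_theory S E}"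


section \<open>G.e.c. graphs on dense subsets of a metric space\<close>

locale gec_graph = Metric_space M d
  for M :: "'v set" and d :: "'v \<Rightarrow> 'v \<Rightarrow> real" +
  fixes S :: "'v set" and E :: "'v rel"
  assumes separable: "separable_space mtopology"
    and no_isolated_points: "mtopology derived_set_of M = M"
    and vertices: "S \<subseteq> M"
    and dense: "mtopology closure_of S = M"
    and edges: "E \<subseteq> S \<times> S"
    and sym_edges: "sym E"
    and irrefl_edges: "irrefl E"
    and adjacent_close: "(u, v) \<in> E \<Longrightarrow> d u v < 1"
    and extension: "\<lbrakk>s \<in> S; finite A; finite B; A \<inter> B = {}; A \<subseteq> S \<inter> mball s 1; B \<subseteq> S \<inter> mball s 1;
      \<epsilon> > 0\<rbrakk> \<Longrightarrow>
      \<exists>v \<in> S - (A \<union> B). d s v < \<epsilon> \<and> (\<forall>a\<in>A. (v, a) \<in> E) \<and> (\<forall>b\<in>B. (v, b) \<notin> E)"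


section \<open>Circles\<close>

text \<open>
  The elements of \<open>\<real>/L\<int>\<close> are identified with their representatives in \<open>[0, L)\<close>. Reducing the
  arguments modulo \<open>L\<close> changes nothing on \<open>circle L\<close>; it makes the distance non-negative on all
  reals, as the locale \<^locale>\<open>Metric_space\<close> demands.
\<close>

definition circle :: "real \<Rightarrow> real set" where
  "circle L = {0..<L}"

definition circle_dist :: "real \<Rightarrow> real \<Rightarrow> real \<Rightarrow> real" where
  "circle_dist L a b =
     (let x = a rmod L; y = b rmod L in min \<bar>x - y\<bar> (L - \<bar>x - y\<bar>))"

definition integer_distance_free :: "real \<Rightarrow> real set \<Rightarrow> bool" where
  "integer_distance_free L S \<longleftrightarrow>
     \<not> (\<exists>u\<in>S. \<exists>v\<in>S. \<exists>n::int. u \<noteq> v \<and> [circle_dist L u v = of_int n] (rmod L))"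

definition circle_graph_theory :: "real \<Rightarrow> graph_atom fm set" where
  "circle_graph_theory L =
     common_graph_theory (\<lambda>S E. gec_graph (circle L) (circle_dist L) S E \<and> integer_distance_free L S)"


section \<open>Spheres\<close>

text \<open>
  The geodesic (great-circle) distance on the sphere of radius \<open>r\<close> about the origin: \<open>r\<close> times the
  angle between \<open>x\<close> and \<open>y\<close>. On the sphere the denominator is \<open>r\<^sup>2\<close>; with the norms, the argument of
  \<^const>\<open>arccos\<close> stays in \<open>[-1, 1]\<close> also for points off the sphere.
\<close>

definition geodesic_dist :: "real \<Rightarrow> real ^ 3 \<Rightarrow> real ^ 3 \<Rightarrow> real" where
  "geodesic_dist r x y = r * arccos (x \<bullet> y / (norm x * norm y))"


subsection \<open>The structure \<open>(\<real>, +, \<cdot>, 0, 1, <, r, cos (1/r))\<close>\<close>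

datatype rtm = Var nat | Zero | One | Radius | CosInv | Add rtm rtm | Mul rtm rtm

datatype real_atom = EqT rtm rtm | LessT rtm rtm

primrec rtm_vars :: "rtm \<Rightarrow> nat set" where
  "rtm_vars (Var i) = {i}"
| "rtm_vars Zero = {}"
| "rtm_vars One = {}"
| "rtm_vars Radius = {}"
| "rtm_vars CosInv = {}"
| "rtm_vars (Add s t) = rtm_vars s \<union> rtm_vars t"
| "rtm_vars (Mul s t) = rtm_vars s \<union> rtm_vars t"

primrec rtm_val :: "real \<Rightarrow> (nat \<Rightarrow> real) \<Rightarrow> rtm \<Rightarrow> real" where
  "rtm_val r e (Var i) = e i"
| "rtm_val r e Zero = 0"
| "rtm_val r e One = 1"
| "rtm_val r e Radius = r"
| "rtm_val r e CosInv = cos (1 / r)"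
| "rtm_val r e (Add s t) = rtm_val r e s + rtm_val r e t"
| "rtm_val r e (Mul s t) = rtm_val r e s * rtm_val r e t"

primrec real_atom_vars :: "real_atom \<Rightarrow> nat set" where
  "real_atom_vars (EqT s t) = rtm_vars s \<union> rtm_vars t"
| "real_atom_vars (LessT s t) = rtm_vars s \<union> rtm_vars t"

primrec real_atom_holds :: "real \<Rightarrow> real_atom \<Rightarrow> (nat \<Rightarrow> real) \<Rightarrow> bool" where
  "real_atom_holds r (EqT s t) e \<longleftrightarrow> rtm_val r e s = rtm_val r e t"
| "real_atom_holds r (LessT s t) e \<longleftrightarrow> rtm_val r e s < rtm_val r e t"

text \<open>
  In a formula \<open>\<phi>(x, y)\<close> with \<open>|x| = 3\<close> and \<open>|y| = 3m\<close>, the variables \<open>0, 1, 2\<close> stand for \<open>x\<close> and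
  \<open>3, \<dots>, 3m + 2\<close> for \<open>y\<close>. The value of \<open>!\<close> beyond the end of the list is irrelevant when the free
  variables of \<open>\<phi>\<close> are below \<open>3 + 3m\<close>.
\<close>

definition coords :: "real ^ 3 \<Rightarrow> real list" where
  "coords x = [x $ 1, x $ 2, x $ 3]"

definition sphere_definable ::
    "real \<Rightarrow> real_atom fm \<Rightarrow> (real ^ 3) list \<Rightarrow> (real ^ 3) set" where
  "sphere_definable r \<phi> bs =
     {x \<in> sphere 0 r. sat (real_atom_holds r) UNIV \<phi> (\<lambda>i. concat (map coords (x # bs)) ! i)}"

definition sphere_independent :: "real \<Rightarrow> (real ^ 3) set \<Rightarrow> bool" where
  "sphere_independent r Y \<longleftrightarrow>
     Y \<subseteq> sphere 0 r \<and>
     (\<forall>\<phi> bs. fvars real_atom_vars \<phi> \<subseteq> {..<3 + 3 * length bs} \<longrightarrow> set bs \<subseteq> Y \<longrightarrow>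
        \<not> (\<exists>c\<in>sphere 0 r. \<exists>\<epsilon>>0.
             Metric_space.mball (sphere 0 r) (geodesic_dist r) c \<epsilon> \<subseteq> sphere_definable r \<phi> bs) \<longrightarrow>
        Y \<inter> sphere_definable r \<phi> bs \<subseteq> set bs)"

definition sphere_graph_theory :: "real \<Rightarrow> graph_atom fm set" where
  "sphere_graph_theory r =
     common_graph_theory
       (\<lambda>S E. gec_graph (sphere 0 r) (geodesic_dist r) S E \<and> sphere_independent r S)"

section \<open>Circles and spheres are separable metric spaces without isolated points\<close>

lemma Metric_space_circle:
  assumes "L > 0"
  shows "Metric_space (circle L) (circle_dist L)"
proof
  fix x y z
  show "0 \<le> circle_dist L x y"
    using rmod_less[OF assms, of x] rmod_less[OF assms, of y]
      rmod_nonneg[of L x] rmod_nonneg[of L y] assms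
    by (auto simp: circle_dist_def Let_def)
  show "circle_dist L x y = circle_dist L y x"
    by (simp add: circle_dist_def Let_def abs_minus_commute)
  have id: "u rmod L = u" if "u \<in> circle L" for u
    using that by (auto simp: circle_def)
  show "circle_dist L x y = 0 \<longleftrightarrow> x = y" if "x \<in> circle L" "y \<in> circle L"
    using that assms id[OF that(1)] id[OF that(2)]
    by (auto simp: circle_dist_def Let_def circle_def min_def split: if_splits)
  show "circle_dist L x z \<le> circle_dist L x y + circle_dist L y z"
    if "x \<in> circle L" "y \<in> circle L" "z \<in> circle L"
    using that id[OF that(1)] id[OF that(2)] id[OF that(3)]
    unfolding circle_dist_def Let_def circle_def atLeastLessThan_iff min_def
    by (smt (verit, ccfv_threshold))
qed

lemma separable_perfectI:
  assumes "Metric_space M d" "countable C" "C \<subseteq> M"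
    and C: "\<And>x \<epsilon>. x \<in> M \<Longrightarrow> \<epsilon> > 0 \<Longrightarrow> \<exists>y\<in>C. y \<noteq> x \<and> d x y < \<epsilon>"
  shows "separable_space (Metric_space.mtopology M d)"
    and "Metric_space.mtopology M d derived_set_of M = M"
proof -
  interpret Metric_space M d by fact
  have "mtopology closure_of C = M"
    unfolding metric_closure_of using C assms(3) by (fastforce simp: in_mball)
  then show "separable_space mtopology"
    unfolding separable_space_def using assms by auto
  show "mtopology derived_set_of M = M"
    unfolding metric_derived_set_of using C assms(3) by (fastforce simp: in_mball)
qed

lemma circle_separable_perfect:
  assumes "L > 0"
  shows "separable_space (Metric_space.mtopology (circle L) (circle_dist L))"
    and "Metric_space.mtopology (circle L) (circle_dist L) derived_set_of circle L = circle L"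
proof -
  have *: "\<exists>y\<in>\<rat> \<inter> circle L. y \<noteq> x \<and> circle_dist L x y < \<epsilon>" if "x \<in> circle L" "\<epsilon> > 0" for x \<epsilon>
  proof -
    have "x < min L (x + \<epsilon>)"
      using that by (auto simp: circle_def)
    then obtain q where q: "q \<in> \<rat>" "x < q" "q < min L (x + \<epsilon>)"
      using Rats_dense_in_real by blast
    with that have "x rmod L = x" "q rmod L = q" "q \<in> circle L"
      by (auto simp: circle_def)
    with q show ?thesis
      by (intro bexI[of _ q]) (auto simp: circle_dist_def)
  qed
  have "countable (\<rat> \<inter> circle L)"
    by (simp add: countable_rat countable_Int1)
  from separable_perfectI[OF Metric_space_circle[OF assms] this _ *]
  show "separable_space (Metric_space.mtopology (circle L) (circle_dist L))"
    and "Metric_space.mtopology (circle L) (circle_dist L) derived_set_of circle L = circle L"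
    by auto
qed

lemma arccos_inner_triangle:
  fixes x y z :: "'a::real_inner"
  assumes "norm x = 1" "norm y = 1" "norm z = 1"
  shows "arccos (x \<bullet> z) \<le> arccos (x \<bullet> y) + arccos (y \<bullet> z)"
proof -
  have bd: "\<bar>u \<bullet> v\<bar> \<le> 1" if "norm u = 1" "norm v = 1" for u v :: 'a
    using Cauchy_Schwarz_ineq2[of u v] that by simp
  define \<alpha> \<beta> where "\<alpha> = arccos (x \<bullet> y)" and "\<beta> = arccos (y \<bullet> z)"
  have cos: "cos \<alpha> = x \<bullet> y" "cos \<beta> = y \<bullet> z"
    using bd[OF assms(1,2)] bd[OF assms(2,3)] by (auto simp: \<alpha>_def \<beta>_def cos_arccos_abs)
  have ab: "0 \<le> \<alpha>" "\<alpha> \<le> pi" "0 \<le> \<beta>" "\<beta> \<le> pi"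
    using bd[OF assms(1,2)] bd[OF assms(2,3)]
    by (auto simp: \<alpha>_def \<beta>_def abs_le_iff intro!: arccos_lbound arccos_ubound)
  define u v where "u = x - (x \<bullet> y) *\<^sub>R y" and "v = z - (y \<bullet> z) *\<^sub>R y"
  have unit: "x \<bullet> x = 1" "y \<bullet> y = 1" "z \<bullet> z = 1"
    using assms by (auto simp: norm_eq_1)
  have "u \<bullet> u = (sin \<alpha>)\<^sup>2"
    unfolding sin_squared_eq cos u_def using unit
    by (simp add: inner_diff_left inner_diff_right inner_commute power2_eq_square algebra_simps)
  then have nu: "norm u = sin \<alpha>"
    using ab by (simp add: norm_eq_sqrt_inner sin_ge_zero)
  have "v \<bullet> v = (sin \<beta>)\<^sup>2"
    unfolding sin_squared_eq cos v_def using unit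
    by (simp add: inner_diff_left inner_diff_right inner_commute power2_eq_square algebra_simps)
  then have nv: "norm v = sin \<beta>"
    using ab by (simp add: norm_eq_sqrt_inner sin_ge_zero)
  have "u \<bullet> v = x \<bullet> z - cos \<alpha> * cos \<beta>"
    unfolding cos u_def v_def using unit
    by (simp add: inner_diff_left inner_diff_right inner_commute algebra_simps)
  moreover have "- (sin \<alpha> * sin \<beta>) \<le> u \<bullet> v"
    using Cauchy_Schwarz_ineq2[of u v] nu nv by (simp add: abs_le_iff)
  ultimately have le: "cos (\<alpha> + \<beta>) \<le> x \<bullet> z"
    by (simp add: cos_add)
  show ?thesis
  proof (cases "\<alpha> + \<beta> \<le> pi")
    case True
    then have "arccos (x \<bullet> z) \<le> arccos (cos (\<alpha> + \<beta>))"
      using le bd[OF assms(1,3)] by (intro arccos_le_arccos) (auto simp: abs_le_iff)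
    with True ab show ?thesis
      by (simp add: arccos_cos \<alpha>_def \<beta>_def)
  next
    case False
    then show ?thesis
      using arccos_ubound[of "x \<bullet> z"] bd[OF assms(1,3)] by (auto simp: abs_le_iff \<alpha>_def \<beta>_def)
  qed
qed

lemma inner_normalized: "x \<bullet> y / (norm x * norm y) = sgn x \<bullet> sgn y"
  for x y :: "'a::real_inner"
  by (simp add: sgn_div_norm divide_simps)

lemma Metric_space_sphere:
  assumes "r > 0"
  shows "Metric_space (sphere 0 r) (geodesic_dist r)"
proof
  fix x y z :: "real ^ 3"
  have bd: "\<bar>sgn u \<bullet> sgn v\<bar> \<le> 1" for u v :: "real ^ 3"
    using Cauchy_Schwarz_ineq2[of "sgn u" "sgn v"] by (auto simp: norm_sgn split: if_splits)
  show "0 \<le> geodesic_dist r x y"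
    unfolding geodesic_dist_def inner_normalized
    using assms bd[of x y] by (intro mult_nonneg_nonneg arccos_lbound) (auto simp: abs_le_iff)
  show "geodesic_dist r x y = geodesic_dist r y x"
    by (simp add: geodesic_dist_def inner_commute mult.commute)
  have unit: "norm (sgn u) = 1" if "u \<in> sphere 0 r" for u :: "real ^ 3"
    using that assms by (auto simp: norm_sgn)
  show "geodesic_dist r x y = 0 \<longleftrightarrow> x = y" if "x \<in> sphere 0 r" "y \<in> sphere 0 r"
  proof
    assume "geodesic_dist r x y = 0"
    then have "arccos (sgn x \<bullet> sgn y) = 0"
      using assms by (simp add: geodesic_dist_def inner_normalized)
    then have "sgn x \<bullet> sgn y = 1"
      using cos_arccos_abs[OF bd[of x y]] by simp
    then have "(norm (sgn x - sgn y))\<^sup>2 = 0"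
      using unit[OF that(1)] unit[OF that(2)] inner_commute[of "sgn x" "sgn y"]
      unfolding power2_norm_eq_inner norm_eq_1 by (simp add: inner_diff_left inner_diff_right)
    then show "x = y"
      using that assms by (auto simp: sgn_div_norm)
  next
    assume "x = y"
    then show "geodesic_dist r x y = 0"
      using unit[OF that(1)] by (simp add: geodesic_dist_def inner_normalized norm_eq_1)
  qed
  show "geodesic_dist r x z \<le> geodesic_dist r x y + geodesic_dist r y z"
    if "x \<in> sphere 0 r" "y \<in> sphere 0 r" "z \<in> sphere 0 r"
    unfolding geodesic_dist_def inner_normalized ring_distribs(1)[symmetric]
    using assms unit that by (intro mult_left_mono arccos_inner_triangle) auto
qed

lemma sphere_separable_perfect:
  assumes "r > 0"
  shows "separable_space (Metric_space.mtopology (sphere 0 r) (geodesic_dist r))"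
    and "Metric_space.mtopology (sphere 0 r) (geodesic_dist r) derived_set_of sphere 0 r
         = sphere 0 r"
proof -
  obtain C :: "(real ^ 3) set"
    where C: "countable C" "C \<subseteq> sphere 0 r" "sphere 0 r \<subseteq> closure C"
    using separable by blast
  have conn: "connected (sphere (0 :: real ^ 3) r)"
    by (intro connected_sphere) simp
  have *: "\<exists>y\<in>C. y \<noteq> x \<and> geodesic_dist r x y < \<epsilon>" if x: "x \<in> sphere 0 r" and "\<epsilon> > 0" for x \<epsilon>
  proof -
    have "\<bar>x \<bullet> y / (norm x * norm y)\<bar> \<le> 1" for y
      using Cauchy_Schwarz_ineq2[of x y]
      by (cases "x = 0 \<or> y = 0") (auto simp: abs_mult divide_simps)
    then have bds: "- 1 \<le> x \<bullet> y / (norm x * norm y)" "x \<bullet> y / (norm x * norm y) \<le> 1" for y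
      by (meson abs_le_D1 abs_le_D2 minus_le_iff)+
    have nz: "norm x * norm y \<noteq> 0" if "y \<in> sphere 0 r" for y :: "real ^ 3"
      using x that assms by auto
    have "continuous_on (sphere 0 r) (geodesic_dist r x)"
      unfolding geodesic_dist_def
      by (intro continuous_intros ballI conjI bds) (use nz in blast)
    then obtain \<delta> where \<delta>: "\<delta> > 0"
      "\<And>y. y \<in> sphere 0 r \<Longrightarrow> dist y x < \<delta> \<Longrightarrow> dist (geodesic_dist r x y) (geodesic_dist r x x) < \<epsilon>"
      using x \<open>\<epsilon> > 0\<close> unfolding continuous_on_iff by blast
    have "x islimpt sphere 0 r"
    proof (rule connected_imp_perfect[OF conn x])
      have "x \<noteq> 0" "- x \<in> sphere 0 r"
        using x assms by auto
      then have "- x \<noteq> x"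
        by (simp add: vec_eq_iff)
      with x show "sphere 0 r \<noteq> {a}" for a :: "real ^ 3"
        using \<open>- x \<in> sphere 0 r\<close> by (metis singletonD)
    qed
    then obtain z where z: "z \<in> sphere 0 r" "z \<noteq> x" "dist z x < \<delta>"
      using \<delta>(1) unfolding islimpt_approachable by blast
    then have "min (dist z x) (\<delta> - dist z x) > 0"
      by simp
    then obtain y where y: "y \<in> C" "dist y z < min (dist z x) (\<delta> - dist z x)"
      using z(1) C(3) unfolding closure_approachable by (meson closure_approachable subsetD)
    then have "y \<noteq> x" "dist y x < \<delta>"
      using dist_triangle[of y x z] by (auto simp: dist_commute)
    moreover have "geodesic_dist r x x = 0"
      using Metric_space.zero[OF Metric_space_sphere[OF assms] x x] by simp
    ultimately show ?thesis
      using \<delta>(2)[of y] y(1) C(2) by (intro bexI[of _ y]) (auto simp: dist_real_def)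
  qed
  from separable_perfectI[OF Metric_space_sphere[OF assms] C(1,2) *]
  show "separable_space (Metric_space.mtopology (sphere 0 r) (geodesic_dist r))"
    and "Metric_space.mtopology (sphere 0 r) (geodesic_dist r) derived_set_of sphere 0 r
         = sphere 0 r"
    by auto
qed

end

theory Submission
  imports Defs "HOL-Computational_Algebra.Fundamental_Theorem_Algebra"
begin

text \<open>
  Let \<open>D\<close> be the diameter (\<open>L / 2\<close> for the circle, \<open>\<pi> r\<close> for the sphere). In a g.e.c. graph,
  first-order formulas define, up to any prescribed error, the relation \<open>d u v < 1\<close>; from formulas for
  \<open>d u v < s\<close> and \<open>d u v < t\<close> one gets formulas for \<open>d u v < s + t\<close>, \<open>d u v < t - s\<close> and, as triangles
  have perimeter at most \<open>2 D\<close>, for \<open>d u v < 2 (D - s)\<close>. If two spaces have the same theory, each such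
  formula has thresholds \<open>t\<close>, \<open>t'\<close> in the two spaces, and the correspondence \<open>t \<mapsto> t'\<close> is increasing and
  compatible with these operations. By an Archimedean argument it is linear below the diameter, and
  it is the identity because \<open>1 \<mapsto> 1\<close>. Since it maps \<open>2 (D - n)\<close> to \<open>2 (D' - n)\<close>, the diameters agree.

  This would be vacuous if there were no graphs of the required kind. They are built vertex by
  vertex. On the sphere, independence is obtained from algebraic genericity of the vertices, and this
  step rests on quantifier elimination for the real field.
\<close>

section \<open>Sign-preserving order isomorphisms for real polynomials\<close>

text \<open>An edge forces a distance below 1, but a missing edge says nothing about distance; the
  metric shows itself only through which finite sets of vertices have common neighbours. Each
  formula therefore measures a distance up to an error, and sharper measurements need other
  formulas. This is why thresholds in the two spaces are linked by a relation of pairs that are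
  approximated arbitrarily well, and why it takes an argument to see that the relation is
  single-valued. All thresholds from the diameter on look alike, so order and uniqueness are
  available only below it; the diameter itself is caught through the complement of the largest
  integer below it, with \<open>D = 2\<close> as the one exception.

  On the sphere, independence concerns a vertex relative to later vertices as well as earlier ones.
  Avoiding definable sets one vertex at a time controls only the earlier ones. Genericity of the
  whole sequence is symmetric in its points: a polynomial relation among the vertices holds for all
  points of the sphere. With the signs of polynomials deciding every formula, this settles both
  directions at once.\<close>

lemma strict_mono_on_extend_real:
  fixes g :: "real \<Rightarrow> real"
  assumes "finite F" "strict_mono_on F g"
  shows "\<exists>h. strict_mono h \<and> surj h \<and> (\<forall>x\<in>F. h x = g x)"
  using assms
proof (induction F rule: finite_linorder_max_induct)
  case empty
  show ?case
    by (intro exI[of _ id]) (auto simp: strict_mono_def)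
next
  case (insert b F)
  obtain h where h: "strict_mono h" "surj h" "\<forall>x\<in>F. h x = g x"
    using insert by (auto simp: strict_mono_on_def)
  show ?case
  proof (cases "F = {}")
    case True
    have "surj (\<lambda>y. y + (g b - b))"
      by (rule surjI[of _ "\<lambda>y. y - (g b - b)"]) simp
    with True show ?thesis
      by (intro exI[of _ "\<lambda>y. y + (g b - b)"]) (auto simp: strict_mono_def)
  next
    case False
    define a where "a = Max F"
    have a: "a \<in> F" "\<And>x. x \<in> F \<Longrightarrow> x \<le> a" "a < b"
      using False insert.hyps by (auto simp: a_def)
    then have "g a < g b"
      using insert.prems by (simp add: strict_mono_on_def)
    define m where "m = (g b - g a) / (b - a)"
    have "m > 0" and mb: "m * (b - a) = g b - g a"
      using a(3) \<open>g a < g b\<close> by (auto simp: m_def)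
    \<comment> \<open>Up to the old maximum \<open>a\<close> the map stays as it is; beyond, it
      follows the line of slope \<open>m\<close> through the values prescribed at \<open>a\<close>
      and \<open>b\<close>. The positive slope keeps it onto.\<close>
    define k where "k y = (if y \<le> a then h y else g a + m * (y - a))" for y
    have ha: "h a = g a"
      using a(1) h(3) by simp
    have "k y < k z" if "y < z" for y z
    proof -
      consider "z \<le> a" | "y \<le> a" "a < z" | "a < y"
        by linarith
      then show ?thesis
      proof cases
        case 2
        have "h y \<le> g a"
          using 2(1) ha h(1) strict_mono_less_eq by metis
        moreover have "0 < m * (z - a)"
          using 2(2) \<open>m > 0\<close> by simp
        ultimately show ?thesis
          using 2 by (simp add: k_def)
      qed (use that h(1) \<open>m > 0\<close> in \<open>auto simp: k_def strict_mono_less\<close>)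
    qed
    then have "strict_mono k"
      by (simp add: strict_mono_def)
    moreover have "surj k"
    proof (rule surjI)
      fix t
      show "k (if t \<le> g a then inv h t else a + (t - g a) / m) = t"
      proof (cases "t \<le> g a")
        case True
        have "h (inv h t) = t"
          using h(2) by (rule surj_f_inv_f)
        then have "inv h t \<le> a"
          using True ha h(1) strict_mono_less_eq by metis
        with True \<open>h (inv h t) = t\<close> show ?thesis
          by (simp add: k_def)
      next
        case False
        then have "(t - g a) / m > 0"
          using \<open>m > 0\<close> by simp
        then have "\<not> a + (t - g a) / m \<le> a"
          by simp
        then have "k (a + (t - g a) / m) = t"
          using \<open>m > 0\<close> by (simp add: k_def)
        with False show ?thesis
          by simp
      qed
    qed
    moreover have "\<forall>x\<in>insert b F. k x = g x"
      using a h(3) mb by (auto simp: k_def)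
    ultimately show ?thesis
      by blast
  qed
qed

text \<open>The component of \<open>y\<close> in the complement of \<open>Z\<close>, and the empty
  set if \<open>y \<in> Z\<close>. Being a pure order condition, it is carried along by increasing
  maps.\<close>

definition gap :: "real set \<Rightarrow> real \<Rightarrow> real set" where
  "gap Z y = {w. \<forall>z\<in>Z. (z < y \<and> z < w) \<or> (y < z \<and> w < z)}"

lemma mem_gap: "w \<in> gap Z y \<longleftrightarrow> (\<forall>z\<in>Z. (z < y \<and> z < w) \<or> (y < z \<and> w < z))"
  by (simp add: gap_def)

lemma gap_between: "u \<in> gap Z y \<Longrightarrow> v \<in> gap Z y \<Longrightarrow> u \<le> w \<Longrightarrow> w \<le> v \<Longrightarrow> w \<in> gap Z y"
  unfolding mem_gap by (meson le_less_trans less_le_trans less_trans less_asym)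

lemma gap_refl: "y \<notin> Z \<Longrightarrow> y \<in> gap Z y"
  using linorder_neq_iff[of y] by (auto simp: mem_gap)

text \<open>
  A gap that is unbounded to the left imposes no condition, since a polynomial that increases there
  is unbounded below.
\<close>

lemma poly_neg_on_gap_iff:
  fixes p :: "real poly"
  assumes Z: "finite Z" "y \<notin> Z" and crit: "\<And>w. poly (pderiv p) w = 0 \<Longrightarrow> w \<in> Z"
    and pos: "\<And>w. w \<in> gap Z y \<Longrightarrow> poly (pderiv p) w > 0"
  shows "(\<exists>w\<in>gap Z y. poly p w < 0) \<longleftrightarrow> (\<forall>a\<in>Z. a < y \<longrightarrow> {a<..<y} \<inter> Z = {} \<longrightarrow> poly p a < 0)"
    (is "?l \<longleftrightarrow> ?r")
proof
  assume ?l
  then obtain w where w: "w \<in> gap Z y" "poly p w < 0"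
    by blast
  show ?r
  proof (intro ballI impI)
    fix a assume a: "a \<in> Z" "a < y" "{a<..<y} \<inter> Z = {}"
    then have "a < w"
      using w by (auto simp: mem_gap)
    obtain c where c: "a < c" "c < w" "poly p w - poly p a = (w - a) * poly (pderiv p) c"
      using poly_MVT[OF \<open>a < w\<close>, of p] by blast
    have "c \<in> gap Z y"
      unfolding mem_gap
      proof
        fix z assume "z \<in> Z"
        then have "z \<notin> {a<..<y}" "z \<noteq> y" "z < y \<and> z < w \<or> y < z \<and> w < z"
          using a(3) Z(2) w(1) by (auto simp: mem_gap)
        then show "z < y \<and> z < c \<or> y < z \<and> c < z"
          using c(1,2) by auto
      qed
    then have "(w - a) * poly (pderiv p) c > 0"
      using pos \<open>a < w\<close> by simp
    with c w show "poly p a < 0"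
      by linarith
  qed
next
  assume r: ?r
  show ?l
  proof (cases "{a\<in>Z. a < y} = {}")
    case True
    then have left: "w \<in> gap Z y" if "w \<le> y" for w
      using that Z(2) True linorder_neq_iff[of y] by (fastforce simp: mem_gap)
    have "pderiv p \<noteq> 0"
      using pos[OF gap_refl[OF Z(2)]] by auto
    show ?thesis
    proof (rule ccontr)
      assume neg: "\<not> ?thesis"
      have inc: "poly p u \<le> poly p v" if "u \<le> v" "v \<le> y" for u v
      proof (cases "u = v")
        case False
        then obtain c where c: "u < c" "c < v" "poly p v - poly p u = (v - u) * poly (pderiv p) c"
          using poly_MVT[of u v p] \<open>u \<le> v\<close> by (auto simp: less_le)
        then have "poly (pderiv p) c > 0"
          using that by (intro pos left) auto
        then show ?thesis
          using c(3) \<open>u \<le> v\<close> mult_nonneg_nonneg[of "v - u" "poly (pderiv p) c"] by linarith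
      qed simp
      \<comment> \<open>On the half-line up to \<open>y\<close> the values of \<open>p\<close> would
        lie between 0 and \<open>poly p y\<close>, whereas a nonconstant polynomial is unbounded
        there in absolute value.\<close>
      have "degree p \<noteq> 0"
        using \<open>pderiv p \<noteq> 0\<close> by (simp add: pderiv_eq_0_iff)
      obtain c q where p: "p = pCons c q"
        by (cases p)
      then have "q \<noteq> 0"
        using \<open>degree p \<noteq> 0\<close> by auto
      then obtain R where R: "\<And>z. R \<le> norm z \<Longrightarrow> \<bar>poly p y\<bar> + 1 \<le> norm (poly p z)"
        using poly_infinity[of q "\<bar>poly p y\<bar> + 1" c] p by blast
      define N where "N = - \<bar>R\<bar>"
      have N: "norm (poly p x) > \<bar>poly p y\<bar>" if "x \<le> N" for x
      proof -
        have "R \<le> norm x"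
          using that by (simp add: N_def)
        from R[OF this] show ?thesis
          by linarith
      qed
      let ?x = "min N y"
      have "0 \<le> poly p ?x" "poly p ?x \<le> poly p y"
        using neg left[of ?x] inc[of ?x y] by (auto simp: not_less)
      with N[of ?x] show False
        by simp
    qed
  next
    case False
    define a where "a = Max {a\<in>Z. a < y}"
    have "a \<in> {a\<in>Z. a < y}"
      unfolding a_def using Z False by (intro Max_in) auto
    then have a: "a \<in> Z" "a < y" by auto
    have max: "x \<le> a" if "x \<in> Z" "x < y" for x
      unfolding a_def using Z that by (intro Max_ge) auto
    then have "{a<..<y} \<inter> Z = {}"
      by fastforce
    then have "poly p a < 0"
      using r a by blast
    then have "eventually (\<lambda>x. poly p x < 0) (at_right a)"
      using poly_isCont[of a p] continuous_at_imp_continuous_at_within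
      unfolding continuous_within by (intro order_tendstoD(2)) blast+
    then obtain b where b: "b > a" "\<And>x. a < x \<Longrightarrow> x < b \<Longrightarrow> poly p x < 0"
      unfolding eventually_at_right_field by blast
    define w where "w = (a + min b y) / 2"
    have w: "a < w" "w < b" "w < y"
      using a b by (auto simp: w_def min_def)
    have "w \<in> gap Z y"
      unfolding mem_gap
    proof
      fix z assume "z \<in> Z"
      then have "z < y \<longrightarrow> z \<le> a" "z \<noteq> y"
        using max Z(2) by auto
      then show "z < y \<and> z < w \<or> y < z \<and> w < z"
        using w by auto
    qed
    with b w show ?thesis
      by blast
  qed
qed

section \<open>Roots and signs of a polynomial within a gap\<close>

lemma open_gap:
  assumes "finite Z"
  shows "open (gap Z y)"
proof -
  have "gap Z y = (\<Inter>z\<in>Z. {w. z < y \<and> z < w} \<union> {w. y < z \<and> w < z})"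
    by (auto simp: mem_gap)
  also have "open \<dots>"
    using assms by (intro open_INT ballI open_Un open_Collect_conj open_Collect_less continuous_intros) auto
  finally show ?thesis .
qed

lemma poly_IVT_between:
  fixes p :: "real poly"
  assumes "poly p u < 0" "poly p v > 0"
  shows "\<exists>z. min u v \<le> z \<and> z \<le> max u v \<and> poly p z = 0"
proof (cases "u < v")
  case True
  then show ?thesis
    using poly_IVT_pos[of u v p] assms by (auto simp: min_def max_def intro: less_imp_le)
next
  case False
  moreover have "u \<noteq> v"
    using assms by auto
  ultimately have "v < u"
    by simp
  then show ?thesis
    using poly_IVT_neg[of v u p] assms by (auto simp: min_def max_def intro: less_imp_le)
qed

lemma gap_between_minmax:
  "u \<in> gap Z y \<Longrightarrow> v \<in> gap Z y \<Longrightarrow> min u v \<le> w \<Longrightarrow> w \<le> max u v \<Longrightarrow> w \<in> gap Z y"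
  by (cases "u \<le> v") (auto intro: gap_between simp: min_def max_def)

lemma poly_sgn_gap:
  fixes p :: "real poly"
  assumes nz: "\<And>w. w \<in> gap Z y \<Longrightarrow> poly p w \<noteq> 0" and u: "u \<in> gap Z y" and v: "v \<in> gap Z y"
  shows "sgn (poly p u) = sgn (poly p v)"
proof (rule ccontr)
  assume "\<not> ?thesis"
  then have "(poly p u < 0 \<and> poly p v > 0) \<or> (poly p v < 0 \<and> poly p u > 0)"
    using nz[OF u] nz[OF v] by (auto simp: sgn_if split: if_splits)
  then obtain z where "min u v \<le> z" "z \<le> max u v" "poly p z = 0"
    using poly_IVT_between[of p u v] poly_IVT_between[of p v u] by (auto simp: min.commute max.commute)
  with gap_between_minmax[OF u v] nz show False
    by blast
qed

text \<open>Without critical points in the gap, the mean value theorem gives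
  \<open>poly p w = (w - z) * poly (pderiv p) c\<close>, and the last factor has constant
  sign.\<close>

lemma poly_sgn_near_root:
  fixes p :: "real poly"
  assumes crit: "\<And>w. poly (pderiv p) w = 0 \<Longrightarrow> w \<in> Z"
    and z: "z \<in> gap Z y" "poly p z = 0" and w: "w \<in> gap Z y"
  shows "sgn (poly p w) = sgn (w - z) * sgn (poly (pderiv p) z)"
proof -
  have nz: "poly (pderiv p) x \<noteq> 0" if "x \<in> gap Z y" for x
    using crit that by (force simp: mem_gap)
  have *: "sgn (poly (pderiv p) c) = sgn (poly (pderiv p) z)" if "min w z \<le> c" "c \<le> max w z" for c
    using poly_sgn_gap[OF nz _ z(1)] gap_between_minmax[OF w z(1) that] by blast
  consider "w = z" | "w < z" | "z < w"
    by linarith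
  then show ?thesis
  proof cases
    case 2
    then obtain c where "w < c" "c < z" "poly p z - poly p w = (z - w) * poly (pderiv p) c"
      using poly_MVT by blast
    then have "poly p w = (w - z) * poly (pderiv p) c"
      using z(2) by (simp add: algebra_simps)
    then show ?thesis
      using *[of c] \<open>w < c\<close> \<open>c < z\<close> by (simp add: sgn_mult)
  next
    case 3
    then obtain c where "z < c" "c < w" "poly p w - poly p z = (w - z) * poly (pderiv p) c"
      using poly_MVT by blast
    then show ?thesis
      using *[of c] z(2) by (simp add: sgn_mult)
  qed (use z in simp)
qed

text \<open>A root in a gap free of critical points is simple, so \<open>p\<close> changes sign
  there; the converse is the intermediate value theorem.\<close>

lemma poly_root_on_gap_iff:
  fixes p :: "real poly"
  assumes Z: "finite Z" and crit: "\<And>w. poly (pderiv p) w = 0 \<Longrightarrow> w \<in> Z"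
  shows "(\<exists>z\<in>gap Z y. poly p z = 0) \<longleftrightarrow> (\<exists>w\<in>gap Z y. poly p w < 0) \<and> (\<exists>w\<in>gap Z y. poly p w > 0)"
proof
  assume "\<exists>z\<in>gap Z y. poly p z = 0"
  then obtain z where z: "z \<in> gap Z y" "poly p z = 0" by blast
  obtain e where e: "e > 0" "ball z e \<subseteq> gap Z y"
    using open_gap[OF Z] z(1) open_contains_ball by blast
  define u v where "u = z - e / 2" and "v = z + e / 2"
  have uv: "u \<in> gap Z y" "v \<in> gap Z y" "u < z" "z < v"
    using e by (auto simp: u_def v_def dist_real_def subset_iff)
  have "poly (pderiv p) z \<noteq> 0"
    using crit z(1) by (force simp: mem_gap)
  moreover have "sgn (poly p u) = - sgn (poly (pderiv p) z)" "sgn (poly p v) = sgn (poly (pderiv p) z)"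
    using poly_sgn_near_root[OF crit z uv(1)] poly_sgn_near_root[OF crit z uv(2)] uv(3,4) by simp_all
  ultimately have "(poly p u < 0 \<and> poly p v > 0) \<or> (poly p v < 0 \<and> poly p u > 0)"
    by (auto simp: sgn_if split: if_splits)
  then show "(\<exists>w\<in>gap Z y. poly p w < 0) \<and> (\<exists>w\<in>gap Z y. poly p w > 0)"
    using uv by blast
next
  assume "(\<exists>w\<in>gap Z y. poly p w < 0) \<and> (\<exists>w\<in>gap Z y. poly p w > 0)"
  then obtain u v where uv: "u \<in> gap Z y" "v \<in> gap Z y" "poly p u < 0" "poly p v > 0"
    by blast
  then obtain z where "min u v \<le> z" "z \<le> max u v" "poly p z = 0"
    using poly_IVT_between by blast
  then show "\<exists>z\<in>gap Z y. poly p z = 0"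
    using gap_between_minmax[OF uv(1,2)] by blast
qed

lemma poly_pos_on_gap_iff:
  fixes p :: "real poly"
  assumes Z: "finite Z" "y \<notin> Z" and crit: "\<And>w. poly (pderiv p) w = 0 \<Longrightarrow> w \<in> Z"
    and pos: "\<And>w. w \<in> gap Z y \<Longrightarrow> poly (pderiv p) w > 0"
  shows "(\<exists>w\<in>gap Z y. poly p w > 0) \<longleftrightarrow> (\<forall>b\<in>Z. y < b \<longrightarrow> {y<..<b} \<inter> Z = {} \<longrightarrow> poly p b > 0)"
proof -
  \<comment> \<open>The reflection at 0 swaps the two ends of the gap, and the outer minus sign
    keeps the derivative positive. Negative values of \<open>q\<close> are positive values of
    \<open>p\<close>.\<close>
  define q where "q = - pcompose p [:0, -1:]"
  have q: "poly q w = - poly p (- w)" "poly (pderiv q) w = poly (pderiv p) (- w)" for w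
    by (simp_all add: q_def poly_pcompose pderiv_pcompose pderiv_pCons pderiv_minus)
  let ?Z = "uminus ` Z"
  have gap: "w \<in> gap ?Z (- y) \<longleftrightarrow> - w \<in> gap Z y" for w
    by (auto simp: mem_gap)
  have "(\<exists>w\<in>gap ?Z (- y). poly q w < 0) \<longleftrightarrow>
    (\<forall>a\<in>?Z. a < - y \<longrightarrow> {a<..<- y} \<inter> ?Z = {} \<longrightarrow> poly q a < 0)"
  proof (rule poly_neg_on_gap_iff)
    show "w \<in> ?Z" if "poly (pderiv q) w = 0" for w
    proof -
      have "- w \<in> Z"
        using crit[of "- w"] that q by simp
      then show ?thesis
        by (rule rev_image_eqI) simp
    qed
  qed (use Z pos gap q in auto)
  moreover have "(\<exists>w\<in>gap ?Z (- y). poly q w < 0) \<longleftrightarrow> (\<exists>w\<in>gap Z y. poly p w > 0)"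
  proof
    assume "\<exists>w\<in>gap Z y. poly p w > 0"
    then obtain w where "w \<in> gap Z y" "poly p w > 0" by blast
    then show "\<exists>w\<in>gap ?Z (- y). poly q w < 0"
      by (intro bexI[of _ "- w"]) (auto simp: gap q)
  qed (auto simp: gap q)
  moreover have "{- b<..<- y} \<inter> ?Z = {} \<longleftrightarrow> {y<..<b} \<inter> Z = {}" for b
  proof -
    have "{- b<..<- y} = uminus ` {y<..<b}"
      by simp
    then show ?thesis
      by (simp only: image_Int[symmetric] inj_uminus image_is_empty)
  qed
  ultimately show ?thesis
    by (simp add: q)
qed

lemma strict_mono_image_Ioo:
  fixes h :: "real \<Rightarrow> real"
  assumes "strict_mono h"
  shows "{h a<..<h b} \<inter> h ` Z = {} \<longleftrightarrow> {a<..<b} \<inter> Z = {}"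
proof -
  have "h z \<in> {h a<..<h b} \<longleftrightarrow> z \<in> {a<..<b}" for z
    using strict_mono_less[OF assms] by simp
  then show ?thesis
    by blast
qed

text \<open>\<open>p\<close> is monotone on the gap, so the signs it takes there can be read off at
  the ends of the gap, and \<open>h\<close> matches both the ends and the signs at them.\<close>

lemma poly_gap_sign_transfer:
  fixes p p' :: "real poly"
  assumes h: "strict_mono h" "surj h" and Z: "finite Z" "y \<notin> Z"
    and crit: "\<And>w. poly (pderiv p) w = 0 \<Longrightarrow> w \<in> Z"
    and der: "\<And>w. sgn (poly (pderiv p) w) = sgn (poly (pderiv p') (h w))"
    and val: "\<And>a. a \<in> Z \<Longrightarrow> sgn (poly p a) = sgn (poly p' (h a))"
  shows "(\<exists>w\<in>gap Z y. poly p w < 0) \<longleftrightarrow> (\<exists>w\<in>gap (h ` Z) (h y). poly p' w < 0)"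
    and "(\<exists>w\<in>gap Z y. poly p w > 0) \<longleftrightarrow> (\<exists>w\<in>gap (h ` Z) (h y). poly p' w > 0)"
proof -
  have Z': "finite (h ` Z)" "h y \<notin> h ` Z"
    using Z strict_mono_eq[OF h(1)] by auto
  have main: "((\<exists>w\<in>gap Z y. poly q w < 0) \<longleftrightarrow> (\<exists>w\<in>gap (h ` Z) (h y). poly q' w < 0)) \<and>
      ((\<exists>w\<in>gap Z y. poly q w > 0) \<longleftrightarrow> (\<exists>w\<in>gap (h ` Z) (h y). poly q' w > 0))"
    if crit: "\<And>w. poly (pderiv q) w = 0 \<Longrightarrow> w \<in> Z"
      and der: "\<And>w. sgn (poly (pderiv q) w) = sgn (poly (pderiv q') (h w))"
      and val: "\<And>a. a \<in> Z \<Longrightarrow> sgn (poly q a) = sgn (poly q' (h a))"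
      and pos: "poly (pderiv q) y > 0" for q q' :: "real poly"
  proof -
    have crit': "w \<in> h ` Z" if "poly (pderiv q') w = 0" for w
    proof -
      obtain v where "w = h v"
        using h(2) by (auto simp: surj_def)
      with that der[of v] have "poly (pderiv q) v = 0"
        by (simp add: sgn_eq_0_iff)
      then show ?thesis
        using \<open>w = h v\<close> crit by blast
    qed
    have nz: "poly (pderiv q) w \<noteq> 0" if "w \<in> gap Z y" for w
      using crit that by (force simp: mem_gap)
    have nz': "poly (pderiv q') w \<noteq> 0" if "w \<in> gap (h ` Z) (h y)" for w
      using crit' that by (force simp: mem_gap)
    have pos1: "poly (pderiv q) w > 0" if "w \<in> gap Z y" for w
      using poly_sgn_gap[OF nz that gap_refl[OF Z(2)]] pos by (simp add: sgn_if split: if_splits)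
    have "poly (pderiv q') (h y) > 0"
      using der[of y] pos by (simp add: sgn_if split: if_splits)
    then have pos2: "poly (pderiv q') w > 0" if "w \<in> gap (h ` Z) (h y)" for w
      using poly_sgn_gap[OF nz' that gap_refl[OF Z'(2)]] by (simp add: sgn_if split: if_splits)
    have val': "poly q a < 0 \<longleftrightarrow> poly q' (h a) < 0" "poly q a > 0 \<longleftrightarrow> poly q' (h a) > 0" if "a \<in> Z" for a
      using val[OF that] by (auto simp: sgn_if split: if_splits)
    show ?thesis
      using poly_neg_on_gap_iff[OF Z crit pos1] poly_neg_on_gap_iff[OF Z' crit' pos2]
        poly_pos_on_gap_iff[OF Z crit pos1] poly_pos_on_gap_iff[OF Z' crit' pos2]
      by (simp add: strict_mono_image_Ioo[OF h(1)] strict_mono_less[OF h(1)] val')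
  qed
  have "poly (pderiv p) y \<noteq> 0"
    using crit Z(2) by blast
  then have "((\<exists>w\<in>gap Z y. poly p w < 0) \<longleftrightarrow> (\<exists>w\<in>gap (h ` Z) (h y). poly p' w < 0)) \<and>
      ((\<exists>w\<in>gap Z y. poly p w > 0) \<longleftrightarrow> (\<exists>w\<in>gap (h ` Z) (h y). poly p' w > 0))"
  proof (cases "poly (pderiv p) y > 0")
    case True
    show ?thesis
      by (rule main[OF crit der val True])
  next
    case False
    with \<open>poly (pderiv p) y \<noteq> 0\<close> have "poly (pderiv (- p)) y > 0"
      by (simp add: pderiv_minus)
    from main[of "- p" "- p'", OF _ _ _ this] crit der val show ?thesis
      by (simp add: pderiv_minus sgn_minus)
  qed
  then show "(\<exists>w\<in>gap Z y. poly p w < 0) \<longleftrightarrow> (\<exists>w\<in>gap (h ` Z) (h y). poly p' w < 0)"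
    and "(\<exists>w\<in>gap Z y. poly p w > 0) \<longleftrightarrow> (\<exists>w\<in>gap (h ` Z) (h y). poly p' w > 0)"
    by auto
qed

text \<open>\<open>h\<close> matches the zeros of the polynomials in \<open>Q\<close>, but not the
  further roots of \<open>p\<close>. Since the derivative of \<open>p\<close> is in
  \<open>Q\<close>, each gap between these zeros contains at most one further root; \<open>h\<close>
  is kept on the zeros and redrawn inside the gaps so that root goes to root.\<close>

lemma sign_preserving_extend:
  fixes p p' :: "real poly" and Q :: "(real poly \<times> real poly) set"
  assumes h: "strict_mono h" "surj h" and Q: "finite Q"
    and sgnQ: "\<And>q q' y. (q, q') \<in> Q \<Longrightarrow> sgn (poly q y) = sgn (poly q' (h y))"
    and der: "(pderiv p, pderiv p') \<in> Q" "pderiv p \<noteq> 0"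
    and val: "\<And>q q' y. (q, q') \<in> Q \<Longrightarrow> q \<noteq> 0 \<Longrightarrow> poly q y = 0 \<Longrightarrow> sgn (poly p y) = sgn (poly p' (h y))"
  shows "\<exists>k. strict_mono k \<and> surj k \<and> (\<forall>y. sgn (poly p y) = sgn (poly p' (k y))) \<and>
    (\<forall>(q, q')\<in>Q. \<forall>y. sgn (poly q y) = sgn (poly q' (k y)))"
proof -
  define Z where "Z = (\<Union>q\<in>fst ` Q - {0}. {y. poly q y = 0})"
  have Z: "finite Z"
    unfolding Z_def using Q by (intro finite_UN_I) (auto intro: poly_roots_finite)
  have crit: "w \<in> Z" if "poly (pderiv p) w = 0" for w
    using that der by (force simp: Z_def)
  have dersgn: "sgn (poly (pderiv p) w) = sgn (poly (pderiv p') (h w))" for w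
    using sgnQ der by blast
  have valZ: "sgn (poly p a) = sgn (poly p' (h a))" if "a \<in> Z" for a
    using that val by (force simp: Z_def)
  have crit': "w \<in> h ` Z" if "poly (pderiv p') w = 0" for w
  proof -
    obtain v where "w = h v"
      using h(2) by (auto simp: surj_def)
    with that dersgn[of v] show ?thesis
      using crit by (auto simp: sgn_eq_0_iff)
  qed
  have Z': "finite (h ` Z)"
    using Z by simp
  have hZ: "h y \<notin> h ` Z" if "y \<notin> Z" for y
    using that strict_mono_eq[OF h(1)] by auto
  define W where "W = {z. poly p z = 0} - Z"
  have "p \<noteq> 0"
    using der(2) by auto
  then have W: "finite W"
    unfolding W_def by (intro finite_Diff poly_roots_finite)
  have root: "\<exists>z'\<in>gap (h ` Z) (h z). poly p' z' = 0" if "z \<in> W" for z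
  proof -
    have "z \<notin> Z" "poly p z = 0"
      using that by (auto simp: W_def)
    then have "\<exists>w\<in>gap Z z. poly p w = 0"
      using gap_refl by blast
    then show ?thesis
      using poly_root_on_gap_iff[OF Z crit] poly_root_on_gap_iff[OF Z' crit']
        poly_gap_sign_transfer[OF h Z \<open>z \<notin> Z\<close> crit dersgn valZ] by simp
  qed
  define g where "g x = (if x \<in> Z then h x else SOME z'. z' \<in> gap (h ` Z) (h x) \<and> poly p' z' = 0)" for x
  have gZ: "g x = h x" if "x \<in> Z" for x
    using that by (simp add: g_def)
  have gW: "g x \<in> gap (h ` Z) (h x)" "poly p' (g x) = 0" if "x \<in> W" for x
  proof -
    have "\<exists>z'. z' \<in> gap (h ` Z) (h x) \<and> poly p' z' = 0"
      using root[OF that] by blast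
    from someI_ex[OF this] show "g x \<in> gap (h ` Z) (h x)" "poly p' (g x) = 0"
      using that by (auto simp: g_def W_def)
  qed
  have less1: "h a < g x" if "a \<in> Z" "x \<in> Z \<union> W" "a < x" for a x
  proof (cases "x \<in> Z")
    case False
    with that gW have "g x \<in> gap (h ` Z) (h x)" by auto
    with that show ?thesis
      using strict_mono_less[OF h(1), of a x] by (force simp: mem_gap)
  qed (use that gZ strict_mono_less[OF h(1)] in auto)
  have less2: "g x < h a" if "a \<in> Z" "x \<in> Z \<union> W" "x < a" for a x
  proof (cases "x \<in> Z")
    case False
    with that gW have "g x \<in> gap (h ` Z) (h x)" by auto
    with that show ?thesis
      using strict_mono_less[OF h(1), of x a] by (force simp: mem_gap)
  qed (use that gZ strict_mono_less[OF h(1)] in auto)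
  have "strict_mono_on (Z \<union> W) g"
  proof (rule strict_mono_onI)
    fix x y assume xy: "x \<in> Z \<union> W" "y \<in> Z \<union> W" "x < y"
    show "g x < g y"
    proof (cases "x \<in> Z \<or> y \<in> Z")
      case True
      then show ?thesis
        using less1[of x y] less2[of y x] xy gZ by auto
    next
      case False
      then have "poly p x = 0" "poly p y = 0"
        using xy by (auto simp: W_def)
      \<comment> \<open>As in Rolle's theorem, two further roots enclose a critical point, which
        lies in \<open>Z\<close> and separates their images.\<close>
      moreover obtain c where c: "x < c" "c < y" "poly p y - poly p x = (y - x) * poly (pderiv p) c"
        using poly_MVT[OF xy(3)] by blast
      ultimately have "c \<in> Z"
        using xy(3) crit by simp
      then show ?thesis
        using less1[of c y] less2[of c x] xy c by (meson less_trans)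
    qed
  qed
  then obtain k where k: "strict_mono k" "surj k" "\<And>x. x \<in> Z \<union> W \<Longrightarrow> k x = g x"
    using strict_mono_on_extend_real[of "Z \<union> W" g] Z W by auto
  have kZ: "k a = h a" if "a \<in> Z" for a
    using k(3) that gZ by simp
  have kgap: "k w \<in> gap (h ` Z) (h y)" if "w \<in> gap Z y" for w y
    unfolding mem_gap
  proof
    fix z assume "z \<in> h ` Z"
    then obtain a where a: "a \<in> Z" "z = h a" by blast
    have "z < h y \<longleftrightarrow> a < y" "h y < z \<longleftrightarrow> y < a" "z < k w \<longleftrightarrow> a < w" "k w < z \<longleftrightarrow> w < a"
      using a kZ strict_mono_less[OF h(1)] strict_mono_less[OF k(1)] by metis+
    with that a show "z < h y \<and> z < k w \<or> h y < z \<and> k w < z"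
      by (auto simp: mem_gap)
  qed
  have "sgn (poly q y) = sgn (poly q' (k y))" if q: "(q, q') \<in> Q" for q q' y
  proof (cases "y \<in> Z")
    case False
    \<comment> \<open>As \<open>h\<close> is onto, the zeros of \<open>q'\<close> are exactly the
      images of the zeros of \<open>q\<close>. Hence, unless \<open>q = 0\<close>, \<open>q'\<close>
      keeps its sign on the gap that contains both \<open>h y\<close> and
      \<open>k y\<close>.\<close>
    have "\<exists>v. x = h v" for x
      using h(2) by (auto simp: surj_def)
    then have q': "sgn (poly q' x) = 0 \<longleftrightarrow> (\<exists>v. x = h v \<and> sgn (poly q v) = 0)" for x
      using sgnQ[OF q] by metis
    show ?thesis
    proof (cases "q = 0")
      case True
      have "\<exists>v. k y = h v"
        using h(2) by (auto simp: surj_def)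
      then show ?thesis
        using q'[of "k y"] True by simp
    next
      case nz: False
      have "poly q' w \<noteq> 0" if "w \<in> gap (h ` Z) (h y)" for w
      proof
        assume "poly q' w = 0"
        then obtain v where "w = h v" "poly q v = 0"
          using q'[of w] by (auto simp: sgn_eq_0_iff)
        then have "w \<in> h ` Z"
          using q nz by (force simp: Z_def)
        with that show False
          by (force simp: mem_gap)
      qed
      from poly_sgn_gap[OF this kgap[OF gap_refl[OF False]] gap_refl[OF hZ[OF False]]]
      show ?thesis
        using sgnQ[OF q, of y] by simp
    qed
  qed (use kZ sgnQ[OF q] in simp)
  moreover have "sgn (poly p y) = sgn (poly p' (k y))" for y
  proof (cases "y \<in> Z")
    case True
    then show ?thesis
      using valZ kZ by simp
  next
    case False
    note transfer = poly_gap_sign_transfer[OF h Z False crit dersgn valZ]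
    show ?thesis
    proof (cases "\<exists>z\<in>gap Z y. poly p z = 0")
      case True
      then obtain z where z: "z \<in> gap Z y" "poly p z = 0" by blast
      then have zW: "z \<in> W"
        by (force simp: W_def mem_gap)
      then have root: "poly p' (k z) = 0"
        using k(3) gW by simp
      have "sgn (poly p y) = sgn (y - z) * sgn (poly (pderiv p) z)"
        by (rule poly_sgn_near_root[OF crit z gap_refl[OF False]])
      moreover have "sgn (poly p' (k y)) = sgn (k y - k z) * sgn (poly (pderiv p') (k z))"
        by (rule poly_sgn_near_root[OF crit' kgap[OF z(1)] root kgap[OF gap_refl[OF False]]])
      moreover have "sgn (poly (pderiv p) z) = sgn (poly (pderiv p') (k z))"
        using calculation der(1) \<open>\<And>y q' q. (q, q') \<in> Q \<Longrightarrow> sgn (poly q y) = sgn (poly q' (k y))\<close> by blast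
      moreover have "sgn (y - z) = sgn (k y - k z)"
        using strict_mono_less[OF k(1)] strict_mono_eq[OF k(1)] by (auto simp: sgn_if)
      ultimately show ?thesis
        by simp
    next
      case noroot: False
      then have noroot': "\<not> (\<exists>z\<in>gap (h ` Z) (h y). poly p' z = 0)"
        using poly_root_on_gap_iff[OF Z crit] poly_root_on_gap_iff[OF Z' crit'] transfer by simp
      have s: "sgn (poly p w) = sgn (poly p y)" if "w \<in> gap Z y" for w
        using poly_sgn_gap[of Z y p, OF _ that gap_refl[OF False]] noroot by blast
      have s': "sgn (poly p' w) = sgn (poly p' (k y))" if "w \<in> gap (h ` Z) (h y)" for w
        using poly_sgn_gap[of "h ` Z" "h y" p', OF _ that kgap[OF gap_refl[OF False]]] noroot' by blast
      have "poly p y \<noteq> 0"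
        using noroot gap_refl[OF False] by blast
      then consider "poly p y < 0" | "poly p y > 0"
        by linarith
      then show ?thesis
      proof cases
        case 1
        then obtain w where "w \<in> gap (h ` Z) (h y)" "poly p' w < 0"
          using transfer(1) gap_refl[OF False] by blast
        with s'[of w] 1 show ?thesis
          by simp
      next
        case 2
        then obtain w where "w \<in> gap (h ` Z) (h y)" "poly p' w > 0"
          using transfer(2) gap_refl[OF False] by blast
        with s'[of w] 2 show ?thesis
          by simp
      qed
    qed
  qed
  ultimately show ?thesis
    using k(1,2) by blast
qed

section \<open>Quantifier elimination over the reals\<close>

definition sgn_equiv :: "('e \<Rightarrow> real) set \<Rightarrow> 'e \<Rightarrow> 'e \<Rightarrow> bool" where
  "sgn_equiv \<Phi> e e' \<longleftrightarrow> (\<forall>f\<in>\<Phi>. sgn (f e) = sgn (f e'))"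

text \<open>One \<open>h\<close> must serve all of \<open>\<Gamma>\<close>, so this compares how the
  roots of the different polynomials interleave and not only the sign sequence of each.\<close>

definition sign_matched :: "('e \<Rightarrow> real poly) set \<Rightarrow> 'e \<Rightarrow> 'e \<Rightarrow> bool" where
  "sign_matched \<Gamma> e e' \<longleftrightarrow>
     (\<exists>h. strict_mono h \<and> surj h \<and> (\<forall>p\<in>\<Gamma>. \<forall>y. sgn (poly (p e) y) = sgn (poly (p e') (h y))))"

text \<open>Elimination forms only ring operations on coefficients. These are functions of a
  parameter \<open>e\<close>, which will be the assignment to the remaining variables.\<close>

locale real_function_ring =
  fixes A :: "('e \<Rightarrow> real) set"
  assumes zero: "(\<lambda>_. 0) \<in> A"
    and one: "(\<lambda>_. 1) \<in> A"
    and add: "f \<in> A \<Longrightarrow> g \<in> A \<Longrightarrow> (\<lambda>e. f e + g e) \<in> A"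
    and mult: "f \<in> A \<Longrightarrow> g \<in> A \<Longrightarrow> (\<lambda>e. f e * g e) \<in> A"
    and minus: "f \<in> A \<Longrightarrow> (\<lambda>e. - f e) \<in> A"
begin

text \<open>\<open>n\<close> bounds the number of coefficients uniformly in \<open>e\<close>; the
  actual degree varies with \<open>e\<close>, as leading coefficients may vanish.\<close>

definition poly_family :: "nat \<Rightarrow> ('e \<Rightarrow> real poly) \<Rightarrow> bool" where
  "poly_family n p \<longleftrightarrow> (\<forall>i. (\<lambda>e. coeff (p e) i) \<in> A) \<and> (\<forall>e. \<forall>i\<ge>n. coeff (p e) i = 0)"

lemma diff: "f \<in> A \<Longrightarrow> g \<in> A \<Longrightarrow> (\<lambda>e. f e - g e) \<in> A"
  using add[OF _ minus] by simp

lemma of_nat: "(\<lambda>_. of_nat k) \<in> A"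
  by (induction k) (auto intro: zero add one)

lemma sum: "(\<And>i. i \<in> I \<Longrightarrow> f i \<in> A) \<Longrightarrow> (\<lambda>e. \<Sum>i\<in>I. f i e) \<in> A"
  by (induction I rule: infinite_finite_induct) (auto intro: zero add)

lemma poly_family_pderiv:
  assumes "poly_family (Suc n) p"
  shows "poly_family n (\<lambda>e. pderiv (p e))"
  using assms mult[OF of_nat] by (auto simp: poly_family_def coeff_pderiv simp del: of_nat_Suc)

lemma poly_family_cutoff:
  assumes "poly_family n p"
  shows "poly_family k (\<lambda>e. poly_cutoff k (p e))"
proof -
  have "(\<lambda>e. coeff (poly_cutoff k (p e)) i) \<in> A" for i
    using assms zero by (cases "i < k") (auto simp: poly_family_def coeff_poly_cutoff)
  then show ?thesis
    by (simp add: poly_family_def coeff_poly_cutoff)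
qed

text \<open>
  The multiplier of \<open>p\<close> in this step of pseudo-division is the square of the leading coefficient of
  \<open>q\<close>, so that the sign of \<open>p\<close> at the roots of \<open>q\<close> is kept.
\<close>

definition reduct :: "nat \<Rightarrow> nat \<Rightarrow> real poly \<Rightarrow> real poly \<Rightarrow> real poly" where
  "reduct m k p q = smult ((coeff q k)\<^sup>2) p
     - smult (coeff q k * coeff p m) (monom 1 (m - k) * poly_cutoff (Suc k) q)"

text \<open>The coefficient of degree \<open>m\<close> cancels for every parameter because
  \<open>q\<close> is cut off above \<open>k\<close>. Where \<open>k\<close> is not the degree of
  \<open>q e\<close>, the reduct is no remainder, but the bound on its length persists.\<close>

lemma poly_family_reduct:
  assumes p: "poly_family (Suc m) p" and q: "poly_family n q" and "k \<le> m"
  shows "poly_family m (\<lambda>e. reduct m k (p e) (q e))"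
proof -
  have A: "(\<lambda>e. coeff (p e) i) \<in> A" "(\<lambda>e. coeff (q e) i) \<in> A" for i
    using p q by (auto simp: poly_family_def)
  have mon: "(\<lambda>e. coeff (monom 1 (m - k) * poly_cutoff (Suc k) (q e)) i) \<in> A" for i
    using A zero by (cases "i < m - k"; cases "i - (m - k) < Suc k") (auto simp: coeff_monom_mult coeff_poly_cutoff)
  have "(\<lambda>e. coeff (reduct m k (p e) (q e)) i) \<in> A" for i
    unfolding reduct_def coeff_diff coeff_smult power2_eq_square by (intro diff mult A mon)
  moreover have "coeff (reduct m k (p e) (q e)) i = 0" if "i \<ge> m" for e i
  proof (cases "i = m")
    case True
    then show ?thesis
      using \<open>k \<le> m\<close> by (simp add: reduct_def coeff_monom_mult coeff_poly_cutoff power2_eq_square)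
  next
    case False
    then have "coeff (p e) i = 0"
      using p that by (simp add: poly_family_def)
    moreover have "\<not> i - (m - k) < Suc k" "\<not> i < m - k"
      using False that \<open>k \<le> m\<close> by auto
    ultimately show ?thesis
      by (simp add: reduct_def coeff_monom_mult coeff_poly_cutoff)
  qed
  ultimately show ?thesis
    by (simp add: poly_family_def)
qed

lemma poly_cutoff_eq_self: "(\<And>i. i \<ge> k \<Longrightarrow> coeff p i = 0) \<Longrightarrow> poly_cutoff k p = p"
  by (rule poly_eqI) (simp add: coeff_poly_cutoff)

text \<open>To redraw \<open>h\<close> for \<open>p\<close>, its derivative and the signs of
  \<open>p\<close> at the roots of the other polynomials must be matched; the reducts supply these
  signs. The degree of \<open>q e\<close> depends on \<open>e\<close>, hence reducts for every
  \<open>k \<le> m\<close>. If the leading coefficient of \<open>p\<close> vanishes,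
  \<open>p\<close> agrees with its cutoff, which is matched already.\<close>

lemma sign_matched_insert:
  assumes G: "finite G" "\<And>q. q \<in> G \<Longrightarrow> poly_family (Suc m) q" and p: "poly_family (Suc m) p"
    and "m > 0"
    and match: "sign_matched (G \<union> {\<lambda>e. poly_cutoff m (p e), \<lambda>e. pderiv (p e)} \<union>
      (\<lambda>(k, q). \<lambda>e. reduct m k (p e) (q e)) ` ({..m} \<times> insert (\<lambda>e. pderiv (p e)) G)) e e'"
    and sgn: "sgn_equiv ((\<lambda>(k, q). \<lambda>e. coeff (q e) k) ` ({..m} \<times> insert p (insert (\<lambda>e. pderiv (p e)) G))) e e'"
  shows "sign_matched (insert p G) e e'"
proof -
  let ?T = "insert (\<lambda>e. pderiv (p e)) G"
  have T: "poly_family (Suc m) q" if "q \<in> ?T" for q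
    using that G(2) poly_family_pderiv[OF p] by (auto simp: poly_family_def)
  have sgn: "sgn (coeff (q e) k) = sgn (coeff (q e') k)" if "k \<le> m" "q \<in> insert p ?T" for k q
    using sgn that by (force simp: sgn_equiv_def)
  obtain h where h: "strict_mono h" "surj h"
    and hG: "\<And>q y. q \<in> ?T \<Longrightarrow> sgn (poly (q e) y) = sgn (poly (q e') (h y))"
    and hcut: "\<And>y. sgn (poly (poly_cutoff m (p e)) y) = sgn (poly (poly_cutoff m (p e')) (h y))"
    and hred: "\<And>k q y. k \<le> m \<Longrightarrow> q \<in> ?T \<Longrightarrow>
      sgn (poly (reduct m k (p e) (q e)) y) = sgn (poly (reduct m k (p e') (q e')) (h y))"
    using match unfolding sign_matched_def by (fastforce simp: ball_Un image_iff)
  show ?thesis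
  proof (cases "coeff (p e) m = 0")
    case True
    then have "coeff (p e') m = 0"
      using sgn[of m p] by (simp add: sgn_eq_0_iff)
    moreover have "coeff (p x) i = 0" if "i \<ge> m" "coeff (p x) m = 0" for i x
      using p that by (cases "i = m") (auto simp: poly_family_def)
    ultimately have "poly_cutoff m (p e) = p e" "poly_cutoff m (p e') = p e'"
      using True by (simp_all add: poly_cutoff_eq_self)
    with h hG hcut show ?thesis
      unfolding sign_matched_def by (intro exI[of _ h]) auto
  next
    case False
    let ?Q = "(\<lambda>q. (q e, q e')) ` ?T"
    have "coeff (pderiv (p e)) (m - 1) \<noteq> 0"
      using False \<open>m > 0\<close> by (simp add: coeff_pderiv)
    then have nz: "pderiv (p e) \<noteq> 0"
      by auto
    have sq: "sgn (c\<^sup>2 * x) = sgn x" if "c \<noteq> 0" for c x :: real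
      using sgn_pos[of "c\<^sup>2"] that unfolding sgn_mult by simp
    have val: "sgn (poly (p e) y) = sgn (poly (p e') (h y))"
      if q: "q \<in> ?T" "q e \<noteq> 0" "poly (q e) y = 0" for q y
    proof -
      \<comment> \<open>The true degree of \<open>q\<close> at \<open>e\<close>. Equal signs of
        coefficients give \<open>q\<close> the same degree at \<open>e'\<close>, so the reducts on
        both sides are genuine remainders.\<close>
      define k where "k = degree (q e)"
      have lc: "coeff (q e) k \<noteq> 0"
        using q(2) by (simp add: k_def)
      then have "k \<le> m"
        using T[OF q(1)] unfolding poly_family_def by (meson not_less_eq_eq)
      then have lc': "coeff (q e') k \<noteq> 0"
        using sgn[of k q] lc q(1) by (auto simp: sgn_eq_0_iff)
      have cut: "poly_cutoff (Suc k) (q e) = q e"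
        by (rule poly_cutoff_eq_self) (simp add: k_def coeff_eq_0)
      have cut': "poly_cutoff (Suc k) (q e') = q e'"
      proof (rule poly_cutoff_eq_self)
        fix i assume "i \<ge> Suc k"
        show "coeff (q e') i = 0"
        proof (cases "i \<le> m")
          case True
          have "coeff (q e) i = 0"
            using \<open>i \<ge> Suc k\<close> by (simp add: k_def coeff_eq_0)
          then show ?thesis
            using sgn[OF True, of q] q(1) by (simp add: sgn_eq_0_iff)
        next
          case False
          then show ?thesis
            using T[OF q(1)] by (simp add: poly_family_def)
        qed
      qed
      have "poly (q e') (h y) = 0"
        using hG[OF q(1), of y] q(3) by (simp add: sgn_eq_0_iff)
      then have "sgn (poly (reduct m k (p e') (q e')) (h y)) = sgn (poly (p e') (h y))"
        using lc' by (simp add: reduct_def cut' sq)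
      moreover have "sgn (poly (reduct m k (p e) (q e)) y) = sgn (poly (p e) y)"
        using lc q(3) by (simp add: reduct_def cut sq)
      ultimately show ?thesis
        using hred[OF \<open>k \<le> m\<close> q(1), of y] by simp
    qed
    have "\<exists>k. strict_mono k \<and> surj k \<and> (\<forall>y. sgn (poly (p e) y) = sgn (poly (p e') (k y))) \<and>
      (\<forall>(q, q')\<in>?Q. \<forall>y. sgn (poly q y) = sgn (poly q' (k y)))"
    proof (rule sign_preserving_extend[OF h])
      show "sgn (poly q y) = sgn (poly q' (h y))" if "(q, q') \<in> ?Q" for q q' y
        using that hG by blast
      show "sgn (poly (p e) y) = sgn (poly (p e') (h y))"
        if "(q, q') \<in> ?Q" "q \<noteq> 0" "poly q y = 0" for q q' y
        using that val by blast
    qed (use G(1) nz in auto)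
    then show ?thesis
      unfolding sign_matched_def by auto
  qed
qed

text \<open>Induction on the length, and inside it on the set \<open>H\<close> of polynomials of
  maximal length: one of them is traded for its derivative, its cutoff and reducts, which are
  shorter and join \<open>G\<close>.\<close>

theorem sign_matched_if_sgn_equiv:
  assumes "finite \<Gamma>" "\<And>p. p \<in> \<Gamma> \<Longrightarrow> poly_family n p"
  shows "\<exists>\<Phi>. finite \<Phi> \<and> \<Phi> \<subseteq> A \<and> (\<forall>e e'. sgn_equiv \<Phi> e e' \<longrightarrow> sign_matched \<Gamma> e e')"
  using assms
proof (induction n arbitrary: \<Gamma>)
  case 0
  have "sgn (poly (p e) y) = sgn (poly (p e') (id y))" if "p \<in> \<Gamma>" for p e e' y
  proof -
    have "p x = 0" for x
      using 0(2)[OF that] by (auto simp: poly_family_def poly_eq_iff)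
    then show ?thesis
      by simp
  qed
  moreover have "strict_mono (id :: real \<Rightarrow> real)"
    by (simp add: strict_mono_def)
  ultimately have "sign_matched \<Gamma> e e'" for e e'
    unfolding sign_matched_def using surj_id by metis
  then show ?case
    by (intro exI[of _ "{}"]) simp
next
  case (Suc m)
  have "\<exists>\<Phi>. finite \<Phi> \<and> \<Phi> \<subseteq> A \<and> (\<forall>e e'. sgn_equiv \<Phi> e e' \<longrightarrow> sign_matched (G \<union> H) e e')"
    if "finite H" "finite G" "\<And>p. p \<in> H \<Longrightarrow> poly_family (Suc m) p" "\<And>p. p \<in> G \<Longrightarrow> poly_family m p" for G H
    using that
  proof (induction H arbitrary: G rule: finite_induct)
    case empty
    then show ?case
      using Suc.IH[of G] by simp
  next
    case (insert p H)
    have p: "poly_family (Suc m) p"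
      using insert.prems by simp
    have GH: "poly_family (Suc m) q" if "q \<in> G \<union> H" for q
      using that insert.prems by (auto simp: poly_family_def)
    show ?case
    proof (cases "m = 0")
      \<comment> \<open>The polynomial is constant, so its derivative gives nothing to work with;
        its sign is itself a condition on \<open>e\<close>.\<close>
      case True
      obtain \<Phi> where \<Phi>: "finite \<Phi>" "\<Phi> \<subseteq> A" "\<And>e e'. sgn_equiv \<Phi> e e' \<Longrightarrow> sign_matched (G \<union> H) e e'"
        using insert.IH[of G] insert.prems by auto
      have const: "p e = [:coeff (p e) 0:]" for e
      proof (rule poly_eqI)
        show "coeff (p e) i = coeff [:coeff (p e) 0:] i" for i
          using p True by (cases i) (auto simp: poly_family_def)
      qed
      have "poly (p e) y = coeff (p e) 0" for e y
        by (subst const) simp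
      then have "sign_matched (G \<union> insert p H) e e'" if "sgn_equiv (insert (\<lambda>e. coeff (p e) 0) \<Phi>) e e'" for e e'
        using that \<Phi>(3)[of e e'] by (auto simp: sgn_equiv_def sign_matched_def)
      moreover have "(\<lambda>e. coeff (p e) 0) \<in> A"
        using p by (simp add: poly_family_def)
      ultimately show ?thesis
        using \<Phi>(1,2) by (intro exI[of _ "insert (\<lambda>e. coeff (p e) 0) \<Phi>"]) auto
    next
      case False
      let ?d = "\<lambda>e. pderiv (p e)"
      let ?N = "{\<lambda>e. poly_cutoff m (p e), ?d} \<union>
        (\<lambda>(k, q). \<lambda>e. reduct m k (p e) (q e)) ` ({..m} \<times> insert ?d (G \<union> H))"
      let ?C = "(\<lambda>(k, q). \<lambda>e. coeff (q e) k) ` ({..m} \<times> insert p (insert ?d (G \<union> H)))"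
      have d: "poly_family m ?d"
        by (rule poly_family_pderiv[OF p])
      have fin: "finite (G \<union> ?N)" "finite ?C" "finite (G \<union> H)"
        using insert.hyps insert.prems by auto
      have N: "poly_family m q" if q: "q \<in> G \<union> ?N" for q
      proof -
        have GHd: "poly_family (Suc m) r" if "r \<in> insert ?d (G \<union> H)" for r
          using that GH d by (auto simp: poly_family_def)
        consider "q \<in> G" | "q = (\<lambda>e. poly_cutoff m (p e))" | "q = ?d"
          | k r where "k \<le> m" "r \<in> insert ?d (G \<union> H)" "q = (\<lambda>e. reduct m k (p e) (r e))"
          using q by (elim UnE insertE emptyE imageE) auto
        then show ?thesis
          by cases (use insert.prems(3) d poly_family_cutoff[OF p] poly_family_reduct[OF p GHd] in simp_all)
      qed
      have H: "poly_family (Suc m) q" if "q \<in> H" for q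
        using insert.prems that by simp
      obtain \<Phi> where \<Phi>: "finite \<Phi>" "\<Phi> \<subseteq> A"
        "\<And>e e'. sgn_equiv \<Phi> e e' \<Longrightarrow> sign_matched (G \<union> ?N \<union> H) e e'"
        by (rule exE[OF insert.IH[OF fin(1) H N]]) (assumption, assumption, elim conjE, simp)
      have "sign_matched (G \<union> insert p H) e e'" if "sgn_equiv (\<Phi> \<union> ?C) e e'" for e e'
      proof -
        have "sign_matched (insert p (G \<union> H)) e e'"
        proof (rule sign_matched_insert[OF fin(3) GH p])
          have "sign_matched (G \<union> ?N \<union> H) e e'"
            using that by (intro \<Phi>(3)) (auto simp: sgn_equiv_def)
          then show "sign_matched (G \<union> H \<union> {\<lambda>e. poly_cutoff m (p e), ?d} \<union>
              (\<lambda>(k, q). \<lambda>e. reduct m k (p e) (q e)) ` ({..m} \<times> insert ?d (G \<union> H))) e e'"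
            by (simp add: Un_ac)
          show "sgn_equiv ?C e e'"
            using that by (auto simp: sgn_equiv_def)
        qed (use False in auto)
        then show ?thesis
          by simp
      qed
      moreover have "?C \<subseteq> A"
        using p d GH by (auto simp: poly_family_def)
      ultimately show ?thesis
        using \<Phi>(1,2) fin(2) by (intro exI[of _ "\<Phi> \<union> ?C"]) blast
    qed
  qed
  from this[of \<Gamma> "{}"] Suc.prems show ?case
    by simp
qed

end

section \<open>Polynomial terms with countably many constants\<close>

datatype pt = PVar nat | PConst nat | PAdd pt pt | PMul pt pt | PNeg pt

instance pt :: countable
  by countable_datatype

text \<open>Constants are indices into a sequence \<open>\<kappa>\<close> of reals. This keeps the
  set of terms countable, as the Baire argument on the sphere requires, while
  \<open>\<kappa>\<close> may list the coordinates of a dense set.\<close>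

primrec peval :: "(nat \<Rightarrow> real) \<Rightarrow> (nat \<Rightarrow> real) \<Rightarrow> pt \<Rightarrow> real" where
  "peval \<kappa> e (PVar i) = e i"
| "peval \<kappa> e (PConst k) = \<kappa> k"
| "peval \<kappa> e (PAdd s t) = peval \<kappa> e s + peval \<kappa> e t"
| "peval \<kappa> e (PMul s t) = peval \<kappa> e s * peval \<kappa> e t"
| "peval \<kappa> e (PNeg t) = - peval \<kappa> e t"

primrec pvars :: "pt \<Rightarrow> nat set" where
  "pvars (PVar i) = {i}"
| "pvars (PConst k) = {}"
| "pvars (PAdd s t) = pvars s \<union> pvars t"
| "pvars (PMul s t) = pvars s \<union> pvars t"
| "pvars (PNeg t) = pvars t"

primrec psubst :: "(nat \<Rightarrow> pt) \<Rightarrow> pt \<Rightarrow> pt" where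
  "psubst \<sigma> (PVar i) = \<sigma> i"
| "psubst \<sigma> (PConst k) = PConst k"
| "psubst \<sigma> (PAdd s t) = PAdd (psubst \<sigma> s) (psubst \<sigma> t)"
| "psubst \<sigma> (PMul s t) = PMul (psubst \<sigma> s) (psubst \<sigma> t)"
| "psubst \<sigma> (PNeg t) = PNeg (psubst \<sigma> t)"

lemma peval_psubst: "peval \<kappa> e (psubst \<sigma> t) = peval \<kappa> (\<lambda>i. peval \<kappa> e (\<sigma> i)) t"
  by (induction t) auto

lemma pvars_psubst: "pvars (psubst \<sigma> t) = (\<Union>i\<in>pvars t. pvars (\<sigma> i))"
  by (induction t) auto

lemma finite_pvars: "finite (pvars t)"
  by (induction t) auto

lemma peval_cong: "(\<And>i. i \<in> pvars t \<Longrightarrow> e i = e' i) \<Longrightarrow> peval \<kappa> e t = peval \<kappa> e' t"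
  by (induction t) auto

primrec ppoly :: "(nat \<Rightarrow> real) \<Rightarrow> nat \<Rightarrow> pt \<Rightarrow> (nat \<Rightarrow> real) \<Rightarrow> real poly" where
  "ppoly \<kappa> n (PVar i) e = (if i = n then [:0, 1:] else [:e i:])"
| "ppoly \<kappa> n (PConst k) e = [:\<kappa> k:]"
| "ppoly \<kappa> n (PAdd s t) e = ppoly \<kappa> n s e + ppoly \<kappa> n t e"
| "ppoly \<kappa> n (PMul s t) e = ppoly \<kappa> n s e * ppoly \<kappa> n t e"
| "ppoly \<kappa> n (PNeg t) e = - ppoly \<kappa> n t e"

lemma poly_ppoly: "poly (ppoly \<kappa> n t e) u = peval \<kappa> (e(n := u)) t"
  by (induction t) auto

definition pfuns :: "(nat \<Rightarrow> real) \<Rightarrow> ((nat \<Rightarrow> real) \<Rightarrow> real) set" where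
  "pfuns \<kappa> = range (\<lambda>t e. peval \<kappa> e t)"

lemma real_function_ring_pfuns:
  assumes "1 \<in> range \<kappa>"
  shows "real_function_ring (pfuns \<kappa>)"
proof
  obtain k where k: "\<kappa> k = 1"
    using assms by auto
  have I: "(\<lambda>e. peval \<kappa> e t) \<in> pfuns \<kappa>" for t
    by (simp add: pfuns_def)
  show "(\<lambda>_. 0) \<in> pfuns \<kappa>"
    using I[of "PAdd (PConst k) (PNeg (PConst k))"] by simp
  show "(\<lambda>_. 1) \<in> pfuns \<kappa>"
    using I[of "PConst k"] k by simp
  fix f g assume "f \<in> pfuns \<kappa>"
  then obtain s where s: "f = (\<lambda>e. peval \<kappa> e s)"
    by (auto simp: pfuns_def)
  show "(\<lambda>e. - f e) \<in> pfuns \<kappa>"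
    using I[of "PNeg s"] s by simp
  assume "g \<in> pfuns \<kappa>"
  then obtain t where t: "g = (\<lambda>e. peval \<kappa> e t)"
    by (auto simp: pfuns_def)
  show "(\<lambda>e. f e + g e) \<in> pfuns \<kappa>" "(\<lambda>e. f e * g e) \<in> pfuns \<kappa>"
    using I[of "PAdd s t"] I[of "PMul s t"] s t by simp_all
qed

lemma poly_family_ppoly:
  assumes "1 \<in> range \<kappa>"
  shows "\<exists>m. real_function_ring.poly_family (pfuns \<kappa>) m (ppoly \<kappa> n t)"
proof -
  interpret real_function_ring "pfuns \<kappa>"
    by (rule real_function_ring_pfuns[OF assms])
  have I: "(\<lambda>e. peval \<kappa> e t) \<in> pfuns \<kappa>" for t
    by (simp add: pfuns_def)
  have const: "(\<lambda>e. coeff [:f e:] i) \<in> pfuns \<kappa>" if "f \<in> pfuns \<kappa>" for f i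
    using that zero by (cases i) auto
  have "(\<lambda>e. coeff (ppoly \<kappa> n t e) i) \<in> pfuns \<kappa>" for i
  proof (induction t arbitrary: i)
    case (PVar j)
    have "(\<lambda>e. coeff [:0, 1::real:] i) \<in> pfuns \<kappa>"
      using zero one by (auto simp: coeff_pCons split: nat.split)
    then show ?case
      using const[of "\<lambda>e. e j"] I[of "PVar j"] by (cases "j = n") simp_all
  next
    case (PConst k)
    then show ?case
      using const[of "\<lambda>e. \<kappa> k"] I[of "PConst k"] by simp
  next
    case (PMul s t)
    then show ?case
      by (auto simp: coeff_mult intro!: sum mult)
  qed (auto intro: add minus)
  moreover have "\<exists>m. \<forall>e. degree (ppoly \<kappa> n t e) < m"
  proof (induction t)
    case (PVar j)
    show ?case
      by (intro exI[of _ 2]) auto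
  next
    case (PAdd s t)
    then obtain a b where "\<forall>e. degree (ppoly \<kappa> n s e) < a" "\<forall>e. degree (ppoly \<kappa> n t e) < b"
      by blast
    then have "degree (ppoly \<kappa> n s e + ppoly \<kappa> n t e) < max a b" for e
      by (intro degree_add_less) (auto simp: less_max_iff_disj)
    then show ?case
      by auto
  next
    case (PMul s t)
    then obtain a b where "\<forall>e. degree (ppoly \<kappa> n s e) < a" "\<forall>e. degree (ppoly \<kappa> n t e) < b"
      by blast
    then have "degree (ppoly \<kappa> n s e * ppoly \<kappa> n t e) < a + b" for e
      by (intro le_less_trans[OF degree_mult_le] add_strict_mono) auto
    then show ?case
      by auto
  qed auto
  ultimately show ?thesis
    unfolding poly_family_def by (meson coeff_eq_0 order_less_le_trans)
qed

lemma peval_of_rtm: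
  assumes "{1, r, cos (1 / r)} \<subseteq> range \<kappa>"
  shows "\<exists>t. \<forall>e. peval \<kappa> e t = rtm_val r e s"
proof (induction s)
  case (Var i)
  show ?case by (intro exI[of _ "PVar i"]) simp
next
  case Zero
  show ?case by (intro exI[of _ "PAdd (PConst 0) (PNeg (PConst 0))"]) simp
next
  case One
  obtain k where "\<kappa> k = 1" using assms by (metis insert_subset rangeE)
  then show ?case by (intro exI[of _ "PConst k"]) simp
next
  case Radius
  obtain k where "\<kappa> k = r" using assms by (metis insert_subset rangeE)
  then show ?case by (intro exI[of _ "PConst k"]) simp
next
  case CosInv
  obtain k where "\<kappa> k = cos (1 / r)" using assms by (metis insert_subset rangeE)
  then show ?case by (intro exI[of _ "PConst k"]) simp
next
  case (Add s t)
  then obtain a b where "\<forall>e. peval \<kappa> e a = rtm_val r e s" "\<forall>e. peval \<kappa> e b = rtm_val r e t" by blast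
  then show ?case by (intro exI[of _ "PAdd a b"]) simp
next
  case (Mul s t)
  then obtain a b where "\<forall>e. peval \<kappa> e a = rtm_val r e s" "\<forall>e. peval \<kappa> e b = rtm_val r e t" by blast
  then show ?case by (intro exI[of _ "PMul a b"]) simp
qed

text \<open>
  This amounts to quantifier elimination: \<open>\<phi>\<close> is equivalent to a Boolean combination of sign
  conditions on the terms in \<open>\<Phi>\<close>. An order isomorphism that preserves the signs of polynomials carries
  witnesses of \<open>Ex n \<phi>\<close> to witnesses.
\<close>

theorem sat_determined_by_signs:
  assumes \<kappa>: "{1, r, cos (1 / r)} \<subseteq> range \<kappa>"
  shows "\<exists>\<Phi>. finite \<Phi> \<and> (\<forall>e e'. (\<forall>t\<in>\<Phi>. sgn (peval \<kappa> e t) = sgn (peval \<kappa> e' t)) \<longrightarrow>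
    sat (real_atom_holds r) UNIV \<phi> e = sat (real_atom_holds r) UNIV \<phi> e')"
proof (induction \<phi>)
  case (Atom a)
  have "\<exists>t. \<forall>e. sgn (peval \<kappa> e t) = sgn (rtm_val r e u - rtm_val r e v)" for u v
  proof -
    obtain a b where "\<forall>e. peval \<kappa> e a = rtm_val r e u" "\<forall>e. peval \<kappa> e b = rtm_val r e v"
      using peval_of_rtm[OF \<kappa>] by metis
    then show ?thesis by (intro exI[of _ "PAdd a (PNeg b)"]) simp
  qed
  moreover obtain u v where "a = EqT u v \<or> a = LessT u v"
    by (cases a) auto
  ultimately obtain t where t: "\<forall>e. sgn (peval \<kappa> e t) = sgn (rtm_val r e u - rtm_val r e v)"
    by blast
  have "real_atom_holds r a e \<longleftrightarrow> real_atom_holds r a e'" if "sgn (peval \<kappa> e t) = sgn (peval \<kappa> e' t)" for e e'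
  proof -
    have "sgn (rtm_val r e u - rtm_val r e v) = sgn (rtm_val r e' u - rtm_val r e' v)"
      using that t by simp
    then have "(rtm_val r e u - rtm_val r e v = 0 \<longleftrightarrow> rtm_val r e' u - rtm_val r e' v = 0) \<and>
        (rtm_val r e u - rtm_val r e v < 0 \<longleftrightarrow> rtm_val r e' u - rtm_val r e' v < 0)"
      by (metis sgn_0_0 sgn_less)
    with \<open>a = EqT u v \<or> a = LessT u v\<close> show ?thesis
      by (elim disjE) simp_all
  qed
  then have "\<forall>e e'. (\<forall>t\<in>{t}. sgn (peval \<kappa> e t) = sgn (peval \<kappa> e' t)) \<longrightarrow>
      sat (real_atom_holds r) UNIV (Atom a) e = sat (real_atom_holds r) UNIV (Atom a) e'"
    unfolding sat.simps by blast
  then show ?case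
    by (metis finite.emptyI finite.insertI)
next
  case (Neg \<phi>)
  then show ?case
    by (simp only: sat.simps not_iff simp_thms)
next
  case (Conj \<phi> \<psi>)
  from Conj.IH(1) obtain \<Phi> where \<Phi>: "finite \<Phi>"
    "\<forall>e e'. (\<forall>t\<in>\<Phi>. sgn (peval \<kappa> e t) = sgn (peval \<kappa> e' t)) \<longrightarrow>
      sat (real_atom_holds r) UNIV \<phi> e = sat (real_atom_holds r) UNIV \<phi> e'"
    by (elim exE conjE)
  from Conj.IH(2) obtain \<Psi> where \<Psi>: "finite \<Psi>"
    "\<forall>e e'. (\<forall>t\<in>\<Psi>. sgn (peval \<kappa> e t) = sgn (peval \<kappa> e' t)) \<longrightarrow>
      sat (real_atom_holds r) UNIV \<psi> e = sat (real_atom_holds r) UNIV \<psi> e'"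
    by (elim exE conjE)
  have "\<forall>e e'. (\<forall>t\<in>\<Phi> \<union> \<Psi>. sgn (peval \<kappa> e t) = sgn (peval \<kappa> e' t)) \<longrightarrow>
      sat (real_atom_holds r) UNIV (Conj \<phi> \<psi>) e = sat (real_atom_holds r) UNIV (Conj \<phi> \<psi>) e'"
    unfolding sat.simps ball_Un using \<Phi>(2) \<Psi>(2) by blast
  with \<Phi>(1) \<Psi>(1) show ?case
    by (meson finite_UnI)
next
  case (Ex n \<phi>)
  interpret real_function_ring "pfuns \<kappa>"
    using \<kappa> by (intro real_function_ring_pfuns) auto
  obtain \<Phi> where \<Phi>: "finite \<Phi>" "\<And>e e'. (\<And>t. t \<in> \<Phi> \<Longrightarrow> sgn (peval \<kappa> e t) = sgn (peval \<kappa> e' t)) \<Longrightarrow>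
      sat (real_atom_holds r) UNIV \<phi> e = sat (real_atom_holds r) UNIV \<phi> e'"
    using Ex.IH by metis
  have "\<forall>t. \<exists>m. poly_family m (ppoly \<kappa> n t)"
    using poly_family_ppoly \<kappa> by auto
  then obtain d where d: "\<And>t. poly_family (d t) (ppoly \<kappa> n t)"
    by metis
  define N where "N = Max (insert 0 (d ` \<Phi>))"
  have "poly_family N p" if p: "p \<in> ppoly \<kappa> n ` \<Phi>" for p
  proof -
    obtain t where "t \<in> \<Phi>" "p = ppoly \<kappa> n t"
      using p by blast
    then have "d t \<le> N"
      unfolding N_def using \<Phi>(1) by (intro Max_ge) auto
    with d[of t] \<open>p = ppoly \<kappa> n t\<close> show ?thesis
      by (auto simp: poly_family_def)
  qed
  then have "\<exists>\<Psi>. finite \<Psi> \<and> \<Psi> \<subseteq> pfuns \<kappa> \<and>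
      (\<forall>e e'. sgn_equiv \<Psi> e e' \<longrightarrow> sign_matched (ppoly \<kappa> n ` \<Phi>) e e')"
    using \<Phi>(1) by (intro sign_matched_if_sgn_equiv) auto
  then
  obtain \<Psi> where \<Psi>: "finite \<Psi>" "\<Psi> \<subseteq> pfuns \<kappa>"
    "\<forall>e e'. sgn_equiv \<Psi> e e' \<longrightarrow> sign_matched (ppoly \<kappa> n ` \<Phi>) e e'"
    by (elim exE conjE)
  obtain \<Theta> where \<Theta>: "finite \<Theta>" "\<Psi> = (\<lambda>t e. peval \<kappa> e t) ` \<Theta>"
    using finite_subset_image[OF \<Psi>(1) \<Psi>(2)[unfolded pfuns_def]] by (elim exE conjE)
  have "sat (real_atom_holds r) UNIV (Ex n \<phi>) e = sat (real_atom_holds r) UNIV (Ex n \<phi>) e'"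
    if "\<forall>t\<in>\<Theta>. sgn (peval \<kappa> e t) = sgn (peval \<kappa> e' t)" for e e'
  proof -
    have "sgn_equiv \<Psi> e e'"
      using that \<Theta>(2) by (simp add: sgn_equiv_def)
    with \<Psi>(3) have "sign_matched (ppoly \<kappa> n ` \<Phi>) e e'"
      by (elim allE impE)
    then obtain h where h: "surj h"
      "\<And>t u. t \<in> \<Phi> \<Longrightarrow> sgn (poly (ppoly \<kappa> n t e) u) = sgn (poly (ppoly \<kappa> n t e') (h u))"
      unfolding sign_matched_def by (elim exE conjE) (simp only: ball_simps)
    have *: "sat (real_atom_holds r) UNIV \<phi> (e(n := u)) = sat (real_atom_holds r) UNIV \<phi> (e'(n := h u))" for u
      using h(2) by (intro \<Phi>(2)) (simp add: poly_ppoly)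
    have "(\<exists>u. sat (real_atom_holds r) UNIV \<phi> (e'(n := u))) \<longleftrightarrow>
        (\<exists>u. sat (real_atom_holds r) UNIV \<phi> (e'(n := h u)))"
      using h(1) by (metis surjD)
    then show ?thesis
      by (simp add: *)
  qed
  then show ?case
    using \<Theta>(1) by blast
qed

lemma sat_cong_fvars:
  assumes "\<And>a e e'. (\<And>i. i \<in> va a \<Longrightarrow> e i = e' i) \<Longrightarrow> I a e = I a e'"
    and "\<And>i. i \<in> fvars va \<phi> \<Longrightarrow> e i = e' i"
  shows "sat I D \<phi> e = sat I D \<phi> e'"
  using assms(2)
proof (induction \<phi> arbitrary: e e')
  case (Atom a)
  then show ?case
    using assms(1)[of a e e'] by simp
next
  case (Neg \<phi>)
  from Neg.IH[of e e'] Neg.prems show ?case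
    by simp
next
  case (Conj \<phi> \<psi>)
  from Conj.IH(1)[of e e'] Conj.IH(2)[of e e'] Conj.prems show ?case
    by simp
next
  case (Ex n \<phi>)
  have "sat I D \<phi> (e(n := u)) = sat I D \<phi> (e'(n := u))" for u
    using Ex.prems by (intro Ex.IH) auto
  then show ?case
    by simp
qed

section \<open>Existence of g.e.c. graphs\<close>

context Metric_space begin

lemma closure_of_eq_M_iff:
  assumes "C \<subseteq> M"
  shows "mtopology closure_of C = M \<longleftrightarrow> (\<forall>x\<in>M. \<forall>\<epsilon>>0. \<exists>y\<in>C. d x y < \<epsilon>)"
  unfolding metric_closure_of using assms by (auto simp: in_mball subset_iff)

text \<open>
  A g.e.c. graph is built vertex by vertex. At stage \<open>n\<close>, a task \<open>(k, is, m)\<close> asks for a new vertex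
  within \<open>1 / (m + 1)\<close> of the \<open>k\<close>-th point of a countable dense set, which is joined to precisely the
  vertices \<open>i\<close> in \<open>is\<close> that are at distance less than 1 from that point. Every task recurs at
  arbitrarily late stages, so vertices that must not be neighbours come before it.
\<close>

theorem gec_graph_exists:
  fixes P :: "(nat \<Rightarrow> 'a) \<Rightarrow> nat \<Rightarrow> 'a \<Rightarrow> bool"
  assumes sep: "separable_space mtopology" and perfect: "mtopology derived_set_of M = M"
    and "M \<noteq> {}"
    and loc: "\<And>f g n v. (\<And>i. i < n \<Longrightarrow> f i = g i) \<Longrightarrow> P f n v = P g n v"
    and fresh: "\<And>f n v i. P f n v \<Longrightarrow> i < n \<Longrightarrow> v \<noteq> f i"
    and ext: "\<And>f n p \<epsilon>. (\<And>i. i < n \<Longrightarrow> f i \<in> M \<and> P f i (f i)) \<Longrightarrow> p \<in> M \<Longrightarrow> \<epsilon> > 0 \<Longrightarrow>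
      \<exists>v\<in>M. d p v < \<epsilon> \<and> P f n v"
  shows "\<exists>s E. gec_graph M d (range s) E \<and> (\<forall>n. P s n (s n)) \<and> inj s"
proof -
  obtain C where C: "countable C" "C \<subseteq> M" "mtopology closure_of C = M"
    using sep by (auto simp: separable_space_def)
  then have "C \<noteq> {}"
    using \<open>M \<noteq> {}\<close> by auto
  define p where "p = from_nat_into C"
  have pC: "range p = C"
    unfolding p_def by (rule range_from_nat_into) fact+
  have pM: "p k \<in> M" for k
    using pC C(2) by auto
  have p_dense: "\<exists>k. d x (p k) < \<epsilon>" if "x \<in> M" "\<epsilon> > 0" for x \<epsilon>
    using C(3) that pC unfolding closure_of_eq_M_iff[OF C(2)] by (metis imageE)
  \<comment> \<open>The first component of the decoded pair is a dummy, so each task has codes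
    beyond any \<open>N\<close>.\<close>
  define task :: "nat \<Rightarrow> nat \<times> nat list \<times> nat" where "task n = from_nat (snd (prod_decode n))" for n
  have task: "\<exists>n\<ge>N. task n = t" for N t
    by (intro exI[of _ "prod_encode (N, to_nat t)"]) (simp add: task_def le_prod_encode_1)
  define Q where "Q f n v \<longleftrightarrow> v \<in> M \<and> P f n v \<and> (case task n of (k, is, m) \<Rightarrow>
    d (p k) v < 1 / Suc m \<and> (\<forall>i\<in>set is. i < n \<longrightarrow> d (p k) (f i) < 1 \<longrightarrow> d v (f i) < 1))"
    for f :: "nat \<Rightarrow> 'a" and n v
  have "\<exists>s. \<forall>n. Q s n (s n)"
  proof (rule dependent_wellorder_choice)
    show "Q f n v = Q g n v" if "\<And>i. i < n \<Longrightarrow> f i = g i" for f g n v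
      using loc[of n f g v, OF that] that unfolding Q_def by (auto split: prod.splits)
  next
    fix n f assume prev: "\<And>i. i < n \<Longrightarrow> Q f i (f i)"
    obtain k "is" m where t: "task n = (k, is, m)"
      by (cases "task n") auto
    define I where "I = {i \<in> set is. i < n \<and> d (p k) (f i) < 1}"
    \<comment> \<open>A vertex within \<open>\<epsilon>\<close> of \<open>p k\<close> stays at
      distance less than 1 from all requested neighbours.\<close>
    define \<epsilon> where "\<epsilon> = Min (insert (1 / Suc m) ((\<lambda>i. 1 - d (p k) (f i)) ` I))"
    have fin: "finite (insert (1 / Suc m) ((\<lambda>i. 1 - d (p k) (f i)) ` I))"
      by (simp add: I_def)
    have "\<epsilon> > 0"
      unfolding \<epsilon>_def using fin by (subst Min_gr_iff) (auto simp: I_def)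
    then obtain v where v: "v \<in> M" "d (p k) v < \<epsilon>" "P f n v"
      using ext[of n f "p k" \<epsilon>] prev pM by (auto simp: Q_def)
    have "\<epsilon> \<le> 1 / Suc m"
      unfolding \<epsilon>_def using fin by (intro Min_le) auto
    moreover have "d v (f i) < 1" if "i \<in> I" for i
    proof -
      have "\<epsilon> \<le> 1 - d (p k) (f i)"
        unfolding \<epsilon>_def using fin that by (intro Min_le) auto
      moreover have "f i \<in> M"
        using prev that by (auto simp: I_def Q_def)
      ultimately show ?thesis
        using v triangle[of v "p k" "f i"] pM[of k] commute[of v "p k"] by linarith
    qed
    ultimately show "\<exists>v. Q f n v"
      using v by (intro exI[of _ v]) (auto simp: Q_def t I_def)
  qed
  then obtain s where s: "\<And>n. Q s n (s n)"
    by blast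
  have sM: "s n \<in> M" and sP: "P s n (s n)" for n
    using s[of n] by (auto simp: Q_def)
  have "s i \<noteq> s n" if "i < n" for i n
    using fresh[OF sP that] by auto
  then have inj: "inj s"
    by (intro injI) (metis linorder_neqE_nat)
  \<comment> \<open>The later of two vertices decides whether they are adjacent; the condition on
    the distance drops requests that are out of reach.\<close>
  define E where "E = {(s i, s n) | i n. (i < n \<and> i \<in> set (fst (snd (task n))) \<or> n < i \<and> n \<in> set (fst (snd (task i)))) \<and> d (s i) (s n) < 1}"
  have E: "(s i, s n) \<in> E \<longleftrightarrow>
    (i < n \<and> i \<in> set (fst (snd (task n))) \<or> n < i \<and> n \<in> set (fst (snd (task i)))) \<and> d (s i) (s n) < 1" for i n
    unfolding E_def using inj_eq[OF inj] by auto
  have "gec_graph M d (range s) E"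
  proof
    show "range s \<subseteq> M"
      using sM by auto
    show "mtopology closure_of (range s) = M"
      unfolding closure_of_eq_M_iff[OF \<open>range s \<subseteq> M\<close>]
    proof (intro ballI allI impI)
      fix x and \<epsilon> :: real assume x: "x \<in> M" "\<epsilon> > 0"
      then obtain k where k: "d x (p k) < \<epsilon> / 2"
        using p_dense[of x "\<epsilon> / 2"] by auto
      obtain m where m: "1 / Suc m < \<epsilon> / 2"
        using reals_Archimedean[of "\<epsilon> / 2"] x by (auto simp: inverse_eq_divide)
      obtain n where "task n = (k, [], m)"
        using task by blast
      then have "d (p k) (s n) < 1 / Suc m"
        using s[of n] by (simp add: Q_def)
      then have "d x (s n) < \<epsilon>"
        using k m triangle[of x "p k" "s n"] x pM[of k] sM[of n] by linarith
      then show "\<exists>y\<in>range s. d x y < \<epsilon>"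
        by blast
    qed
    show "E \<subseteq> range s \<times> range s" "irrefl E"
      by (auto simp: E_def irrefl_def dest: injD[OF inj])
    show "sym E"
    proof (rule symI)
      fix u v assume uv: "(u, v) \<in> E"
      then obtain i n where ins: "u = s i" "v = s n"
        by (auto simp: E_def)
      with uv show "(v, u) \<in> E"
        using commute[of "s i" "s n"] by (auto simp: E)
    qed
    show "d u v < 1" if "(u, v) \<in> E" for u v
      using that by (auto simp: E_def)
    show "\<exists>v\<in>range s - (A \<union> B). d x v < \<epsilon> \<and> (\<forall>a\<in>A. (v, a) \<in> E) \<and> (\<forall>b\<in>B. (v, b) \<notin> E)"
      if x: "x \<in> range s" and AB: "finite A" "finite B" "A \<inter> B = {}" and A: "A \<subseteq> range s \<inter> mball x 1"
        and B: "B \<subseteq> range s \<inter> mball x 1" and "\<epsilon> > 0" for x A B and \<epsilon> :: real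
    proof -
      have "x \<in> M"
        using x sM by auto
      obtain I where I: "finite I" "A = s ` I"
        using AB(1) A by (metis finite_subset_image le_infE)
      obtain J where J: "finite J" "B = s ` J"
        using AB(2) B by (metis finite_subset_image le_infE)
      \<comment> \<open>Within \<open>\<delta>\<close> of \<open>x\<close>, the point
        \<open>p k\<close> still has all of \<open>A\<close> in its unit ball, and
        \<open>\<epsilon> / 2\<close> is left for the new vertex.\<close>
      define \<delta> where "\<delta> = Min (insert (\<epsilon> / 2) ((\<lambda>a. 1 - d x a) ` A))"
      have fin: "finite (insert (\<epsilon> / 2) ((\<lambda>a. 1 - d x a) ` A))"
        using AB(1) by simp
      have "\<delta> > 0"
        unfolding \<delta>_def using fin A \<open>\<epsilon> > 0\<close> by (subst Min_gr_iff) auto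
      then obtain k where k: "d x (p k) < \<delta>"
        using p_dense \<open>x \<in> M\<close> by blast
      have "\<delta> \<le> \<epsilon> / 2"
        unfolding \<delta>_def using fin by (intro Min_le) auto
      have pA: "d (p k) a < 1" if "a \<in> A" for a
      proof -
        have "\<delta> \<le> 1 - d x a"
          unfolding \<delta>_def using fin that by (intro Min_le) auto
        moreover have "a \<in> M"
          using that A by auto
        ultimately show ?thesis
          using k triangle[of "p k" x a] pM[of k] \<open>x \<in> M\<close> commute[of "p k" x] by linarith
      qed
      obtain m where m: "1 / Suc m < \<epsilon> / 2"
        using reals_Archimedean[of "\<epsilon> / 2"] \<open>\<epsilon> > 0\<close> by (auto simp: inverse_eq_divide)
      obtain "is" where "is": "set is = I"
        using I(1) finite_list by blast
      \<comment> \<open>The stage lies beyond the indices of \<open>A\<close> and \<open>B\<close>,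
        so it alone decides the edges to them; the indices of \<open>B\<close> are missing from its
        list.\<close>
      obtain n where n: "n \<ge> Suc (Max (insert 0 (I \<union> J)))" "task n = (k, is, m)"
        using task by blast
      have less: "i < n" if "i \<in> I \<union> J" for i
      proof -
        have "i \<le> Max (insert 0 (I \<union> J))"
          using that I(1) J(1) by (intro Max_ge) auto
        with n(1) show ?thesis
          by linarith
      qed
      have sn: "d (p k) (s n) < 1 / Suc m" "\<And>i. i \<in> I \<Longrightarrow> d (p k) (s i) < 1 \<Longrightarrow> d (s n) (s i) < 1"
        using s[of n] less n(2) "is" by (auto simp: Q_def)
      have "d x (s n) < \<epsilon>"
        using k sn(1) m \<open>\<delta> \<le> \<epsilon> / 2\<close> triangle[of x "p k" "s n"] \<open>x \<in> M\<close> pM[of k] sM[of n] by linarith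
      moreover have "s n \<notin> A \<union> B"
      proof
        assume "s n \<in> A \<union> B"
        then obtain i where "i \<in> I \<union> J" "s n = s i"
          using I(2) J(2) by auto
        with less[of i] injD[OF inj] show False
          by fastforce
      qed
      moreover have "(s n, a) \<in> E" if "a \<in> A" for a
        using that pA[OF that] sn(2) I(2) less "is" n(2) by (auto simp: E)
      moreover have "(s n, b) \<notin> E" if "b \<in> B" for b
      proof -
        obtain j where j: "j \<in> J" "b = s j"
          using \<open>b \<in> B\<close> J(2) by blast
        then have "j \<notin> I"
          using AB(3) I(2) J(2) by auto
        with j less[of j] "is" n(2) show ?thesis
          by (auto simp: E)
      qed
      ultimately show ?thesis
        by blast
    qed
  qed (fact sep perfect)+
  with sP inj show ?thesis
    by blast
qed

end

section \<open>Thresholds definable in g.e.c. graphs\<close>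

text \<open>\<open>\<Theta> t t'\<close> means that formulas cut off distances at \<open>t\<close>
  in one space and at \<open>t'\<close> in the other, up to any error. A formula with threshold 0
  may hold for no pair, and composing with it gives nothing, so \<open>sum\<close> does not mix zero
  and positive thresholds. The bounds by \<open>D\<close> and \<open>D'\<close> reflect that no
  distance exceeds the diameter.\<close>

locale threshold_correspondence =
  fixes \<Theta> :: "real \<Rightarrow> real \<Rightarrow> bool" and D D' :: real
  assumes D: "D > 1" "D' > 1"
    and nonneg: "\<Theta> t t' \<Longrightarrow> 0 \<le> t \<and> 0 \<le> t'"
    and one: "\<Theta> 1 1"
    and top: "\<Theta> D D'"
    and sum: "\<Theta> s s' \<Longrightarrow> \<Theta> t t' \<Longrightarrow> s = 0 \<longleftrightarrow> t = 0 \<Longrightarrow> s' = 0 \<longleftrightarrow> t' = 0 \<Longrightarrow> \<Theta> (s + t) (s' + t')"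
    and diff: "\<Theta> s s' \<Longrightarrow> \<Theta> t t' \<Longrightarrow> 0 < s \<Longrightarrow> s \<le> t \<Longrightarrow> t < D \<Longrightarrow> 0 < s' \<Longrightarrow> s' \<le> t' \<Longrightarrow> t' < D' \<Longrightarrow>
      \<Theta> (t - s) (t' - s')"
    and compl: "\<Theta> s s' \<Longrightarrow> s \<le> D \<Longrightarrow> s' \<le> D' \<Longrightarrow> \<Theta> (2 * (D - s)) (2 * (D' - s'))"
    and mono: "\<Theta> s s' \<Longrightarrow> \<Theta> t t' \<Longrightarrow> s < t \<Longrightarrow> s < D \<Longrightarrow> s' \<le> t'"
    and mono': "\<Theta> s s' \<Longrightarrow> \<Theta> t t' \<Longrightarrow> s' < t' \<Longrightarrow> s' < D' \<Longrightarrow> s \<le> t"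
begin

lemma flip: "threshold_correspondence (\<lambda>t' t. \<Theta> t t') D' D"
proof
  show "\<Theta> s s' \<Longrightarrow> \<Theta> t t' \<Longrightarrow> s' < t' \<Longrightarrow> s' < D' \<Longrightarrow> s \<le> t" for s s' t t'
    by (rule mono')
  show "\<Theta> s s' \<Longrightarrow> \<Theta> t t' \<Longrightarrow> s < t \<Longrightarrow> s < D \<Longrightarrow> s' \<le> t'" for s s' t t'
    by (rule mono)
qed (use D nonneg one top sum diff compl in auto)

text \<open>Doubling fixes 0 but takes a positive \<open>c\<close> past \<open>D'\<close>, against
  \<open>mono\<close> and \<open>top\<close>.\<close>

lemma zero:
  assumes "\<Theta> 0 c"
  shows "c = 0"
proof (rule ccontr)
  assume "c \<noteq> 0"
  then have "c > 0"
    using nonneg[OF assms] by simp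
  have "\<Theta> 0 (2 ^ n * c)" for n
  proof (induction n)
    case (Suc n)
    then show ?case
      using sum[OF Suc Suc] by (simp add: mult_ac)
  qed (use assms in simp)
  moreover obtain n where "D' / c < 2 ^ n"
    using real_arch_pow[of 2 "D' / c"] by auto
  then have "D' < 2 ^ n * c"
    using \<open>c > 0\<close> by (simp add: field_simps)
  ultimately show False
    using mono[OF _ top, of 0 "2 ^ n * c"] D by fastforce
qed

lemma zero':
  assumes "\<Theta> c 0"
  shows "c = 0"
  using threshold_correspondence.zero[OF flip assms] .

lemma pos:
  assumes "\<Theta> s s'" "0 < s"
  shows "0 < s'"
  using zero'[of s] nonneg[OF assms(1)] assms by (cases "s' = 0") auto

text \<open>Otherwise \<open>t' = D'\<close>, and the complement \<open>2 * (D - t)\<close> would be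
  a positive threshold paired with 0.\<close>

lemma below:
  assumes "\<Theta> t t'" "t < D"
  shows "t' < D'"
proof (rule ccontr)
  assume "\<not> t' < D'"
  moreover have "t' \<le> D'"
    using mono[OF assms(1) top assms(2) assms(2)] .
  ultimately have "\<Theta> (2 * (D - t)) 0"
    using compl[OF assms(1)] assms(2) by simp
  with zero' assms(2) show False
    by fastforce
qed

text \<open>Subtracting one pair from the other pairs 0 with the difference of \<open>a\<close> and
  \<open>b\<close>, which \<open>zero\<close> forces to be 0.\<close>

lemma unique:
  assumes "\<Theta> s a" "\<Theta> s b" "0 < s" "s < D"
  shows "a = b"
proof -
  have "x = y" if xy: "\<Theta> s x" "\<Theta> s y" "x \<le> y" for x y
  proof -
    have "x > 0"
      using pos[OF xy(1) assms(3)] .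
    then have "\<Theta> (s - s) (y - x)"
      using below[OF xy(2)] assms xy by (intro diff) auto
    then show ?thesis
      using zero by fastforce
  qed
  then show ?thesis
    using assms linear by metis
qed

lemma euclid:
  assumes s: "\<Theta> s s'" "0 < s" and t: "\<Theta> t t'" "t < D" and k: "of_nat k * s \<le> t"
  shows "\<Theta> (t - of_nat k * s) (t' - of_nat k * s')"
  using k
proof (induction k)
  case (Suc k)
  define u u' where "u = t - of_nat k * s" and "u' = t' - of_nat k * s'"
  have "s' > 0"
    using pos[OF s] .
  have u: "\<Theta> u u'" "s \<le> u" "u < D"
  proof -
    have "0 \<le> of_nat k * s"
      using s(2) by simp
    then show "u < D"
      using t(2) unfolding u_def by linarith
    show "\<Theta> u u'" "s \<le> u"
      using Suc s(2) unfolding u_def u'_def by (simp_all add: algebra_simps)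
  qed
  \<comment> \<open>A strict inequality \<open>s < u\<close> passes to the other side by
    \<open>mono\<close>; equality needs \<open>unique\<close>.\<close>
  have "s' \<le> u'"
  proof (cases "s = u")
    case True
    then show ?thesis
      using unique[of s s' u'] u s by simp
  next
    case False
    then show ?thesis
      using mono[OF s(1) u(1)] u(2,3) by simp
  qed
  then have "\<Theta> (u - s) (u' - s')"
    using u s \<open>s' > 0\<close> below[OF u(1,3)] by (intro diff) auto
  then show ?case
    by (simp add: u_def u'_def algebra_simps)
qed (use t in simp)

text \<open>Repeated subtraction runs in parallel on both sides, so \<open>s\<close> fits into
  \<open>t\<close> as often as \<open>s'\<close> into \<open>t'\<close>, up to the boundary case
  \<open>t' = (of_nat k + 1) * s'\<close>.\<close>

lemma floor_bounds:
  assumes s: "\<Theta> s s'" "0 < s" "s < D" and t: "\<Theta> t t'" "t < D"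
  shows "\<exists>k::nat. of_nat k * s \<le> t \<and> t < (of_nat k + 1) * s \<and> of_nat k * s' \<le> t' \<and> t' \<le> (of_nat k + 1) * s' \<and>
    \<Theta> (t - of_nat k * s) (t' - of_nat k * s')"
proof -
  define k where "k = nat \<lfloor>t / s\<rfloor>"
  have "t / s \<ge> 0"
    using s(2) nonneg[OF t(1)] by simp
  then have "of_nat k \<le> t / s" "t / s < of_nat k + 1"
    by (auto simp: k_def)
  then have k: "of_nat k * s \<le> t" "t < (of_nat k + 1) * s"
    using s(2) by (simp_all add: pos_le_divide_eq pos_divide_less_eq)
  let ?r = "t - of_nat k * s" and ?r' = "t' - of_nat k * s'"
  have r: "\<Theta> ?r ?r'"
    using euclid[OF s(1,2) t k(1)] .
  have "?r < s"
    using k(2) by (simp add: algebra_simps)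
  have "?r' \<le> s'"
    using mono[OF r s(1) \<open>?r < s\<close>] \<open>?r < s\<close> s(3) by linarith
  with k r nonneg[OF r] show ?thesis
    by (intro exI[of _ k]) (simp add: algebra_simps)
qed

text \<open>If there are arbitrarily small positive thresholds, counting how often one fits into
  \<open>t\<close> and into 1 determines the ratio on both sides, and the unit is shared. Otherwise
  there is a least one, the others below \<open>D\<close> are its multiples, and 1 fixes its
  partner.\<close>

lemma diagonal:
  assumes t: "\<Theta> t t'" "t < D"
  shows "t' = t"
proof -
  define P where "P = {s. 0 < s \<and> s < D \<and> (\<exists>s'. \<Theta> s s')}"
  have "1 \<in> P"
    using one D by (auto simp: P_def)
  have bdd: "bdd_below P"
    by (intro bdd_belowI[of _ 0]) (auto simp: P_def)
  define m where "m = Inf P"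
  have m: "m \<le> s" if "s \<in> P" for s
    unfolding m_def using that bdd by (rule cInf_lower)
  have close: "\<exists>s\<in>P. s < m + e" if "e > 0" for e
    using that \<open>1 \<in> P\<close> bdd cInf_less_iff[of P "m + e"] unfolding m_def by auto
  have "m \<ge> 0"
    unfolding m_def using \<open>1 \<in> P\<close> by (intro cInf_greatest) (auto simp: P_def)
  show ?thesis
  proof (cases "m = 0")
    case True
    show ?thesis
    proof (rule ccontr)
      assume "t' \<noteq> t"
      \<comment> \<open>The counts below leave an error of at most \<open>s * (1 + t')\<close>,
        which this bound on \<open>s\<close> makes smaller than
        \<open>\<bar>t - t'\<bar>\<close>.\<close>
      define e where "e = min 1 (\<bar>t - t'\<bar> / (1 + t'))"
      have "t' \<ge> 0"
        using nonneg[OF t(1)] by simp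
      with \<open>t' \<noteq> t\<close> have "e > 0"
        by (simp add: e_def)
      then obtain s where "s \<in> P" "s < e"
        using close[of e] True by auto
      then obtain s' where s: "\<Theta> s s'" "0 < s" "s < D" "s < 1"
        by (auto simp: P_def e_def)
      then have "s' > 0"
        using pos[OF s(1,2)] by simp
      obtain k :: nat where k: "of_nat k * s \<le> t" "t < (of_nat k + 1) * s" "of_nat k * s' \<le> t'" "t' \<le> (of_nat k + 1) * s'"
        using floor_bounds[OF s(1-3) t] by blast
      obtain l :: nat where l: "of_nat l * s \<le> 1" "1 < (of_nat l + 1) * s" "of_nat l * s' \<le> 1" "1 \<le> (of_nat l + 1) * s'"
        using floor_bounds[OF s(1-3) one] D by blast
      \<comment> \<open>Eliminating \<open>s'\<close> from the bounds for \<open>t'\<close> and for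
        1 leaves a comparison of the counts \<open>k\<close> and \<open>l\<close>, which
        \<open>s\<close> turns back into lengths.\<close>
      have "t' * of_nat l \<le> of_nat k + 1"
      proof -
        have "t' * of_nat l \<le> (of_nat k + 1) * s' * of_nat l"
          using k(4) by (intro mult_right_mono) auto
        also have "\<dots> = (of_nat k + 1) * (of_nat l * s')"
          by simp
        also have "\<dots> \<le> (of_nat k + 1) * 1"
          using l(3) by (intro mult_left_mono) auto
        finally show ?thesis by simp
      qed
      then have "t' * of_nat l * s \<le> (of_nat k + 1) * s"
        using s(2) by (intro mult_right_mono) auto
      moreover have "t' * (1 - s) \<le> t' * (of_nat l * s)"
        using l(2) \<open>t' \<ge> 0\<close> by (intro mult_left_mono) (auto simp: algebra_simps)
      ultimately have 1: "t' * (1 - s) \<le> t + s"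
        using k(1) by (simp add: algebra_simps)
      have "of_nat k \<le> t' * (of_nat l + 1)"
      proof -
        have "of_nat k * 1 \<le> of_nat k * ((of_nat l + 1) * s')"
          using l(4) by (intro mult_left_mono) auto
        also have "\<dots> = (of_nat k * s') * (of_nat l + 1)"
          by simp
        also have "\<dots> \<le> t' * (of_nat l + 1)"
          using k(3) by (intro mult_right_mono) auto
        finally show ?thesis by simp
      qed
      then have "of_nat k * s \<le> t' * (of_nat l + 1) * s"
        using s(2) by (intro mult_right_mono) auto
      moreover have "t' * (of_nat l * s + s) \<le> t' * (1 + s)"
        using l(1) \<open>t' \<ge> 0\<close> by (intro mult_left_mono) auto
      ultimately have 2: "t - s \<le> t' * (1 + s)"
        using k(2) by (simp add: algebra_simps)
      have "\<bar>t - t'\<bar> \<le> s * (1 + t')"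
        using 1 2 by (simp add: algebra_simps abs_le_iff)
      moreover have "s < \<bar>t - t'\<bar> / (1 + t')"
        using \<open>s < e\<close> by (simp add: e_def)
      then have "s * (1 + t') < \<bar>t - t'\<bar>"
        using \<open>t' \<ge> 0\<close> by (simp add: pos_less_divide_eq)
      ultimately show False
        by simp
    qed
  next
    case False
    then have "m > 0"
      using \<open>m \<ge> 0\<close> by simp
    have "m \<in> P"
    proof (rule ccontr)
      assume "m \<notin> P"
      \<comment> \<open>If the infimum is not attained, two members of \<open>P\<close> lie strictly
        between \<open>m\<close> and \<open>2 * m\<close> or the smaller one would be
        \<open>m\<close>; their difference is a member below \<open>m\<close>.\<close>
      obtain v where v: "v \<in> P" "v < m + m"
        using close[OF \<open>m > 0\<close>] by blast
      then have "m < v"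
        using m[OF v(1)] \<open>m \<notin> P\<close> by (cases "m = v") auto
      then obtain u where u: "u \<in> P" "u < v"
        using close[of "v - m"] by auto
      obtain u' v' where uv: "\<Theta> u u'" "\<Theta> v v'" "0 < u" "v < D"
        using u v by (auto simp: P_def)
      have "u' > 0"
        using pos[OF uv(1,3)] .
      then have "\<Theta> (v - u) (v' - u')"
        using uv u mono[OF uv(1,2) u(2)] below[OF uv(2,4)] by (intro diff) auto
      then have "v - u \<in> P"
        using u uv by (auto simp: P_def)
      from m[OF this] m[OF u(1)] v show False
        by linarith
    qed
    then obtain m' where m': "\<Theta> m m'" "m < D"
      by (auto simp: P_def)
    have mult: "\<exists>k::nat. t = of_nat k * m \<and> t' = of_nat k * m'" if t: "\<Theta> t t'" "t < D" for t t'
    proof -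
      obtain k :: nat where k: "of_nat k * m \<le> t" "t < (of_nat k + 1) * m" "\<Theta> (t - of_nat k * m) (t' - of_nat k * m')"
        using floor_bounds[OF m'(1) \<open>m > 0\<close> m'(2) t] by blast
      have "t - of_nat k * m < m"
        using k(2) by (simp add: algebra_simps)
      then have "t - of_nat k * m \<notin> P"
        using m by fastforce
      then have "t - of_nat k * m = 0"
        using k \<open>t - of_nat k * m < m\<close> m'(2) by (auto simp: P_def)
      moreover from this have "t' - of_nat k * m' = 0"
        using k(3) zero[of "t' - of_nat k * m'"] by simp
      ultimately show ?thesis
        by (intro exI[of _ k]) simp
    qed
    obtain k :: nat where "1 = of_nat k * m" "1 = of_nat k * m'"
      using mult[OF one] D by blast
    then have "m = m'"
      by (metis mult_cancel_left mult_zero_left zero_neq_one)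
    with mult[OF t] show ?thesis
      by auto
  qed
qed

text \<open>The integer thresholds agree, so with \<open>n\<close> the largest integer below
  \<open>D\<close> the complements \<open>2 * (D - n)\<close> and \<open>2 * (D' - n)\<close>
  correspond. The first lies below \<open>D\<close> unless \<open>D = 2\<close>, and
  \<open>diagonal\<close> then makes them equal. For \<open>D = 2\<close> the pair
  \<open>\<Theta> 2 2\<close> has one entry at its diameter and the other below, which
  \<open>below\<close> forbids.\<close>

lemma not_less: "\<not> D < D'"
proof
  assume less: "D < D'"
  define n where "n = nat (\<lceil>D\<rceil> - 1)"
  have n: "of_nat n < D" "D \<le> of_nat n + 1" "n \<ge> 1"
    using D(1) unfolding n_def by linarith+
  have nn: "\<Theta> (of_nat k) (of_nat k)" if "k \<ge> 1" for k
    using that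
  proof (induction k rule: dec_induct)
    case (step k)
    then show ?case
      using sum[OF step(3) one] by (simp add: add.commute)
  qed (use one in simp)
  have compl: "\<Theta> (2 * (D - of_nat n)) (2 * (D' - of_nat n))"
    using compl[OF nn[OF n(3)]] n less by simp
  show False
  proof (cases "2 * (D - of_nat n) < D")
    case True
    with diagonal[OF compl] less show False
      by simp
  next
    case False
    then have "D = 2"
      using n by (cases "n = 1") (auto simp: not_less)
    moreover have "\<Theta> 2 2"
      using nn[of 2] by simp
    ultimately show False
      using threshold_correspondence.below[OF flip \<open>\<Theta> 2 2\<close>] less by simp
  qed
qed

theorem rigidity: "D = D'"
  using not_less threshold_correspondence.not_less[OF flip] by simp

end

section \<open>Formulas for relations between two vertices\<close>

primrec rename_atom :: "(nat \<Rightarrow> nat) \<Rightarrow> graph_atom \<Rightarrow> graph_atom" where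
  "rename_atom \<pi> (EqV i j) = EqV (\<pi> i) (\<pi> j)"
| "rename_atom \<pi> (Adj i j) = Adj (\<pi> i) (\<pi> j)"

primrec rename_fm :: "(nat \<Rightarrow> nat) \<Rightarrow> graph_atom fm \<Rightarrow> graph_atom fm" where
  "rename_fm \<pi> (Atom a) = Atom (rename_atom \<pi> a)"
| "rename_fm \<pi> (Neg \<phi>) = Neg (rename_fm \<pi> \<phi>)"
| "rename_fm \<pi> (Conj \<phi> \<psi>) = Conj (rename_fm \<pi> \<phi>) (rename_fm \<pi> \<psi>)"
| "rename_fm \<pi> (Ex n \<phi>) = Ex (\<pi> n) (rename_fm \<pi> \<phi>)"

text \<open>Bound variables are renamed too; injectivity of \<open>\<pi>\<close> rules out
  capture.\<close>

lemma sat_rename_fm: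
  assumes "inj \<pi>"
  shows "sat (graph_atom_holds E) S (rename_fm \<pi> \<phi>) e \<longleftrightarrow> sat (graph_atom_holds E) S \<phi> (e \<circ> \<pi>)"
proof (induction \<phi> arbitrary: e)
  case (Atom a)
  show ?case by (cases a) auto
next
  case (Ex n \<phi>)
  have "e(\<pi> n := u) \<circ> \<pi> = (e \<circ> \<pi>)(n := u)" for u
    using inj_eq[OF assms] by auto
  then show ?case
    by (simp only: rename_fm.simps sat.simps Ex.IH)
qed auto

lemma fvars_rename_fm:
  assumes "inj \<pi>"
  shows "fvars graph_atom_vars (rename_fm \<pi> \<phi>) = \<pi> ` fvars graph_atom_vars \<phi>"
proof (induction \<phi>)
  case (Atom a)
  show ?case by (cases a) auto
qed (use assms in \<open>auto simp: image_Un dest: injD\<close>)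

lemma sat_graph_cong:
  assumes "\<And>i. i \<in> fvars graph_atom_vars \<phi> \<Longrightarrow> e i = e' i"
  shows "sat (graph_atom_holds E) S \<phi> e = sat (graph_atom_holds E) S \<phi> e'"
proof (rule sat_cong_fvars)
  show "graph_atom_holds E a e = graph_atom_holds E a e'" if "\<And>i. i \<in> graph_atom_vars a \<Longrightarrow> e i = e' i" for a e e'
    using that by (cases a) auto
qed (use assms in auto)

text \<open>
  A binary relation is defined by a formula with free variables \<open>0\<close> and \<open>1\<close>.
\<close>

definition comp_fm :: "graph_atom fm \<Rightarrow> graph_atom fm \<Rightarrow> graph_atom fm" where
  "comp_fm \<phi> \<psi> = Ex 2 (Conj (rename_fm (Transposition.transpose 1 2) \<phi>) (rename_fm (Transposition.transpose 0 2) \<psi>))"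

definition holds2 :: "'v set \<Rightarrow> 'v rel \<Rightarrow> graph_atom fm \<Rightarrow> 'v \<Rightarrow> 'v \<Rightarrow> bool" where
  "holds2 S E \<phi> u v \<longleftrightarrow> sat (graph_atom_holds E) S \<phi> (\<lambda>i. if i = 0 then u else v)"

lemma sat_holds2:
  assumes "fvars graph_atom_vars \<phi> \<subseteq> {0, 1}"
  shows "sat (graph_atom_holds E) S \<phi> e = holds2 S E \<phi> (e 0) (e 1)"
  unfolding holds2_def using assms by (intro sat_graph_cong) auto

lemma holds2_Neg: "holds2 S E (Neg \<phi>) u v \<longleftrightarrow> \<not> holds2 S E \<phi> u v"
  by (simp add: holds2_def)

lemma holds2_comp_fm:
  assumes "fvars graph_atom_vars \<phi> \<subseteq> {0, 1}" "fvars graph_atom_vars \<psi> \<subseteq> {0, 1}"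
  shows "holds2 S E (comp_fm \<phi> \<psi>) u v \<longleftrightarrow> (\<exists>w\<in>S. holds2 S E \<phi> u w \<and> holds2 S E \<psi> w v)"
proof -
  have inj: "inj (Transposition.transpose a b)" for a b :: nat
    by (rule bij_is_inj) simp
  have "holds2 S E (comp_fm \<phi> \<psi>) u v \<longleftrightarrow>
      sat (graph_atom_holds E) S (comp_fm \<phi> \<psi>) (\<lambda>i. if i = 0 then u else v)"
    by (simp only: holds2_def)
  also have "\<dots> \<longleftrightarrow> (\<exists>w\<in>S. holds2 S E \<phi> u w \<and> holds2 S E \<psi> w v)"
    unfolding comp_fm_def sat.simps sat_rename_fm[OF inj] sat_holds2[OF assms(1)] sat_holds2[OF assms(2)]
    by (simp add: Transposition.transpose_def)
  finally show ?thesis .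
qed

lemma fvars_comp_fm:
  assumes "fvars graph_atom_vars \<phi> \<subseteq> {0, 1}" "fvars graph_atom_vars \<psi> \<subseteq> {0, 1}"
  shows "fvars graph_atom_vars (comp_fm \<phi> \<psi>) \<subseteq> {0, 1}"
proof -
  have "Transposition.transpose 1 2 ` fvars graph_atom_vars \<phi> \<subseteq> Transposition.transpose 1 2 ` {0, 1::nat}"
    "Transposition.transpose 0 2 ` fvars graph_atom_vars \<psi> \<subseteq> Transposition.transpose 0 2 ` {0, 1::nat}"
    by (intro image_mono assms)+
  then show ?thesis
    unfolding comp_fm_def by (auto simp: fvars_rename_fm Transposition.transpose_def)
qed

text \<open>
  The tolerance \<open>\<epsilon>\<close> is there because \<open>unit_fm K\<close> below pins down the distance 1 only up to an error
  that shrinks as \<open>K\<close> grows.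
\<close>

definition threshold :: "'v set \<Rightarrow> ('v \<Rightarrow> 'v \<Rightarrow> real) \<Rightarrow> graph_atom fm \<Rightarrow> real \<Rightarrow> real \<Rightarrow> bool" where
  "threshold M d \<phi> t \<epsilon> \<longleftrightarrow> (\<forall>S E u v. gec_graph M d S E \<longrightarrow> u \<in> S \<longrightarrow> v \<in> S \<longrightarrow>
     (d u v < t - \<epsilon> \<longrightarrow> holds2 S E \<phi> u v) \<and> (d u v > t + \<epsilon> \<longrightarrow> \<not> holds2 S E \<phi> u v))"

lemma threshold_mono: "threshold M d \<phi> t \<epsilon> \<Longrightarrow> \<epsilon> \<le> \<epsilon>' \<Longrightarrow> threshold M d \<phi> t \<epsilon>'"
  unfolding threshold_def by (smt (verit))

definition True_fm :: "graph_atom fm" where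
  "True_fm = Atom (EqV 0 0)"

definition Ex_list :: "nat list \<Rightarrow> graph_atom fm \<Rightarrow> graph_atom fm" where
  "Ex_list vs \<phi> = foldr Ex vs \<phi>"

definition Conj_list :: "graph_atom fm list \<Rightarrow> graph_atom fm" where
  "Conj_list \<phi>s = foldr Conj \<phi>s True_fm"

lemma sat_Conj_list: "sat (graph_atom_holds E) S (Conj_list \<phi>s) e \<longleftrightarrow> (\<forall>\<phi>\<in>set \<phi>s. sat (graph_atom_holds E) S \<phi> e)"
  by (induction \<phi>s) (auto simp: Conj_list_def True_fm_def)

lemma fvars_Conj_list: "fvars graph_atom_vars (Conj_list \<phi>s) = insert 0 (\<Union>\<phi>\<in>set \<phi>s. fvars graph_atom_vars \<phi>)"
  by (induction \<phi>s) (auto simp: Conj_list_def True_fm_def)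

lemma fvars_Ex_list: "fvars graph_atom_vars (Ex_list vs \<phi>) = fvars graph_atom_vars \<phi> - set vs"
  by (induction vs) (auto simp: Ex_list_def)

lemma sat_Ex_list:
  "sat (graph_atom_holds E) S (Ex_list vs \<phi>) e \<longleftrightarrow>
    (\<exists>e'. (\<forall>i. i \<notin> set vs \<longrightarrow> e' i = e i) \<and> (\<forall>i\<in>set vs. e' i \<in> S) \<and> sat (graph_atom_holds E) S \<phi> e')"
proof (induction vs arbitrary: e)
  case Nil
  have "e' = e" if "\<forall>i. e' i = e i" for e' :: "nat \<Rightarrow> _"
    using that by auto
  then show ?case
    by (auto simp: Ex_list_def)
next
  case (Cons n vs)
  have "sat (graph_atom_holds E) S (Ex_list (n # vs) \<phi>) e \<longleftrightarrow>
      (\<exists>u\<in>S. sat (graph_atom_holds E) S (Ex_list vs \<phi>) (e(n := u)))"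
    by (simp add: Ex_list_def)
  also have "\<dots> \<longleftrightarrow> (\<exists>e'. (\<forall>i. i \<notin> set (n # vs) \<longrightarrow> e' i = e i) \<and> (\<forall>i\<in>set (n # vs). e' i \<in> S) \<and>
      sat (graph_atom_holds E) S \<phi> e')"
    unfolding Cons.IH
  proof safe
    fix u e' assume u: "u \<in> S" and e': "\<forall>i. i \<notin> set vs \<longrightarrow> e' i = (e(n := u)) i" "\<forall>i\<in>set vs. e' i \<in> S"
      "sat (graph_atom_holds E) S \<phi> e'"
    have "e' n \<in> S"
      using u e'(1,2) by (cases "n \<in> set vs") auto
    with e' show "\<exists>e'. (\<forall>i. i \<notin> set (n # vs) \<longrightarrow> e' i = e i) \<and> (\<forall>i\<in>set (n # vs). e' i \<in> S) \<and>
        sat (graph_atom_holds E) S \<phi> e'"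
      by (intro exI[of _ e']) auto
  next
    fix e' assume e': "\<forall>i. i \<notin> set (n # vs) \<longrightarrow> e' i = e i" "\<forall>i\<in>set (n # vs). e' i \<in> S"
      "sat (graph_atom_holds E) S \<phi> e'"
    then show "\<exists>u\<in>S. \<exists>e'. (\<forall>i. i \<notin> set vs \<longrightarrow> e' i = (e(n := u)) i) \<and> (\<forall>i\<in>set vs. e' i \<in> S) \<and>
        sat (graph_atom_holds E) S \<phi> e'"
      by (intro bexI[of _ "e' n"] exI[of _ e']) auto
  qed
  finally show ?case .
qed

text \<open>The extension property at vertex 0 is what can be expressed: if vertex 1 lies in its
  unit ball, then it has a common neighbour with any \<open>K\<close> neighbours of 0. For large
  \<open>K\<close> this is nearly sufficient. Variables 2 to \<open>K + 1\<close> are the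
  neighbours, with repetitions allowed, and \<open>K + 2\<close> is the common neighbour.\<close>

definition unit_fm :: "nat \<Rightarrow> graph_atom fm" where
  "unit_fm K = Neg (Ex_list [2..<K + 2] (Conj (Conj_list (map (\<lambda>i. Atom (Adj 0 i)) [2..<K + 2]))
     (Neg (Ex (K + 2) (Conj (Atom (Adj (K + 2) 1)) (Conj_list (map (\<lambda>i. Atom (Adj (K + 2) i)) [2..<K + 2])))))))"

lemma fvars_unit_fm: "fvars graph_atom_vars (unit_fm K) \<subseteq> {0, 1}"
  by (auto simp: unit_fm_def fvars_Ex_list fvars_Conj_list)

lemma holds2_unit_fm:
  "holds2 S E (unit_fm K) u v \<longleftrightarrow>
    (\<forall>a. (\<forall>i<K. a i \<in> S \<and> (u, a i) \<in> E) \<longrightarrow> (\<exists>w\<in>S. (w, v) \<in> E \<and> (\<forall>i<K. (w, a i) \<in> E)))"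
proof -
  have "holds2 S E (unit_fm K) u v \<longleftrightarrow>
    \<not> (\<exists>e. (\<forall>i. i \<notin> {2..<K + 2} \<longrightarrow> e i = (if i = 0 then u else v)) \<and> (\<forall>i\<in>{2..<K + 2}. e i \<in> S) \<and>
      (\<forall>i\<in>{2..<K + 2}. (e 0, e i) \<in> E) \<and>
      \<not> (\<exists>w\<in>S. (w, e 1) \<in> E \<and> (\<forall>i\<in>{2..<K + 2}. (w, e i) \<in> E)))"
    by (simp add: holds2_def unit_fm_def sat_Ex_list sat_Conj_list del: upt_Suc)
  also have "\<dots> \<longleftrightarrow> (\<forall>a. (\<forall>i<K. a i \<in> S \<and> (u, a i) \<in> E) \<longrightarrow> (\<exists>w\<in>S. (w, v) \<in> E \<and> (\<forall>i<K. (w, a i) \<in> E)))"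
    (is "\<not> ?l \<longleftrightarrow> ?r")
  proof
    assume l: "\<not> ?l"
    show ?r
    proof (intro allI impI)
      fix a assume a: "\<forall>i<K. a i \<in> S \<and> (u, a i) \<in> E"
      define e where "e i = (if i = 0 then u else if 2 \<le> i \<and> i < K + 2 then a (i - 2) else v)" for i
      have e01: "e 0 = u" "e 1 = v"
        by (simp_all add: e_def)
      have e2: "e i \<in> S \<and> (e 0, e i) \<in> E" if "i \<in> {2..<K + 2}" for i
        using a[rule_format, of "i - 2"] that by (auto simp: e_def)
      have e_out: "e i = (if i = 0 then u else v)" if "i \<notin> {2..<K + 2}" for i
        using that by (auto simp: e_def)
      have "\<exists>w\<in>S. (w, e 1) \<in> E \<and> (\<forall>i\<in>{2..<K + 2}. (w, e i) \<in> E)"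
      proof (rule ccontr)
        assume "\<not> ?thesis"
        with e2 e_out have ?l
          by blast
        with l show False
          by contradiction
      qed
      then obtain w where w: "w \<in> S" "(w, e 1) \<in> E" "\<forall>i\<in>{2..<K + 2}. (w, e i) \<in> E"
        by blast
      have "(w, a i) \<in> E" if "i < K" for i
        using w(3)[rule_format, of "i + 2"] that by (simp add: e_def)
      with w(1,2) show "\<exists>w\<in>S. (w, v) \<in> E \<and> (\<forall>i<K. (w, a i) \<in> E)"
        unfolding e01 by blast
    qed
  next
    assume r: ?r
    show "\<not> ?l"
    proof
      assume ?l
      then obtain e where e: "\<forall>i. i \<notin> {2..<K + 2} \<longrightarrow> e i = (if i = 0 then u else v)"
        "\<forall>i\<in>{2..<K + 2}. e i \<in> S" "\<forall>i\<in>{2..<K + 2}. (e 0, e i) \<in> E"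
        "\<not> (\<exists>w\<in>S. (w, e 1) \<in> E \<and> (\<forall>i\<in>{2..<K + 2}. (w, e i) \<in> E))"
        by blast
      have "e 0 = u" "e 1 = v"
        using e(1) by simp_all
      with e(2,3) r[rule_format, of "\<lambda>i. e (i + 2)"]
      obtain w where w: "w \<in> S" "(w, v) \<in> E" "\<forall>i<K. (w, e (i + 2)) \<in> E"
        by auto
      have "(w, e i) \<in> E" if "i \<in> {2..<K + 2}" for i
      proof -
        have "i - 2 < K" "i - 2 + 2 = i"
          using that by auto
        then show ?thesis
          using w(3)[rule_format, of "i - 2"] by (simp only:)
      qed
      with w(1,2) e(4) \<open>e 1 = v\<close> show False
        by auto
    qed
  qed
  finally show ?thesis .
qed

section \<open>Neighbours in a g.e.c. graph\<close>

context gec_graph begin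

lemma vertex_near:
  assumes "x \<in> M" "\<epsilon> > 0"
  shows "\<exists>v\<in>S. d x v < \<epsilon>"
  using dense assms closure_of_eq_M_iff[OF vertices] by blast

text \<open>Extension with \<open>A = {x}\<close> is applied at a vertex near \<open>s\<close> that
  is still within distance 1 of \<open>x\<close>. Thus the neighbours of \<open>x\<close> are dense
  in its open unit ball.\<close>

lemma neighbour_near:
  assumes "x \<in> S" "s \<in> M" "d x s < 1" "\<epsilon> > 0"
  shows "\<exists>v\<in>S. (x, v) \<in> E \<and> d s v < \<epsilon>"
proof -
  have xM: "x \<in> M"
    using assms vertices by blast
  obtain w where w: "w \<in> S" "d s w < min (\<epsilon> / 2) (1 - d x s)"
    using vertex_near[OF assms(2), of "min (\<epsilon> / 2) (1 - d x s)"] assms by auto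
  then have wM: "w \<in> M"
    using vertices by blast
  have "d x w < 1"
    using w(2) triangle[OF xM assms(2) wM] by linarith
  then have "{x} \<subseteq> S \<inter> mball w 1"
    using assms(1) xM wM commute by auto
  then obtain v where v: "v \<in> S" "d w v < \<epsilon> / 2" "(v, x) \<in> E"
    using extension[OF w(1), of "{x}" "{}" "\<epsilon> / 2"] assms(4) by auto
  moreover have "v \<in> M"
    using v vertices by blast
  ultimately have "d s v < \<epsilon>"
    using w(2) triangle[OF assms(2) wM, of v] by linarith
  with v show ?thesis
    using sym_edges by (auto dest: symD)
qed

lemma common_neighbour:
  assumes "x \<in> S" "finite A" "A \<subseteq> S" "\<And>a. a \<in> A \<Longrightarrow> d x a < 1"
  shows "\<exists>v\<in>S. \<forall>a\<in>A. (v, a) \<in> E"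
proof -
  have "A \<subseteq> S \<inter> mball x 1"
    using assms vertices by (auto simp: in_mball subset_iff)
  then show ?thesis
    using extension[OF assms(1,2), of "{}" 1] by auto
qed

end

text \<open>
  The circle and the sphere are the intended instances: \<open>D\<close> is the diameter, any two points lie on
  half of a great circle, and the perimeter of a triangle is at most that of a great circle.
\<close>

locale round_space = Metric_space M d for M :: "'v set" and d +
  fixes D :: real
  assumes D: "D > 1"
    and nonempty: "M \<noteq> {}"
    and geodesic: "x \<in> M \<Longrightarrow> y \<in> M \<Longrightarrow> \<exists>\<gamma>. (\<forall>s\<in>{0..D}. \<gamma> s \<in> M) \<and>
      (\<forall>s\<in>{0..D}. \<forall>t\<in>{0..D}. d (\<gamma> s) (\<gamma> t) = \<bar>s - t\<bar>) \<and> \<gamma> 0 = x \<and> \<gamma> (d x y) = y"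
    and perimeter: "x \<in> M \<Longrightarrow> y \<in> M \<Longrightarrow> z \<in> M \<Longrightarrow> d x y + d y z + d z x \<le> 2 * D"
    and finite_net: "\<epsilon> > 0 \<Longrightarrow> \<exists>F. finite F \<and> F \<subseteq> M \<and> (\<forall>x\<in>M. \<exists>f\<in>F. d x f < \<epsilon>)"
begin

lemma diameter:
  assumes "x \<in> M" "y \<in> M"
  shows "d x y \<le> D"
  using perimeter[OF assms(1,2) assms(2)] assms commute by simp

lemma between:
  assumes "x \<in> M" "y \<in> M" "0 \<le> s" "s \<le> d x y"
  shows "\<exists>z\<in>M. d x z = s \<and> d z y = d x y - s"
proof -
  obtain \<gamma> where g: "\<forall>s\<in>{0..D}. \<gamma> s \<in> M" "\<forall>s\<in>{0..D}. \<forall>t\<in>{0..D}. d (\<gamma> s) (\<gamma> t) = \<bar>s - t\<bar>" "\<gamma> 0 = x" "\<gamma> (d x y) = y"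
    using geodesic[OF assms(1,2)] by blast
  have le: "d x y \<le> D"
    by (rule diameter[OF assms(1,2)])
  have "d (\<gamma> 0) (\<gamma> s) = s" "d (\<gamma> s) (\<gamma> (d x y)) = d x y - s"
    using g(2) assms(3,4) le by auto
  with g(1,3,4) assms(3,4) le show ?thesis
    by (intro bexI[of _ "\<gamma> s"]) auto
qed

text \<open>With \<open>y = x\<close> this yields points at every distance up to \<open>D\<close>
  from \<open>x\<close>, in particular an antipode.\<close>

lemma beyond:
  assumes "x \<in> M" "y \<in> M" "d x y \<le> t" "t \<le> D"
  shows "\<exists>z\<in>M. d x z = t \<and> d y z = t - d x y"
proof -
  obtain \<gamma> where g: "\<forall>s\<in>{0..D}. \<gamma> s \<in> M" "\<forall>s\<in>{0..D}. \<forall>t\<in>{0..D}. d (\<gamma> s) (\<gamma> t) = \<bar>s - t\<bar>" "\<gamma> 0 = x" "\<gamma> (d x y) = y"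
    using geodesic[OF assms(1,2)] by blast
  have "0 \<le> d x y"
    by simp
  then have mem: "0 \<in> {0..D}" "d x y \<in> {0..D}" "t \<in> {0..D}"
    using assms(3,4) unfolding atLeastAtMost_iff by linarith+
  have "d (\<gamma> 0) (\<gamma> t) = t" "d (\<gamma> (d x y)) (\<gamma> t) = t - d x y"
    using g(2)[rule_format, OF mem(1) mem(3)] g(2)[rule_format, OF mem(2) mem(3)] mem assms(3) by simp_all
  with g(1,3,4) mem(3) show ?thesis
    by (intro bexI[of _ "\<gamma> t"]) auto
qed

lemma threshold_top:
  assumes "t \<ge> D" "\<epsilon> \<ge> 0"
  shows "threshold M d True_fm t \<epsilon>"
  unfolding threshold_def
proof (intro allI impI)
  fix S E u v assume "gec_graph M d S E" and uv: "u \<in> S" "v \<in> S"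
  then interpret gec_graph M d S E by simp
  have "d u v \<le> D"
    using uv vertices by (intro diameter) auto
  with assms show "(d u v < t - \<epsilon> \<longrightarrow> holds2 S E True_fm u v) \<and> (d u v > t + \<epsilon> \<longrightarrow> \<not> holds2 S E True_fm u v)"
    by (simp add: holds2_def True_fm_def)
qed

text \<open>Both relations must hold at small distances to be composed, whence
  \<open>\<epsilon> < s\<close> and \<open>\<epsilon> < t\<close>. In the other case no distance is
  below \<open>s + t - 2 * \<epsilon>\<close>, and the lower half of the claim is void.\<close>

lemma threshold_sum:
  assumes fv: "fvars graph_atom_vars \<phi> \<subseteq> {0, 1}" "fvars graph_atom_vars \<psi> \<subseteq> {0, 1}"
    and thr: "threshold M d \<phi> s \<epsilon>" "threshold M d \<psi> t \<epsilon>"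
    and st: "\<epsilon> < s \<and> \<epsilon> < t \<or> s + t \<le> 2 * \<epsilon>"
  shows "threshold M d (comp_fm \<phi> \<psi>) (s + t) (2 * \<epsilon>)"
  unfolding threshold_def
proof (intro allI impI)
  fix S E u v assume gec: "gec_graph M d S E" and uv: "u \<in> S" "v \<in> S"
  then interpret gec_graph M d S E by simp
  have uvM: "u \<in> M" "v \<in> M"
    using uv vertices by auto
  have thr1: "\<And>x y. x \<in> S \<Longrightarrow> y \<in> S \<Longrightarrow> d x y < s - \<epsilon> \<Longrightarrow> holds2 S E \<phi> x y"
      "\<And>x y. x \<in> S \<Longrightarrow> y \<in> S \<Longrightarrow> d x y > s + \<epsilon> \<Longrightarrow> \<not> holds2 S E \<phi> x y"
    and thr2: "\<And>x y. x \<in> S \<Longrightarrow> y \<in> S \<Longrightarrow> d x y < t - \<epsilon> \<Longrightarrow> holds2 S E \<psi> x y"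
      "\<And>x y. x \<in> S \<Longrightarrow> y \<in> S \<Longrightarrow> d x y > t + \<epsilon> \<Longrightarrow> \<not> holds2 S E \<psi> x y"
    using thr gec unfolding threshold_def by blast+
  have "\<exists>w\<in>S. holds2 S E \<phi> u w \<and> holds2 S E \<psi> w v" if less: "d u v < s + t - 2 * \<epsilon>"
  proof -
    have "0 \<le> d u v"
      by simp
    then have pos: "s - \<epsilon> > 0" "t - \<epsilon> > 0"
      using st less \<open>0 \<le> d u v\<close> by linarith+
    obtain a where a: "0 \<le> a" "a \<le> d u v" "a < s - \<epsilon>" "d u v - a < t - \<epsilon>"
    proof (cases "d u v < t - \<epsilon>")
      case True
      with pos \<open>0 \<le> d u v\<close> that[of 0] show ?thesis
        by simp
    next
      case False
      have "d u v - (t - \<epsilon>) < min (d u v) (s - \<epsilon>)"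
        using pos less by simp
      from Orderings.dense[OF this] obtain z where "d u v - (t - \<epsilon>) < z" "z < min (d u v) (s - \<epsilon>)"
        by blast
      with that[of z] False show ?thesis
        by simp
    qed
    then obtain z where z: "z \<in> M" "d u z = a" "d z v = d u v - a"
      using between[OF uvM] by blast
    obtain w where w: "w \<in> S" "d z w < min (s - \<epsilon> - a) (t - \<epsilon> - (d u v - a))"
      using vertex_near[OF z(1), of "min (s - \<epsilon> - a) (t - \<epsilon> - (d u v - a))"] a by auto
    then have wM: "w \<in> M"
      using vertices by blast
    have "d u w < s - \<epsilon>"
      using triangle[OF uvM(1) z(1) wM] w z by linarith
    moreover have "d w v < t - \<epsilon>"
      using triangle[OF wM z(1) uvM(2)] w z commute[of z w] by linarith
    ultimately show ?thesis
      using w(1) uv thr1(1) thr2(1) by blast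
  qed
  moreover have "\<not> (\<exists>w\<in>S. holds2 S E \<phi> u w \<and> holds2 S E \<psi> w v)" if gr: "d u v > s + t + 2 * \<epsilon>"
  proof
    assume "\<exists>w\<in>S. holds2 S E \<phi> u w \<and> holds2 S E \<psi> w v"
    then obtain w where w: "w \<in> S" "holds2 S E \<phi> u w" "holds2 S E \<psi> w v" by blast
    then have "d u w \<le> s + \<epsilon>" "d w v \<le> t + \<epsilon>"
      using thr1(2)[OF uv(1) w(1)] thr2(2)[OF w(1) uv(2)] by force+
    moreover have "w \<in> M"
      using w vertices by blast
    ultimately show False
      using triangle[OF uvM(1) _ uvM(2), of w] gr by linarith
  qed
  ultimately show "(d u v < s + t - 2 * \<epsilon> \<longrightarrow> holds2 S E (comp_fm \<phi> \<psi>) u v) \<and>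
      (d u v > s + t + 2 * \<epsilon> \<longrightarrow> \<not> holds2 S E (comp_fm \<phi> \<psi>) u v)"
    unfolding holds2_comp_fm[OF fv] by blast
qed

text \<open>Up to the error, the formula says that the \<open>s\<close>-ball about \<open>v\<close>
  lies in the \<open>t\<close>-ball about \<open>u\<close>. This bounds \<open>d u v\<close> by
  \<open>t - s\<close> because one can move on from \<open>v\<close> away from \<open>u\<close>, as
  long as \<open>t\<close> is below the diameter.\<close>

lemma threshold_diff:
  assumes fv: "fvars graph_atom_vars \<phi> \<subseteq> {0, 1}" "fvars graph_atom_vars \<psi> \<subseteq> {0, 1}"
    and thr: "threshold M d \<phi> s \<epsilon>" "threshold M d \<psi> t \<epsilon>"
    and st: "\<epsilon> < s" "s \<le> t" "t + \<epsilon> < D"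
  shows "threshold M d (Neg (comp_fm (Neg \<psi>) \<phi>)) (t - s) (2 * \<epsilon>)"
  unfolding threshold_def
proof (intro allI impI)
  fix S E u v assume gec: "gec_graph M d S E" and uv: "u \<in> S" "v \<in> S"
  then interpret gec_graph M d S E by simp
  have uvM: "u \<in> M" "v \<in> M"
    using uv vertices by auto
  have thr1: "\<And>x y. x \<in> S \<Longrightarrow> y \<in> S \<Longrightarrow> d x y < s - \<epsilon> \<Longrightarrow> holds2 S E \<phi> x y"
      "\<And>x y. x \<in> S \<Longrightarrow> y \<in> S \<Longrightarrow> d x y > s + \<epsilon> \<Longrightarrow> \<not> holds2 S E \<phi> x y"
    and thr2: "\<And>x y. x \<in> S \<Longrightarrow> y \<in> S \<Longrightarrow> d x y < t - \<epsilon> \<Longrightarrow> holds2 S E \<psi> x y"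
      "\<And>x y. x \<in> S \<Longrightarrow> y \<in> S \<Longrightarrow> d x y > t + \<epsilon> \<Longrightarrow> \<not> holds2 S E \<psi> x y"
    using thr gec unfolding threshold_def by blast+
  have "\<not> (\<exists>w\<in>S. \<not> holds2 S E \<psi> u w \<and> holds2 S E \<phi> w v)" if less: "d u v < t - s - 2 * \<epsilon>"
  proof
    assume "\<exists>w\<in>S. \<not> holds2 S E \<psi> u w \<and> holds2 S E \<phi> w v"
    then obtain w where w: "w \<in> S" "\<not> holds2 S E \<psi> u w" "holds2 S E \<phi> w v" by blast
    then have "d u w \<ge> t - \<epsilon>" "d w v \<le> s + \<epsilon>"
      using thr2(1)[OF uv(1) w(1)] thr1(2)[OF w(1) uv(2)] by force+
    moreover have "w \<in> M"
      using w vertices by blast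
    ultimately show False
      using triangle[OF uvM, of w] commute[of v w] less by linarith
  qed
  moreover have "\<exists>w\<in>S. \<not> holds2 S E \<psi> u w \<and> holds2 S E \<phi> w v" if gr: "d u v > t - s + 2 * \<epsilon>"
  proof (cases "d u v > t + \<epsilon>")
    case True
    moreover have "d v v < s - \<epsilon>"
      using st uvM by simp
    ultimately show ?thesis
      using thr1(1) thr2(2) uv by blast
  next
    case False
    \<comment> \<open>Room for overshooting \<open>t + \<epsilon>\<close> by
      \<open>2 * \<delta>\<close> on the prolonged path, within \<open>D\<close>, and for replacing
      its end by a vertex within \<open>\<delta>\<close>.\<close>
    define \<delta> where "\<delta> = min (d u v - (t - s + 2 * \<epsilon>)) (D - t - \<epsilon>) / 4"
    have \<delta>: "\<delta> > 0" "4 * \<delta> \<le> d u v - (t - s + 2 * \<epsilon>)" "4 * \<delta> \<le> D - t - \<epsilon>"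
      using gr st by (auto simp: \<delta>_def)
    obtain z where z: "z \<in> M" "d u z = t + \<epsilon> + 2 * \<delta>" "d v z = t + \<epsilon> + 2 * \<delta> - d u v"
      using beyond[OF uvM, of "t + \<epsilon> + 2 * \<delta>"] False \<delta> by auto
    obtain w where w: "w \<in> S" "d z w < \<delta>"
      using vertex_near[OF z(1) \<delta>(1)] by blast
    then have wM: "w \<in> M"
      using vertices by blast
    have "d u w > t + \<epsilon>"
      using triangle[OF uvM(1) wM z(1)] commute[of z w] w z \<delta>(1) by linarith
    moreover have "d w v < s - \<epsilon>"
      using triangle[OF wM z(1) uvM(2)] commute[of z w] commute[of z v] w z \<delta> by linarith
    ultimately show ?thesis
      using w(1) uv thr1(1) thr2(2) by blast
  qed
  ultimately show "(d u v < t - s - 2 * \<epsilon> \<longrightarrow> holds2 S E (Neg (comp_fm (Neg \<psi>) \<phi>)) u v) \<and>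
      (d u v > t - s + 2 * \<epsilon> \<longrightarrow> \<not> holds2 S E (Neg (comp_fm (Neg \<psi>) \<phi>)) u v)"
    using holds2_comp_fm[of "Neg \<psi>" \<phi> S E u v] fv by (simp add: holds2_Neg)
qed

text \<open>
  Two points at distance more than \<open>s\<close> from a third one are within \<open>2 * (D - s)\<close> of each other by the
  perimeter bound, and the antipode of their midpoint shows that this is sharp.
\<close>

lemma threshold_compl:
  assumes fv: "fvars graph_atom_vars \<phi> \<subseteq> {0, 1}" and thr: "threshold M d \<phi> s \<epsilon>"
  shows "threshold M d (comp_fm (Neg \<phi>) (Neg \<phi>)) (2 * (D - s)) (2 * \<epsilon>)"
  unfolding threshold_def
proof (intro allI impI)
  fix S E u v assume gec: "gec_graph M d S E" and uv: "u \<in> S" "v \<in> S"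
  then interpret gec_graph M d S E by simp
  have uvM: "u \<in> M" "v \<in> M"
    using uv vertices by auto
  have thr1: "\<And>x y. x \<in> S \<Longrightarrow> y \<in> S \<Longrightarrow> d x y < s - \<epsilon> \<Longrightarrow> holds2 S E \<phi> x y"
      "\<And>x y. x \<in> S \<Longrightarrow> y \<in> S \<Longrightarrow> d x y > s + \<epsilon> \<Longrightarrow> \<not> holds2 S E \<phi> x y"
    using thr gec unfolding threshold_def by blast+
  have "\<exists>w\<in>S. \<not> holds2 S E \<phi> u w \<and> \<not> holds2 S E \<phi> w v" if less: "d u v < 2 * (D - s) - 2 * \<epsilon>"
  proof -
    obtain m where m: "m \<in> M" "d u m = d u v / 2" "d m v = d u v - d u v / 2"
      using between[OF uvM, of "d u v / 2"] by auto
    obtain z where z: "z \<in> M" "d m z = D"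
      using beyond[OF m(1) m(1), of D] D m(1) by auto
    define \<delta> where "\<delta> = D - d u v / 2 - (s + \<epsilon>)"
    have "\<delta> > 0"
      using less by (simp add: \<delta>_def)
    then obtain w where w: "w \<in> S" "d z w < \<delta>"
      using vertex_near[OF z(1)] by blast
    then have wM: "w \<in> M"
      using vertices by blast
    have "d m w > D - \<delta>"
      using triangle[OF m(1) wM z(1)] commute[of z w] w z by linarith
    then have "d u w > s + \<epsilon>" "d w v > s + \<epsilon>"
      using triangle[OF m(1) uvM(1) wM] triangle[OF m(1) uvM(2) wM] commute[of m u] commute[of w v] m
      by (simp_all add: \<delta>_def)
    then show ?thesis
      using w(1) uv thr1(2) by blast
  qed
  moreover have "\<not> (\<exists>w\<in>S. \<not> holds2 S E \<phi> u w \<and> \<not> holds2 S E \<phi> w v)" if gr: "d u v > 2 * (D - s) + 2 * \<epsilon>"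
  proof
    assume "\<exists>w\<in>S. \<not> holds2 S E \<phi> u w \<and> \<not> holds2 S E \<phi> w v"
    then obtain w where w: "w \<in> S" "\<not> holds2 S E \<phi> u w" "\<not> holds2 S E \<phi> w v" by blast
    then have "d u w \<ge> s - \<epsilon>" "d w v \<ge> s - \<epsilon>"
      using thr1(1)[OF uv(1) w(1)] thr1(1)[OF w(1) uv(2)] by force+
    moreover have "w \<in> M"
      using w vertices by blast
    ultimately show False
      using perimeter[OF uvM, of w] commute[of u w] commute[of v w] gr by (simp add: algebra_simps)
  qed
  ultimately show "(d u v < 2 * (D - s) - 2 * \<epsilon> \<longrightarrow> holds2 S E (comp_fm (Neg \<phi>) (Neg \<phi>)) u v) \<and>
      (d u v > 2 * (D - s) + 2 * \<epsilon> \<longrightarrow> \<not> holds2 S E (comp_fm (Neg \<phi>) (Neg \<phi>)) u v)"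
    using holds2_comp_fm[of "Neg \<phi>" "Neg \<phi>" S E u v] fv by (simp add: holds2_Neg)
qed

text \<open>
  If \<open>d u v > 1 + \<epsilon>\<close>, any neighbour \<open>w\<close> of \<open>v\<close> is at distance more than \<open>\<epsilon>\<close> from \<open>u\<close>; going from \<open>w\<close>
  through \<open>u\<close> and almost one unit further (or to the antipode of \<open>w\<close>), one meets a neighbour of \<open>u\<close>
  that is not adjacent to \<open>w\<close>. By compactness, finitely many neighbours of \<open>u\<close> serve for all \<open>w\<close>.
\<close>

lemma threshold_unit:
  assumes "\<epsilon> > 0"
  shows "\<exists>K\<^sub>0. \<forall>K\<ge>K\<^sub>0. threshold M d (unit_fm K) 1 \<epsilon>"
proof -
  \<comment> \<open>Mesh of the net. The bounds by \<open>\<epsilon> / 8\<close> and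
    \<open>(D - 1) / 4\<close> put the point \<open>x\<close> found below at distance at least
    \<open>1 + 4 * c\<close> from \<open>w\<close>, while the errors from net point and neighbour
    add up to less than \<open>3 * c\<close>.\<close>
  define c where "c = min (min (\<epsilon> / 8) (1 / 4)) ((D - 1) / 4)"
  have c: "c > 0" "8 * c \<le> \<epsilon>" "4 * c \<le> 1" "4 * c \<le> D - 1"
    using assms D by (auto simp: c_def min_def)
  obtain F where F: "finite F" "F \<subseteq> M" "\<forall>x\<in>M. \<exists>f\<in>F. d x f < c"
    using finite_net[OF c(1)] by blast
  have "threshold M d (unit_fm K) 1 \<epsilon>" if K: "K \<ge> card F" for K
    unfolding threshold_def
  proof (intro allI impI)
    fix S E u v assume gec: "gec_graph M d S E" and uv: "u \<in> S" "v \<in> S"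
    then interpret gec_graph M d S E by simp
    have uvM: "u \<in> M" "v \<in> M"
      using uv vertices by auto
    have "holds2 S E (unit_fm K) u v" if less: "d u v < 1 - \<epsilon>"
      unfolding holds2_unit_fm
    proof (intro allI impI)
      fix a assume a: "\<forall>i<K. a i \<in> S \<and> (u, a i) \<in> E"
      have "d u x < 1" if "x \<in> insert v (a ` {..<K})" for x
        using that a less assms adjacent_close by auto
      then obtain w where "w \<in> S" "\<forall>x\<in>insert v (a ` {..<K}). (w, x) \<in> E"
        using common_neighbour[OF uv(1), of "insert v (a ` {..<K})"] a uv(2) by auto
      then show "\<exists>w\<in>S. (w, v) \<in> E \<and> (\<forall>i<K. (w, a i) \<in> E)"
        by auto
    qed
    moreover have "\<not> holds2 S E (unit_fm K) u v" if gr: "d u v > 1 + \<epsilon>"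
    proof
      assume h: "holds2 S E (unit_fm K) u v"
      obtain n0 where n0: "n0 \<in> S" "(u, n0) \<in> E"
        using neighbour_near[OF uv(1) uvM(1), of 1] uvM by auto
      \<comment> \<open>One neighbour of \<open>u\<close> per net point, fixed before
        \<open>w\<close> is known; \<open>n0\<close> is the default for net points with no neighbour
        of \<open>u\<close> nearby.\<close>
      define nb where "nb f = (if \<exists>n\<in>S. (u, n) \<in> E \<and> d f n < 2 * c then SOME n. n \<in> S \<and> (u, n) \<in> E \<and> d f n < 2 * c else n0)" for f
      have nb: "nb f \<in> S \<and> (u, nb f) \<in> E" for f
        using n0 someI_ex[of "\<lambda>n. n \<in> S \<and> (u, n) \<in> E \<and> d f n < 2 * c"] by (auto simp: nb_def)
      have nb_near: "d f (nb f) < 2 * c" if "n \<in> S" "(u, n) \<in> E" "d f n < 2 * c" for f n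
        using that someI_ex[of "\<lambda>n. n \<in> S \<and> (u, n) \<in> E \<and> d f n < 2 * c"] by (auto simp: nb_def)
      obtain g where g: "bij_betw g {0..<card F} F"
        using ex_bij_betw_nat_finite[OF F(1)] by blast
      \<comment> \<open>From index \<open>card F\<close> on nothing is known about
        \<open>g i\<close>, but every value of \<open>nb\<close> is a neighbour of
        \<open>u\<close>.\<close>
      obtain w where w: "w \<in> S" "(w, v) \<in> E" "\<forall>i<K. (w, nb (g i)) \<in> E"
        using h[unfolded holds2_unit_fm, rule_format, of "\<lambda>i. nb (g i)"] nb by blast
      have wM: "w \<in> M"
        using w(1) vertices by blast
      have "d w v < 1"
        using w(2) adjacent_close by blast
      then have wu: "d w u > \<epsilon>"
        using triangle[OF uvM(1) wM uvM(2)] commute[of u w] gr by linarith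
      define T where "T = min D (d w u + 1 - 4 * c)"
      have T: "d w u \<le> T" "T \<le> D" "T - d w u \<le> 1 - 4 * c" "T \<ge> 1 + 4 * c"
        using diameter[OF wM uvM(1)] c wu D unfolding T_def by (auto simp: min_def)
      obtain x where x: "x \<in> M" "d w x = T" "d u x = T - d w u"
        using beyond[OF wM uvM(1) T(1,2)] by blast
      obtain f where f: "f \<in> F" "d x f < c"
        using F(3) x(1) by blast
      then have fM: "f \<in> M"
        using F(2) by blast
      have "d u f < 1"
        using triangle[OF uvM(1) x(1) fM] f x T(3) c(1) by linarith
      then obtain n where "n \<in> S" "(u, n) \<in> E" "d f n < 2 * c"
        using neighbour_near[OF uv(1) fM, of "2 * c"] c(1) by auto
      then have near: "d f (nb f) < 2 * c"
        by (rule nb_near)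
      obtain i where "i < card F" "g i = f"
        using g f(1) unfolding bij_betw_def by force
      then have "d w (nb f) < 1"
        using w(3) K adjacent_close by (metis order_less_le_trans)
      moreover have nbM: "nb f \<in> M"
        using nb vertices by blast
      ultimately show False
        using triangle[OF wM fM x(1)] triangle[OF wM nbM fM] commute[of f x] commute[of f "nb f"]
          near f(2) x(2) T(4) c(1) by linarith
    qed
    ultimately show "(d u v < 1 - \<epsilon> \<longrightarrow> holds2 S E (unit_fm K) u v) \<and>
        (d u v > 1 + \<epsilon> \<longrightarrow> \<not> holds2 S E (unit_fm K) u v)"
      by blast
  qed
  then show ?thesis
    by blast
qed

end

section \<open>Comparison of two spaces with the same theory\<close>

lemma threshold_separation:
  assumes X1: "round_space M\<^sub>1 d\<^sub>1 D\<^sub>1"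
    and K1: "\<And>S E. C\<^sub>1 S E \<Longrightarrow> gec_graph M\<^sub>1 d\<^sub>1 S E" and K2: "\<And>S E. C\<^sub>2 S E \<Longrightarrow> gec_graph M\<^sub>2 d\<^sub>2 S E"
    and ex: "C\<^sub>2 S\<^sub>2 E\<^sub>2" "S\<^sub>2 \<noteq> {}"
    and eq: "common_graph_theory C\<^sub>1 = common_graph_theory C\<^sub>2"
    and fv: "fvars graph_atom_vars \<phi> \<subseteq> {0, 1}" "fvars graph_atom_vars \<psi> \<subseteq> {0, 1}"
    and \<phi>: "threshold M\<^sub>1 d\<^sub>1 \<phi> s \<epsilon>" "threshold M\<^sub>2 d\<^sub>2 \<phi> s' \<epsilon>"
    and \<psi>: "threshold M\<^sub>1 d\<^sub>1 \<psi> t \<epsilon>" "threshold M\<^sub>2 d\<^sub>2 \<psi> t' \<epsilon>"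
    and pos: "0 \<le> s" "\<epsilon> > 0" and less: "s + \<epsilon> < t - \<epsilon>" "s + \<epsilon> < D\<^sub>1"
  shows "s' - \<epsilon> \<le> t' + \<epsilon>"
proof -
  interpret X1: round_space M\<^sub>1 d\<^sub>1 D\<^sub>1 by fact
  \<comment> \<open>\<open>\<sigma>\<close> asserts a pair of vertices with \<open>\<psi>\<close>
    but not \<open>\<phi>\<close>, so a distance between the two thresholds. It is true in every
    graph of the first class, since all distances up to \<open>D\<^sub>1\<close> occur there, hence
    in the given graph of the second.\<close>
  define \<sigma> where "\<sigma> = Ex 0 (Ex 1 (Conj \<psi> (Neg \<phi>)))"
  have \<sigma>: "\<sigma> \<in> graph_sentences"
    using fv by (auto simp: \<sigma>_def graph_sentences_def)
  have sat: "sat (graph_atom_holds E) S \<sigma> e \<longleftrightarrow> (\<exists>u\<in>S. \<exists>v\<in>S. holds2 S E \<psi> u v \<and> \<not> holds2 S E \<phi> u v)"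
    for S :: "'b set" and E e
    unfolding \<sigma>_def sat.simps sat_holds2[OF fv(1)] sat_holds2[OF fv(2)] by simp
  have sat1: "sat (graph_atom_holds E) S \<sigma> e \<longleftrightarrow> (\<exists>u\<in>S. \<exists>v\<in>S. holds2 S E \<psi> u v \<and> \<not> holds2 S E \<phi> u v)"
    for S :: "'a set" and E e
    unfolding \<sigma>_def sat.simps sat_holds2[OF fv(1)] sat_holds2[OF fv(2)] by simp
  have "sat (graph_atom_holds E) S \<sigma> e" if "C\<^sub>1 S E" for S E e
  proof -
    interpret gec_graph M\<^sub>1 d\<^sub>1 S E
      using that by (rule K1)
    obtain x where x: "x \<in> M\<^sub>1"
      using X1.nonempty by blast
    obtain T where T: "s + \<epsilon> < T" "T < min (t - \<epsilon>) D\<^sub>1"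
      using Orderings.dense[of "s + \<epsilon>" "min (t - \<epsilon>) D\<^sub>1"] less by auto
    obtain y where y: "y \<in> M\<^sub>1" "d\<^sub>1 x y = T"
      using X1.beyond[OF x x, of T] x T pos by auto
    define \<delta> where "\<delta> = min (T - (s + \<epsilon>)) (t - \<epsilon> - T) / 2"
    have \<delta>: "\<delta> > 0" "2 * \<delta> \<le> T - (s + \<epsilon>)" "2 * \<delta> \<le> t - \<epsilon> - T"
      using T by (auto simp: \<delta>_def)
    obtain u v where uv: "u \<in> S" "v \<in> S" "d\<^sub>1 x u < \<delta>" "d\<^sub>1 y v < \<delta>"
      using vertex_near[OF x \<delta>(1)] vertex_near[OF y(1) \<delta>(1)] by blast
    then have M: "u \<in> M\<^sub>1" "v \<in> M\<^sub>1"
      using vertices by auto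
    have "d\<^sub>1 u v < t - \<epsilon>"
      using X1.triangle[OF M(1) x M(2)] X1.triangle[OF x y(1) M(2)] X1.commute[of x u] uv y(2) \<delta>(3) by linarith
    moreover have "d\<^sub>1 u v > s + \<epsilon>"
      using X1.triangle[OF x M(1) y(1)] X1.triangle[OF M(1,2) y(1)] X1.commute[of y v] uv y(2) \<delta>(2) by linarith
    ultimately have "holds2 S E \<psi> u v" "\<not> holds2 S E \<phi> u v"
      using \<phi>(1) \<psi>(1) K1[OF that] uv(1,2) unfolding threshold_def by blast+
    with uv(1,2) show ?thesis
      unfolding sat1 by blast
  qed
  then have "\<sigma> \<in> common_graph_theory C\<^sub>1"
    using \<sigma> by (simp add: common_graph_theory_def graph_theory_def)
  then have "\<sigma> \<in> common_graph_theory C\<^sub>2"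
    using eq by simp
  then have "\<sigma> \<in> graph_theory S\<^sub>2 E\<^sub>2"
    using ex(1) by (simp add: common_graph_theory_def)
  moreover obtain a where "a \<in> S\<^sub>2"
    using ex(2) by blast
  ultimately have "sat (graph_atom_holds E\<^sub>2) S\<^sub>2 \<sigma> (\<lambda>_. a)"
    by (auto simp: graph_theory_def)
  then obtain u v where uv: "u \<in> S\<^sub>2" "v \<in> S\<^sub>2" "holds2 S\<^sub>2 E\<^sub>2 \<psi> u v" "\<not> holds2 S\<^sub>2 E\<^sub>2 \<phi> u v"
    unfolding sat by blast
  have "\<not> d\<^sub>2 u v > t' + \<epsilon>" "\<not> d\<^sub>2 u v < s' - \<epsilon>"
    using \<phi>(2) \<psi>(2) K2[OF ex(1)] uv unfolding threshold_def by blast+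
  then show ?thesis
    by linarith
qed

theorem round_spaces_same_diameter:
  assumes X1: "round_space M\<^sub>1 d\<^sub>1 D\<^sub>1" and X2: "round_space M\<^sub>2 d\<^sub>2 D\<^sub>2"
    and K1: "\<And>S E. C\<^sub>1 S E \<Longrightarrow> gec_graph M\<^sub>1 d\<^sub>1 S E" and K2: "\<And>S E. C\<^sub>2 S E \<Longrightarrow> gec_graph M\<^sub>2 d\<^sub>2 S E"
    and ex1: "C\<^sub>1 S\<^sub>1 E\<^sub>1" "S\<^sub>1 \<noteq> {}" and ex2: "C\<^sub>2 S\<^sub>2 E\<^sub>2" "S\<^sub>2 \<noteq> {}"
    and eq: "common_graph_theory C\<^sub>1 = common_graph_theory C\<^sub>2"
  shows "D\<^sub>1 = D\<^sub>2"
proof -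
  interpret X1: round_space M\<^sub>1 d\<^sub>1 D\<^sub>1 by fact
  interpret X2: round_space M\<^sub>2 d\<^sub>2 D\<^sub>2 by fact
  \<comment> \<open>One formula must work in both spaces with the same error; it may change with the
    error.\<close>
  define thr where "thr \<phi> t t' \<epsilon> \<longleftrightarrow> fvars graph_atom_vars \<phi> \<subseteq> {0, 1} \<and>
    threshold M\<^sub>1 d\<^sub>1 \<phi> t \<epsilon> \<and> threshold M\<^sub>2 d\<^sub>2 \<phi> t' \<epsilon>" for \<phi> t t' \<epsilon>
  define \<Theta> where "\<Theta> t t' \<longleftrightarrow> 0 \<le> t \<and> 0 \<le> t' \<and> (\<forall>\<epsilon>>0. \<exists>\<phi>. thr \<phi> t t' \<epsilon>)" for t t'
  have \<Theta>D: "\<exists>\<phi>. thr \<phi> t t' \<epsilon>" if "\<Theta> t t'" "\<epsilon> > 0" for t t' \<epsilon>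
    using that by (simp add: \<Theta>_def)
  have thr_mono: "thr \<phi> t t' \<epsilon>'" if "thr \<phi> t t' \<epsilon>" "\<epsilon> \<le> \<epsilon>'" for \<phi> t t' \<epsilon> \<epsilon>'
    using that threshold_mono[of M\<^sub>1 d\<^sub>1 \<phi> t \<epsilon> \<epsilon>'] threshold_mono[of M\<^sub>2 d\<^sub>2 \<phi> t' \<epsilon> \<epsilon>']
    unfolding thr_def by simp
  have "threshold_correspondence \<Theta> D\<^sub>1 D\<^sub>2"
  proof
    show "D\<^sub>1 > 1" "D\<^sub>2 > 1"
      by (rule X1.D X2.D)+
    show "\<Theta> t t' \<Longrightarrow> 0 \<le> t \<and> 0 \<le> t'" for t t'
      by (simp add: \<Theta>_def)
    show "\<Theta> 1 1"
      unfolding \<Theta>_def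
    proof (intro conjI allI impI)
      fix \<epsilon> :: real assume "\<epsilon> > 0"
      then obtain K\<^sub>1 K\<^sub>2 where "\<forall>K\<ge>K\<^sub>1. threshold M\<^sub>1 d\<^sub>1 (unit_fm K) 1 \<epsilon>" "\<forall>K\<ge>K\<^sub>2. threshold M\<^sub>2 d\<^sub>2 (unit_fm K) 1 \<epsilon>"
        using X1.threshold_unit X2.threshold_unit by meson
      then show "\<exists>\<phi>. thr \<phi> 1 1 \<epsilon>"
        unfolding thr_def using fvars_unit_fm by (intro exI[of _ "unit_fm (max K\<^sub>1 K\<^sub>2)"]) simp
    qed auto
    show "\<Theta> D\<^sub>1 D\<^sub>2"
      unfolding \<Theta>_def
    proof (intro conjI allI impI)
      fix \<epsilon> :: real assume "\<epsilon> > 0"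
      then show "\<exists>\<phi>. thr \<phi> D\<^sub>1 D\<^sub>2 \<epsilon>"
        unfolding thr_def using X1.threshold_top X2.threshold_top
        by (intro exI[of _ True_fm]) (auto simp: True_fm_def)
    qed (use X1.D X2.D in auto)
    show "\<Theta> (s + t) (s' + t')"
      if st: "\<Theta> s s'" "\<Theta> t t'" "s = 0 \<longleftrightarrow> t = 0" "s' = 0 \<longleftrightarrow> t' = 0" for s s' t t'
    proof -
      have nn: "0 \<le> s" "0 \<le> t" "0 \<le> s'" "0 \<le> t'"
        using st by (auto simp: \<Theta>_def)
      have "\<exists>\<phi>. thr \<phi> (s + t) (s' + t') \<epsilon>" if "\<epsilon> > 0" for \<epsilon>
      proof -
        \<comment> \<open>Half of a positive threshold, and 1 for the threshold 0: this keeps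
          \<open>\<delta>\<close> below the positive thresholds and positive itself.\<close>
        define h where "h x = (if x > 0 then x / 2 else 1)" for x :: real
        have h: "h x > 0" "x > 0 \<Longrightarrow> h x < x" for x
          by (auto simp: h_def)
        let ?m = "{\<epsilon> / 2, h s, h t, h s', h t'}"
        define \<delta> where "\<delta> = Min ?m"
        have le: "\<delta> \<le> x" if "x \<in> ?m" for x
          unfolding \<delta>_def using that by (intro Min_le) auto
        have \<delta>: "2 * \<delta> \<le> \<epsilon>" "\<delta> \<le> h s" "\<delta> \<le> h t" "\<delta> \<le> h s'" "\<delta> \<le> h t'"
          using le[of "\<epsilon> / 2"] le[of "h s"] le[of "h t"] le[of "h s'"] le[of "h t'"] by simp_all
        have "\<delta> > 0"
          unfolding \<delta>_def using that h(1) by simp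
        have *: "\<delta> < x \<and> \<delta> < y \<or> x + y \<le> 2 * \<delta>"
          if "0 \<le> x" "0 \<le> y" "x = 0 \<longleftrightarrow> y = 0" "\<delta> \<le> h x" "\<delta> \<le> h y" for x y
          using that h(2)[of x] h(2)[of y] \<open>\<delta> > 0\<close> by (cases "x = 0") auto
        obtain \<phi> \<psi> where thr: "thr \<phi> s s' \<delta>" "thr \<psi> t t' \<delta>"
          using \<Theta>D[OF st(1) \<open>\<delta> > 0\<close>] \<Theta>D[OF st(2) \<open>\<delta> > 0\<close>] by blast
        have "\<delta> < s \<and> \<delta> < t \<or> s + t \<le> 2 * \<delta>" "\<delta> < s' \<and> \<delta> < t' \<or> s' + t' \<le> 2 * \<delta>"
          by (intro * nn st(3,4) \<delta>)+
        with thr have "thr (comp_fm \<phi> \<psi>) (s + t) (s' + t') (2 * \<delta>)"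
          unfolding thr_def
          using X1.threshold_sum[of \<phi> \<psi> s \<delta> t] X2.threshold_sum[of \<phi> \<psi> s' \<delta> t'] fvars_comp_fm[of \<phi> \<psi>] by simp
        with thr_mono \<delta>(1) show ?thesis
          by blast
      qed
      with nn show ?thesis
        by (simp add: \<Theta>_def)
    qed
    show "\<Theta> (t - s) (t' - s')"
      if st: "\<Theta> s s'" "\<Theta> t t'" "0 < s" "s \<le> t" "t < D\<^sub>1" "0 < s'" "s' \<le> t'" "t' < D\<^sub>2" for s s' t t'
    proof -
      have "\<exists>\<phi>. thr \<phi> (t - s) (t' - s') \<epsilon>" if "\<epsilon> > 0" for \<epsilon>
      proof -
        define \<delta> where "\<delta> = Min {\<epsilon>, s, s', D\<^sub>1 - t, D\<^sub>2 - t'} / 2"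
        have "Min {\<epsilon>, s, s', D\<^sub>1 - t, D\<^sub>2 - t'} > 0"
          using that st by simp
        moreover have "Min {\<epsilon>, s, s', D\<^sub>1 - t, D\<^sub>2 - t'} \<le> \<epsilon>" "Min {\<epsilon>, s, s', D\<^sub>1 - t, D\<^sub>2 - t'} \<le> s" "Min {\<epsilon>, s, s', D\<^sub>1 - t, D\<^sub>2 - t'} \<le> s'" "Min {\<epsilon>, s, s', D\<^sub>1 - t, D\<^sub>2 - t'} \<le> D\<^sub>1 - t" "Min {\<epsilon>, s, s', D\<^sub>1 - t, D\<^sub>2 - t'} \<le> D\<^sub>2 - t'"
          by (intro Min_le; simp)+
        ultimately have \<delta>: "\<delta> > 0" "2 * \<delta> \<le> \<epsilon>" "\<delta> < s" "\<delta> < s'" "t + \<delta> < D\<^sub>1" "t' + \<delta> < D\<^sub>2"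
          unfolding \<delta>_def by linarith+
        obtain \<phi> \<psi> where thr: "thr \<phi> s s' \<delta>" "thr \<psi> t t' \<delta>"
          using \<Theta>D[OF st(1) \<delta>(1)] \<Theta>D[OF st(2) \<delta>(1)] by blast
        have fv: "fvars graph_atom_vars \<phi> \<subseteq> {0, 1}" "fvars graph_atom_vars \<psi> \<subseteq> {0, 1}"
          using thr by (auto simp: thr_def)
        have "thr (Neg (comp_fm (Neg \<psi>) \<phi>)) (t - s) (t' - s') (2 * \<delta>)"
          using X1.threshold_diff[OF fv _ _ \<delta>(3) st(4) \<delta>(5)] X2.threshold_diff[OF fv _ _ \<delta>(4) st(7) \<delta>(6)]
            thr fvars_comp_fm[of "Neg \<psi>" \<phi>] fv unfolding thr_def by simp
        with thr_mono \<delta>(2) show ?thesis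
          by blast
      qed
      with st show ?thesis
        by (simp add: \<Theta>_def)
    qed
    show "\<Theta> (2 * (D\<^sub>1 - s)) (2 * (D\<^sub>2 - s'))" if s: "\<Theta> s s'" "s \<le> D\<^sub>1" "s' \<le> D\<^sub>2" for s s'
    proof -
      have "\<exists>\<phi>. thr \<phi> (2 * (D\<^sub>1 - s)) (2 * (D\<^sub>2 - s')) \<epsilon>" if e: "\<epsilon> > 0" for \<epsilon>
      proof -
        obtain \<phi> where thr: "thr \<phi> s s' (\<epsilon> / 2)"
          using \<Theta>D[OF s(1), of "\<epsilon> / 2"] e by auto
        have fv: "fvars graph_atom_vars \<phi> \<subseteq> {0, 1}"
          using thr by (simp add: thr_def)
        have "thr (comp_fm (Neg \<phi>) (Neg \<phi>)) (2 * (D\<^sub>1 - s)) (2 * (D\<^sub>2 - s')) (2 * (\<epsilon> / 2))"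
          using X1.threshold_compl[OF fv, of s "\<epsilon> / 2"] X2.threshold_compl[OF fv, of s' "\<epsilon> / 2"]
            thr fvars_comp_fm[of "Neg \<phi>" "Neg \<phi>"] fv unfolding thr_def by simp
        then show ?thesis
          by auto
      qed
      with s show ?thesis
        by (simp add: \<Theta>_def)
    qed
    show "s' \<le> t'" if st: "\<Theta> s s'" "\<Theta> t t'" "s < t" "s < D\<^sub>1" for s s' t t'
    proof (rule ccontr)
      assume "\<not> s' \<le> t'"
      define \<epsilon> where "\<epsilon> = Min {t - s, D\<^sub>1 - s, s' - t'} / 3"
      have "Min {t - s, D\<^sub>1 - s, s' - t'} > 0"
        using st \<open>\<not> s' \<le> t'\<close> by simp
      moreover have "Min {t - s, D\<^sub>1 - s, s' - t'} \<le> t - s" "Min {t - s, D\<^sub>1 - s, s' - t'} \<le> D\<^sub>1 - s" "Min {t - s, D\<^sub>1 - s, s' - t'} \<le> s' - t'"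
          by (intro Min_le; simp)+
      ultimately have \<epsilon>: "\<epsilon> > 0" "s + \<epsilon> < t - \<epsilon>" "s + \<epsilon> < D\<^sub>1" "t' + \<epsilon> < s' - \<epsilon>"
          unfolding \<epsilon>_def by linarith+
      obtain \<phi> \<psi> where thr: "thr \<phi> s s' \<epsilon>" "thr \<psi> t t' \<epsilon>"
        using \<Theta>D[OF st(1) \<epsilon>(1)] \<Theta>D[OF st(2) \<epsilon>(1)] by blast
      have "s' - \<epsilon> \<le> t' + \<epsilon>"
        by (rule threshold_separation[OF X1 K1 K2 ex2 eq, of \<phi> \<psi> s \<epsilon> s' t t'])
          (use thr st(1) \<epsilon> in \<open>auto simp: thr_def \<Theta>_def\<close>)
      with \<epsilon>(4) show False
        by simp
    qed
    show "s \<le> t" if st: "\<Theta> s s'" "\<Theta> t t'" "s' < t'" "s' < D\<^sub>2" for s s' t t'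
    proof (rule ccontr)
      assume "\<not> s \<le> t"
      define \<epsilon> where "\<epsilon> = Min {t' - s', D\<^sub>2 - s', s - t} / 3"
      have "Min {t' - s', D\<^sub>2 - s', s - t} > 0"
        using st \<open>\<not> s \<le> t\<close> by simp
      moreover have "Min {t' - s', D\<^sub>2 - s', s - t} \<le> t' - s'" "Min {t' - s', D\<^sub>2 - s', s - t} \<le> D\<^sub>2 - s'" "Min {t' - s', D\<^sub>2 - s', s - t} \<le> s - t"
          by (intro Min_le; simp)+
      ultimately have \<epsilon>: "\<epsilon> > 0" "s' + \<epsilon> < t' - \<epsilon>" "s' + \<epsilon> < D\<^sub>2" "t + \<epsilon> < s - \<epsilon>"
          unfolding \<epsilon>_def by linarith+
      obtain \<phi> \<psi> where thr: "thr \<phi> s s' \<epsilon>" "thr \<psi> t t' \<epsilon>"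
        using \<Theta>D[OF st(1) \<epsilon>(1)] \<Theta>D[OF st(2) \<epsilon>(1)] by blast
      have "s - \<epsilon> \<le> t + \<epsilon>"
        by (rule threshold_separation[OF X2 K2 K1 ex1 eq[symmetric], of \<phi> \<psi> s' \<epsilon> s t' t])
          (use thr st(1) \<epsilon> in \<open>auto simp: thr_def \<Theta>_def\<close>)
      with \<epsilon>(4) show False
        by simp
    qed
  qed
  then show ?thesis
    by (rule threshold_correspondence.rigidity)
qed

section \<open>Circles\<close>

lemma circle_dist_representatives:
  assumes "x \<in> circle L" "y \<in> circle L"
  shows "circle_dist L x y = min \<bar>x - y\<bar> (L - \<bar>x - y\<bar>)"
  using assms by (simp add: circle_dist_def circle_def)

text \<open>Passing to representatives changes \<open>a - b\<close> by a multiple of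
  \<open>L\<close>, and by size only \<open>- L\<close>, 0 and \<open>L\<close> are
  possible.\<close>

lemma circle_dist_shift:
  assumes L: "L > 0" and ab: "\<bar>a - b\<bar> \<le> L / 2"
  shows "circle_dist L (a rmod L) (b rmod L) = \<bar>a - b\<bar>"
proof -
  define x y where "x = a rmod L" and "y = b rmod L"
  have xy: "0 \<le> x" "x < L" "0 \<le> y" "y < L"
    using L by (auto simp: x_def y_def rmod_less rmod_nonneg)
  obtain k :: int where k: "x - y = a - b + of_int k * L"
  proof
    show "x - y = a - b + of_int (\<lfloor>b / L\<rfloor> - \<lfloor>a / L\<rfloor>) * L"
      using L by (simp add: x_def y_def rmod_def algebra_simps)
  qed
  have "\<bar>of_int k * L\<bar> < 2 * L"
    using k ab xy L by linarith
  then have "\<bar>of_int k :: real\<bar> < 2"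
    using L by (simp add: abs_mult)
  then have "k = -1 \<or> k = 0 \<or> k = 1"
    by linarith
  then have "min \<bar>x - y\<bar> (L - \<bar>x - y\<bar>) = \<bar>a - b\<bar>"
    using k ab xy L by (elim disjE) (auto simp: min_def abs_if split: if_splits)
  moreover have "x \<in> circle L" "y \<in> circle L"
    using xy by (auto simp: circle_def)
  ultimately show ?thesis
    unfolding x_def[symmetric] y_def[symmetric] by (simp add: circle_dist_representatives)
qed

lemma round_space_circle:
  assumes "L > 2"
  shows "round_space (circle L) (circle_dist L) (L / 2)"
proof -
  have L: "L > 0"
    using assms by simp
  interpret Metric_space "circle L" "circle_dist L"
    by (rule Metric_space_circle[OF L])
  show ?thesis
  proof
    show "L / 2 > 1"
      using assms by simp
    show "circle L \<noteq> {}"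
      using L by (auto simp: circle_def)
    fix x y assume xy: "x \<in> circle L" "y \<in> circle L"
    show "\<exists>\<gamma>. (\<forall>s\<in>{0..L / 2}. \<gamma> s \<in> circle L) \<and>
      (\<forall>s\<in>{0..L / 2}. \<forall>t\<in>{0..L / 2}. circle_dist L (\<gamma> s) (\<gamma> t) = \<bar>s - t\<bar>) \<and> \<gamma> 0 = x \<and> \<gamma> (circle_dist L x y) = y"
    proof -
      have dist: "circle_dist L x y = min \<bar>x - y\<bar> (L - \<bar>x - y\<bar>)"
        by (rule circle_dist_representatives[OF xy])
      \<comment> \<open>\<open>c\<close> is the direction of the shorter arc from \<open>x\<close>
        to \<open>y\<close>, and \<open>n\<close> corrects for an arc that passes through 0.\<close>
      obtain c :: real and n :: int where c: "c = 1 \<or> c = -1" "x + c * circle_dist L x y = y + of_int n * L"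
      proof (cases "\<bar>x - y\<bar> \<le> L - \<bar>x - y\<bar>")
        case True
        then have "circle_dist L x y = \<bar>x - y\<bar>"
          using dist by simp
        then show ?thesis
          using that[of 1 0] that[of "-1" 0] by (cases "x \<le> y") auto
      next
        case False
        then have "circle_dist L x y = L - \<bar>x - y\<bar>"
          using dist by simp
        then show ?thesis
          using that[of "-1" "-1"] that[of 1 1] by (cases "x \<le> y") auto
      qed
      define \<gamma> where "\<gamma> s = (x + c * s) rmod L" for s
      have "\<gamma> s \<in> circle L" for s
        using L by (simp add: \<gamma>_def circle_def rmod_less rmod_nonneg)
      moreover have "circle_dist L (\<gamma> s) (\<gamma> t) = \<bar>s - t\<bar>" if "s \<in> {0..L / 2}" "t \<in> {0..L / 2}" for s t
      proof -
        have "\<bar>(x + c * s) - (x + c * t)\<bar> = \<bar>s - t\<bar>" "\<bar>s - t\<bar> \<le> L / 2"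
          using c(1) that by (auto simp: abs_if)
        with circle_dist_shift[OF L, of "x + c * s" "x + c * t"] show ?thesis
          by (simp add: \<gamma>_def)
      qed
      moreover have "\<gamma> 0 = x"
        using xy(1) by (simp add: \<gamma>_def circle_def)
      moreover have "\<gamma> (circle_dist L x y) = y"
        unfolding \<gamma>_def c(2) using xy(2) L by (intro rmod_unique[of _ _ _ n]) (auto simp: circle_def)
      ultimately show ?thesis
        by blast
    qed
    fix z assume z: "z \<in> circle L"
    show "circle_dist L x y + circle_dist L y z + circle_dist L z x \<le> 2 * (L / 2)"
      unfolding circle_dist_representatives[OF xy] circle_dist_representatives[OF xy(2) z]
        circle_dist_representatives[OF z xy(1)]
      by (auto simp: min_def abs_if)
  next
    fix \<epsilon> :: real assume "\<epsilon> > 0"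
    define N where "N = nat \<lfloor>L / \<epsilon>\<rfloor>"
    define F where "F = (\<lambda>k. of_nat k * \<epsilon>) ` {..N} \<inter> circle L"
    have "\<exists>f\<in>F. circle_dist L x f < \<epsilon>" if x: "x \<in> circle L" for x
    proof -
      have x': "0 \<le> x" "x < L"
        using x by (auto simp: circle_def)
      define k where "k = nat \<lfloor>x / \<epsilon>\<rfloor>"
      have "x / \<epsilon> \<ge> 0"
        using x' \<open>\<epsilon> > 0\<close> by simp
      then have "of_nat k \<le> x / \<epsilon>" "x / \<epsilon> < of_nat k + 1"
        by (auto simp: k_def)
      then have k: "of_nat k * \<epsilon> \<le> x" "x < (of_nat k + 1) * \<epsilon>"
        using \<open>\<epsilon> > 0\<close> by (simp_all add: pos_le_divide_eq pos_divide_less_eq)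
      have "k \<le> N"
        unfolding k_def N_def using x' \<open>\<epsilon> > 0\<close> by (intro nat_mono floor_mono divide_right_mono) auto
      moreover have "0 \<le> of_nat k * \<epsilon>" "of_nat k * \<epsilon> < L"
        using k x' \<open>\<epsilon> > 0\<close> by auto
      then have mem: "of_nat k * \<epsilon> \<in> circle L"
        unfolding circle_def atLeastLessThan_iff by blast
      ultimately have "of_nat k * \<epsilon> \<in> F"
        by (auto simp: F_def)
      moreover have "\<bar>x - of_nat k * \<epsilon>\<bar> < \<epsilon>"
        using k by (simp add: algebra_simps)
      then have "circle_dist L x (of_nat k * \<epsilon>) < \<epsilon>"
        unfolding circle_dist_representatives[OF x mem] by linarith
      ultimately show ?thesis
        by blast
    qed
    then show "\<exists>F. finite F \<and> F \<subseteq> circle L \<and> (\<forall>x\<in>circle L. \<exists>f\<in>F. circle_dist L x f < \<epsilon>)"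
      by (intro exI[of _ F]) (auto simp: F_def)
  qed
qed

section \<open>Graphs on circles\<close>

lemma finite_circle_dist_eq:
  assumes "x \<in> circle L"
  shows "finite {y \<in> circle L. circle_dist L x y = c}"
proof (rule finite_subset)
  show "{y \<in> circle L. circle_dist L x y = c} \<subseteq> {x + c, x - c, x + (L - c), x - (L - c)}"
    using assms by (auto simp: circle_dist_representatives min_def abs_if split: if_splits)
qed simp

text \<open>An earlier vertex and an integer together exclude finitely many points, so at every
  stage only countably many points are forbidden.\<close>

theorem circle_gec_graph_exists:
  assumes L: "L > 0"
  shows "\<exists>S E. gec_graph (circle L) (circle_dist L) S E \<and> integer_distance_free L S \<and> S \<noteq> {}"
proof -
  interpret Metric_space "circle L" "circle_dist L"
    by (rule Metric_space_circle[OF L])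
  define P :: "(nat \<Rightarrow> real) \<Rightarrow> nat \<Rightarrow> real \<Rightarrow> bool"
    where "P f n v \<longleftrightarrow> v \<in> circle L \<and> (\<forall>i<n. \<forall>m::int. \<not> [circle_dist L (f i) v = of_int m] (rmod L))" for f n v
  have "\<exists>s E. gec_graph (circle L) (circle_dist L) (range s) E \<and> (\<forall>n. P s n (s n)) \<and> inj s"
  proof (rule gec_graph_exists)
    show "P f n v = P g n v" if "\<And>i. i < n \<Longrightarrow> f i = g i" for f g n v
      using that by (simp add: P_def)
    show "v \<noteq> f i" if "P f n v" "i < n" for f n v i
    proof
      assume "v = f i"
      with that have "circle_dist L (f i) v = of_int 0"
        by (simp add: P_def)
      moreover have "\<not> [circle_dist L (f i) v = of_int 0] (rmod L)"
        using that unfolding P_def by blast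
      ultimately show False
        by simp
    qed
    show "\<exists>v\<in>circle L. circle_dist L p v < \<epsilon> \<and> P f n v"
      if f: "\<And>i. i < n \<Longrightarrow> f i \<in> circle L \<and> P f i (f i)" and p: "p \<in> circle L" and "\<epsilon> > 0" for f n p \<epsilon>
    proof -
      define B where "B = (\<Union>i<n. \<Union>m::int. {v \<in> circle L. circle_dist L (f i) v = of_int m rmod L})"
      have "countable B"
        unfolding B_def using f by (intro countable_UN countableI_type countable_finite[OF finite_circle_dist_eq]) auto
      moreover have "uncountable {p<..<min L (p + \<epsilon>)}"
        using p \<open>\<epsilon> > 0\<close> by (simp add: uncountable_open_interval circle_def)
      ultimately have "uncountable ({p<..<min L (p + \<epsilon>)} - B)"
        by (intro uncountable_minus_countable)
      then have "{p<..<min L (p + \<epsilon>)} - B \<noteq> {}"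
        by (metis countable_empty)
      then obtain v where "v \<in> {p<..<min L (p + \<epsilon>)} - B"
        by blast
      then have v: "v \<notin> B" "p < v" "v < L" "v < p + \<epsilon>"
        by auto
      then have vL: "v \<in> circle L"
        using p by (simp add: circle_def)
      have "circle_dist L p v < \<epsilon>"
        using v by (simp add: circle_dist_representatives[OF p vL])
      moreover have "P f n v"
        unfolding P_def rcong_def
      proof (intro conjI allI impI notI vL)
        fix i and m :: int assume i: "i < n" and eq: "circle_dist L (f i) v rmod L = of_int m rmod L"
        have "\<bar>f i - v\<bar> < L"
          using f[OF i] vL by (auto simp: circle_def)
        then have "circle_dist L (f i) v \<in> {0..<\<bar>L\<bar>}"
          using f[OF i] vL L by (auto simp: circle_dist_representatives)
        then have "circle_dist L (f i) v = of_int m rmod L"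
          using eq by simp
        with v(1) vL i show False
          unfolding B_def by blast
      qed
      ultimately show ?thesis
        using vL by blast
    qed
  qed (use L circle_separable_perfect[OF L] in \<open>auto simp: circle_def\<close>)
  then obtain s E where sE: "gec_graph (circle L) (circle_dist L) (range s) E" "\<And>n. P s n (s n)"
    by blast
  have "integer_distance_free L (range s)"
    unfolding integer_distance_free_def
  proof
    assume "\<exists>u\<in>range s. \<exists>v\<in>range s. \<exists>n::int. u \<noteq> v \<and> [circle_dist L u v = of_int n] (rmod L)"
    then obtain i j and n :: int where ij: "s i \<noteq> s j" "[circle_dist L (s i) (s j) = of_int n] (rmod L)"
      by blast
    then consider "i < j" | "j < i"
      by (metis linorder_neqE_nat)
    then show False
      using sE(2)[of i] sE(2)[of j] ij(2) commute[of "s i" "s j"] by cases (auto simp: P_def)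
  qed
  with sE(1) show ?thesis
    by blast
qed

theorem circle_graph_theory_determines_length:
  assumes "L\<^sub>1 > 2" "L\<^sub>2 > 2" "circle_graph_theory L\<^sub>1 = circle_graph_theory L\<^sub>2"
  shows "L\<^sub>1 = L\<^sub>2"
proof -
  define C where "C L = (\<lambda>S E. gec_graph (circle L) (circle_dist L) S E \<and> integer_distance_free L S)" for L
  obtain S\<^sub>1 E\<^sub>1 where 1: "C L\<^sub>1 S\<^sub>1 E\<^sub>1" "S\<^sub>1 \<noteq> {}"
    using circle_gec_graph_exists[of L\<^sub>1] assms(1) by (auto simp: C_def)
  obtain S\<^sub>2 E\<^sub>2 where 2: "C L\<^sub>2 S\<^sub>2 E\<^sub>2" "S\<^sub>2 \<noteq> {}"
    using circle_gec_graph_exists[of L\<^sub>2] assms(2) by (auto simp: C_def)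
  have "L\<^sub>1 / 2 = L\<^sub>2 / 2"
  proof (rule round_spaces_same_diameter[of _ _ _ _ _ _ "C L\<^sub>1" "C L\<^sub>2", OF _ _ _ _ 1 2])
    show "common_graph_theory (C L\<^sub>1) = common_graph_theory (C L\<^sub>2)"
      using assms(3) by (simp add: C_def circle_graph_theory_def)
  qed (use assms in \<open>auto simp: C_def intro: round_space_circle\<close>)
  then show ?thesis
    by simp
qed

section \<open>Spheres\<close>

lemma geodesic_dist_sphere:
  assumes "x \<in> sphere 0 r" "y \<in> sphere 0 r"
  shows "geodesic_dist r x y = r * arccos (x \<bullet> y / r\<^sup>2)"
  using assms by (simp add: geodesic_dist_def power2_eq_square)

lemma inner_sphere_bounds:
  fixes x y :: "'a::real_inner"
  assumes "r > 0" "x \<in> sphere 0 r" "y \<in> sphere 0 r"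
  shows "- 1 \<le> x \<bullet> y / r\<^sup>2" "x \<bullet> y / r\<^sup>2 \<le> 1"
  using Cauchy_Schwarz_ineq2[of x y] assms by (auto simp: power2_eq_square divide_simps abs_le_iff)

lemma inner_geodesic_dist:
  assumes "r > 0" "x \<in> sphere 0 r" "y \<in> sphere 0 r"
  shows "x \<bullet> y = r\<^sup>2 * cos (geodesic_dist r x y / r)" "0 \<le> geodesic_dist r x y" "geodesic_dist r x y \<le> pi * r"
proof -
  note b = inner_sphere_bounds[OF assms]
  have e: "geodesic_dist r x y / r = arccos (x \<bullet> y / r\<^sup>2)"
    using assms by (simp add: geodesic_dist_sphere)
  show "x \<bullet> y = r\<^sup>2 * cos (geodesic_dist r x y / r)"
    unfolding e using b assms by (simp add: cos_arccos)
  have "0 \<le> geodesic_dist r x y / r" "geodesic_dist r x y / r \<le> pi"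
    unfolding e using b by (auto intro: arccos_lbound arccos_ubound)
  then show "0 \<le> geodesic_dist r x y" "geodesic_dist r x y \<le> pi * r"
    using assms(1) by (auto simp: field_simps)
qed

lemma geodesic_dist_eqI:
  assumes "r > 0" "x \<in> sphere 0 r" "y \<in> sphere 0 r" "x \<bullet> y = r\<^sup>2 * cos \<theta>" "0 \<le> \<theta>" "\<theta> \<le> pi"
  shows "geodesic_dist r x y = r * \<theta>"
  using assms by (simp add: geodesic_dist_sphere arccos_cos)

text \<open>The chord is \<open>2 * r * sin (\<theta> / 2)\<close>. Points close in the geodesic
  metric are thus close in space, where continuity of terms is available.\<close>

lemma chord_le_geodesic_dist:
  assumes "r > 0" "x \<in> sphere 0 r" "y \<in> sphere 0 r"
  shows "dist x y \<le> geodesic_dist r x y"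
proof (rule power2_le_imp_le)
  define \<theta> where "\<theta> = geodesic_dist r x y / r"
  have xx: "x \<bullet> x = r\<^sup>2" "y \<bullet> y = r\<^sup>2"
    using assms by (simp_all add: dot_square_norm)
  have "(dist x y)\<^sup>2 = (x - y) \<bullet> (x - y)"
    by (simp add: dist_norm power2_norm_eq_inner)
  also have "\<dots> = 2 * r\<^sup>2 * (1 - cos \<theta>)"
    using inner_geodesic_dist(1)[OF assms] xx
    by (simp add: \<theta>_def inner_diff_left inner_diff_right inner_commute algebra_simps)
  also have "1 - cos \<theta> = 2 * (sin (\<theta> / 2))\<^sup>2"
    using cos_double_sin[of "\<theta> / 2"] by simp
  also have "2 * r\<^sup>2 * (2 * (sin (\<theta> / 2))\<^sup>2) \<le> 2 * r\<^sup>2 * (2 * (\<theta> / 2)\<^sup>2)"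
    using abs_sin_x_le_abs_x[of "\<theta> / 2"]
    by (intro mult_left_mono) (simp_all only: abs_le_square_iff, simp_all)
  also have "\<dots> = (r * \<theta>)\<^sup>2"
    by (simp add: power2_eq_square)
  also have "r * \<theta> = geodesic_dist r x y"
    using assms(1) by (simp add: \<theta>_def)
  finally show "(dist x y)\<^sup>2 \<le> (geodesic_dist r x y)\<^sup>2" .
qed (use inner_geodesic_dist(2)[OF assms] in simp)

lemma continuous_geodesic_dist:
  assumes "r > 0" "x \<in> sphere 0 r"
  shows "continuous_on (sphere 0 r) (geodesic_dist r x)"
proof -
  have "continuous_on (sphere 0 r) (\<lambda>y. r * arccos (x \<bullet> y / r\<^sup>2))"
    using inner_sphere_bounds[OF assms] assms(1) by (intro continuous_intros ballI conjI) auto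
  then show ?thesis
    by (rule continuous_on_eq) (use assms(2) in \<open>simp add: geodesic_dist_sphere\<close>)
qed

text \<open>Polar coordinates about \<open>x\<close>: \<open>w\<close> is the direction of the part
  of \<open>y\<close> orthogonal to \<open>x\<close>, and any orthogonal direction if
  \<open>y\<close> is \<open>x\<close> or \<open>- x\<close>.\<close>

lemma sphere_polar:
  fixes x y :: "real ^ 3"
  assumes r: "r > 0" and x: "x \<in> sphere 0 r" and y: "y \<in> sphere 0 r"
  obtains w \<theta> where "w \<in> sphere 0 r" "x \<bullet> w = 0" "0 \<le> \<theta>" "\<theta> \<le> pi" "r * \<theta> = geodesic_dist r x y"
    "y = cos \<theta> *\<^sub>R x + sin \<theta> *\<^sub>R w"
proof -
  define \<theta> where "\<theta> = geodesic_dist r x y / r"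
  have \<theta>: "0 \<le> \<theta>" "\<theta> \<le> pi" "r * \<theta> = geodesic_dist r x y" "x \<bullet> y = r\<^sup>2 * cos \<theta>"
    using inner_geodesic_dist[OF assms] r by (auto simp: \<theta>_def field_simps)
  have xx: "x \<bullet> x = r\<^sup>2" "y \<bullet> y = r\<^sup>2"
    using x y by (simp_all add: dot_square_norm)
  define u where "u = y - cos \<theta> *\<^sub>R x"
  have xu: "x \<bullet> u = 0"
    by (simp add: u_def inner_diff_right \<theta>(4) xx)
  have "u \<bullet> u = r\<^sup>2 - (cos \<theta>)\<^sup>2 * r\<^sup>2"
    using xx \<theta>(4) by (simp add: u_def inner_diff_left inner_diff_right inner_commute[of y x] power2_eq_square)
  also have "\<dots> = r\<^sup>2 * (1 - (cos \<theta>)\<^sup>2)"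
    by (simp add: right_diff_distrib)
  also have "\<dots> = (r * sin \<theta>)\<^sup>2"
    by (simp add: sin_squared_eq power_mult_distrib)
  finally have uu: "u \<bullet> u = (r * sin \<theta>)\<^sup>2" .
  have "sin \<theta> \<ge> 0"
    using \<theta> by (simp add: sin_ge_zero)
  then have nu: "norm u = r * sin \<theta>"
    using uu r by (simp add: norm_eq_sqrt_inner)
  show thesis
  proof (cases "sin \<theta> = 0")
    case False
    define w where "w = u /\<^sub>R sin \<theta>"
    have "norm w = r"
      using nu False \<open>sin \<theta> \<ge> 0\<close> by (simp add: w_def)
    then have "w \<in> sphere 0 r"
      by simp
    moreover have "x \<bullet> w = 0"
      using xu by (simp add: w_def)
    moreover have "y = cos \<theta> *\<^sub>R x + sin \<theta> *\<^sub>R w"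
      using False by (simp add: w_def u_def)
    ultimately show thesis
      using that \<theta>(1-3) by blast
  next
    case True
    then have "u = 0"
      using nu by simp
    obtain z :: "real ^ 3" where z: "z \<noteq> 0" "orthogonal x z"
      using orthogonal_to_vector_exists[of x] by auto
    define w where "w = (r / norm z) *\<^sub>R z"
    have "w \<in> sphere 0 r" "x \<bullet> w = 0"
      using z r by (auto simp: w_def orthogonal_def)
    moreover have "y = cos \<theta> *\<^sub>R x + sin \<theta> *\<^sub>R w"
      using \<open>u = 0\<close> True by (simp add: u_def)
    ultimately show thesis
      using that \<theta>(1-3) by blast
  qed
qed

lemma great_circle_inner:
  fixes x w :: "'a::real_inner"
  assumes "x \<bullet> x = r\<^sup>2" "w \<bullet> w = r\<^sup>2" "x \<bullet> w = 0"
  shows "(cos a *\<^sub>R x + sin a *\<^sub>R w) \<bullet> (cos b *\<^sub>R x + sin b *\<^sub>R w) = r\<^sup>2 * cos (a - b)"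
  using assms by (simp add: inner_add_left inner_add_right inner_commute cos_diff algebra_simps)

lemma round_space_sphere:
  assumes "r > 1 / pi"
  shows "round_space (sphere 0 r) (geodesic_dist r) (pi * r)"
proof -
  have r: "r > 0"
    using assms by (meson divide_pos_pos less_trans pi_gt_zero zero_less_one)
  interpret Metric_space "sphere 0 r" "geodesic_dist r"
    by (rule Metric_space_sphere[OF r])
  show ?thesis
  proof
    show "pi * r > 1"
      using assms by (simp add: field_simps)
    show "sphere (0 :: real ^ 3) r \<noteq> {}"
      using r by simp
    fix x y :: "real ^ 3" assume xy: "x \<in> sphere 0 r" "y \<in> sphere 0 r"
    show "\<exists>\<gamma>. (\<forall>s\<in>{0..pi * r}. \<gamma> s \<in> sphere 0 r) \<and>
      (\<forall>s\<in>{0..pi * r}. \<forall>t\<in>{0..pi * r}. geodesic_dist r (\<gamma> s) (\<gamma> t) = \<bar>s - t\<bar>) \<and>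
      \<gamma> 0 = x \<and> \<gamma> (geodesic_dist r x y) = y"
    proof -
      obtain w \<theta> where w: "w \<in> sphere 0 r" "x \<bullet> w = 0" "r * \<theta> = geodesic_dist r x y"
        "y = cos \<theta> *\<^sub>R x + sin \<theta> *\<^sub>R w"
        using sphere_polar[OF r xy] by metis
      define \<gamma> where "\<gamma> s = cos (s / r) *\<^sub>R x + sin (s / r) *\<^sub>R w" for s
      have inner: "\<gamma> s \<bullet> \<gamma> t = r\<^sup>2 * cos (s / r - t / r)" for s t
        unfolding \<gamma>_def using xy(1) w(1,2) by (intro great_circle_inner) (auto simp: dot_square_norm)
      have mem: "\<gamma> s \<in> sphere 0 r" for s
        using inner[of s s] r by (simp add: norm_eq_sqrt_inner)
      have "geodesic_dist r (\<gamma> s) (\<gamma> t) = \<bar>s - t\<bar>" if "s \<in> {0..pi * r}" "t \<in> {0..pi * r}" for s t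
      proof -
        have "\<bar>s - t\<bar> \<le> pi * r"
          using that by (auto simp: abs_if)
        moreover have "cos (s / r - t / r) = cos (\<bar>s - t\<bar> / r)"
          by (simp add: abs_if diff_divide_distrib[symmetric] cos_minus minus_diff_eq[symmetric, of t s] del: minus_diff_eq)
        ultimately have "geodesic_dist r (\<gamma> s) (\<gamma> t) = r * (\<bar>s - t\<bar> / r)"
          using r by (intro geodesic_dist_eqI mem) (auto simp: inner field_simps)
        then show ?thesis
          using r by simp
      qed
      moreover have "\<gamma> (geodesic_dist r x y) = y"
        unfolding w(3)[symmetric] \<gamma>_def using r w(4) by simp
      ultimately show ?thesis
        using mem by (intro exI[of _ \<gamma>]) (auto simp: \<gamma>_def)
    qed
    fix z :: "real ^ 3" assume z: "z \<in> sphere 0 r"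
    \<comment> \<open>Replacing \<open>z\<close> by its antipode turns the triangle inequality into
      the perimeter bound.\<close>
    have anti: "geodesic_dist r a (- z) = pi * r - geodesic_dist r a z" if "a \<in> sphere 0 r" for a
      using that z inner_sphere_bounds[OF r that z] geodesic_dist_sphere[OF that z] geodesic_dist_sphere[OF that, of "- z"]
      by (simp add: arccos_minus algebra_simps)
    have "geodesic_dist r x y \<le> geodesic_dist r x (- z) + geodesic_dist r (- z) y"
      using xy z by (intro triangle) auto
    then show "geodesic_dist r x y + geodesic_dist r y z + geodesic_dist r z x \<le> 2 * (pi * r)"
      using anti[OF xy(1)] anti[OF xy(2)] commute[of "- z" y] commute[of z x] by simp
  next
    fix \<epsilon> :: real assume "\<epsilon> > 0"
    have "\<exists>U. open U \<and> U \<inter> sphere 0 r = {y \<in> sphere 0 r. geodesic_dist r x y < \<epsilon>}" if "x \<in> sphere 0 r" for x :: "real ^ 3"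
    proof -
      have "openin (top_of_set (sphere 0 r)) (sphere 0 r \<inter> geodesic_dist r x -` {..<\<epsilon>})"
        by (intro continuous_openin_preimage_gen continuous_geodesic_dist r that) auto
      then obtain U where U: "open U" "sphere 0 r \<inter> geodesic_dist r x -` {..<\<epsilon>} = sphere 0 r \<inter> U"
        unfolding openin_open by blast
      have "U \<inter> sphere 0 r = {y \<in> sphere 0 r. geodesic_dist r x y < \<epsilon>}"
        using U(2) by blast
      with U(1) show ?thesis
        by blast
    qed
    then have "\<exists>U. \<forall>x\<in>sphere (0 :: real ^ 3) r. open (U x) \<and> U x \<inter> sphere 0 r = {y \<in> sphere 0 r. geodesic_dist r x y < \<epsilon>}"
      by (intro bchoice ballI)
    then obtain U where U: "\<And>x :: real ^ 3. x \<in> sphere 0 r \<Longrightarrow> open (U x)"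
      "\<And>x :: real ^ 3. x \<in> sphere 0 r \<Longrightarrow> U x \<inter> sphere 0 r = {y \<in> sphere 0 r. geodesic_dist r x y < \<epsilon>}"
      by blast
    have "x \<in> U x" if "x \<in> sphere 0 r" for x :: "real ^ 3"
    proof -
      have "geodesic_dist r x x < \<epsilon>"
        using zero[OF that that] \<open>\<epsilon> > 0\<close> by simp
      then show ?thesis
        using U(2)[OF that] that by blast
    qed
    then have cover: "sphere 0 r \<subseteq> \<Union> (U ` sphere 0 r)"
      by blast
    obtain F :: "(real ^ 3) set" where F: "F \<subseteq> sphere 0 r" "finite F" "sphere 0 r \<subseteq> \<Union> (U ` F)"
      by (rule compactE_image[OF compact_sphere U(1) cover])
    have "\<exists>f\<in>F. geodesic_dist r x f < \<epsilon>" if x: "x \<in> sphere 0 r" for x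
    proof -
      obtain f where f: "f \<in> F" "x \<in> U f"
        using F(3) x by blast
      then have "x \<in> U f \<inter> sphere 0 r" "f \<in> sphere 0 r"
        using x F(1) by auto
      then have "geodesic_dist r f x < \<epsilon>"
        using U(2)[of f] by blast
      with f(1) show ?thesis
        unfolding commute[of f x] by blast
    qed
    with F(1,2) show "\<exists>F. finite F \<and> F \<subseteq> sphere 0 r \<and> (\<forall>x\<in>sphere 0 r. \<exists>f\<in>F. geodesic_dist r x f < \<epsilon>)"
      by blast
  qed
qed

section \<open>Zeros of polynomial terms on the sphere\<close>

lemma coords_combination:
  assumes "k < 3"
  shows "coords (a *\<^sub>R x + b *\<^sub>R y) ! k = a * coords x ! k + b * coords y ! k"
proof -
  have "k = 0 \<or> k = 1 \<or> k = 2"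
    using assms by linarith
  then show ?thesis
    by (elim disjE) (simp_all add: coords_def)
qed

lemma continuous_coords:
  assumes "k < 3"
  shows "continuous_on A (\<lambda>x. coords x ! k)"
proof -
  have "k = 0 \<or> k = 1 \<or> k = 2"
    using assms by linarith
  then show ?thesis
    by (elim disjE) (auto simp: coords_def intro!: continuous_intros)
qed

text \<open>The variables \<open>3 * k\<close>, \<open>3 * k + 1\<close>, \<open>3 * k + 2\<close> of a term stand for the point \<open>a k\<close>.\<close>

definition flat :: "(nat \<Rightarrow> real ^ 3) \<Rightarrow> nat \<Rightarrow> real" where
  "flat a i = coords (a (i div 3)) ! (i mod 3)"

lemma continuous_peval_flat: "continuous_on A (\<lambda>w. peval \<kappa> (flat (a(n := w))) t)"
proof (induction t)
  case (PVar i)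
  show ?case
    by (cases "i div 3 = n") (auto simp: flat_def intro!: continuous_coords)
qed (auto intro!: continuous_intros)

text \<open>
  The rational parametrisation of the great circle through \<open>p\<close> and \<open>w\<close> by \<open>t = tan (\<theta> / 2)\<close>, so that
  terms become rational functions of \<open>t\<close>.
\<close>

definition circle_point :: "real ^ 3 \<Rightarrow> real ^ 3 \<Rightarrow> real \<Rightarrow> real ^ 3" where
  "circle_point p w t = ((1 - t\<^sup>2) / (1 + t\<^sup>2)) *\<^sub>R p + (2 * t / (1 + t\<^sup>2)) *\<^sub>R w"

lemma one_plus_square_pos: "1 + (t::real)\<^sup>2 > 0"
  by (simp add: add_pos_nonneg)

lemma peval_circle_point:
  "\<exists>P m. \<forall>x. (1 + x\<^sup>2) ^ m * peval \<kappa> (flat (a(n := circle_point p w x))) t = poly P x"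
proof (induction t)
  case (PVar i)
  show ?case
  proof (cases "i div 3 = n")
    case True
    let ?p = "coords p ! (i mod 3)" and ?w = "coords w ! (i mod 3)"
    have "(1 + x\<^sup>2) * flat (a(n := circle_point p w x)) i = poly [:?p, 2 * ?w, - ?p:] x" for x
    proof -
      have "(1 + x\<^sup>2) * flat (a(n := circle_point p w x)) i
          = (1 + x\<^sup>2) * ((1 - x\<^sup>2) / (1 + x\<^sup>2) * ?p + 2 * x / (1 + x\<^sup>2) * ?w)"
        using True by (simp add: flat_def circle_point_def coords_combination)
      also have "\<dots> = (1 - x\<^sup>2) * ?p + 2 * x * ?w"
        using one_plus_square_pos[of x] by (simp add: distrib_left)
      also have "\<dots> = poly [:?p, 2 * ?w, - ?p:] x"
        by (simp add: power2_eq_square algebra_simps)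
      finally show ?thesis .
    qed
    then have "\<forall>x. (1 + x\<^sup>2) ^ 1 * peval \<kappa> (flat (a(n := circle_point p w x))) (PVar i) = poly [:?p, 2 * ?w, - ?p:] x"
      by (simp only: peval.simps power_one_right simp_thms)
    then show ?thesis
      by blast
  next
    case False
    then show ?thesis
      by (intro exI[of _ "[:flat a i:]"] exI[of _ 0]) (simp add: flat_def)
  qed
next
  case (PConst k)
  show ?case
    by (intro exI[of _ "[:\<kappa> k:]"] exI[of _ 0]) simp
next
  case (PAdd s t)
  then obtain P m Q l where "\<forall>x. (1 + x\<^sup>2) ^ m * peval \<kappa> (flat (a(n := circle_point p w x))) s = poly P x"
    "\<forall>x. (1 + x\<^sup>2) ^ l * peval \<kappa> (flat (a(n := circle_point p w x))) t = poly Q x"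
    by blast
  then have "\<forall>x. (1 + x\<^sup>2) ^ (m + l) * peval \<kappa> (flat (a(n := circle_point p w x))) (PAdd s t)
      = poly (P * [:1, 0, 1:] ^ l + Q * [:1, 0, 1:] ^ m) x"
    by (auto simp: power_add distrib_left poly_power power2_eq_square mult_ac)
  then show ?case
    by blast
next
  case (PMul s t)
  then obtain P m Q l where PQ: "\<And>x. (1 + x\<^sup>2) ^ m * peval \<kappa> (flat (a(n := circle_point p w x))) s = poly P x"
    "\<And>x. (1 + x\<^sup>2) ^ l * peval \<kappa> (flat (a(n := circle_point p w x))) t = poly Q x"
    by blast
  have "(1 + x\<^sup>2) ^ (m + l) * peval \<kappa> (flat (a(n := circle_point p w x))) (PMul s t) = poly (P * Q) x" for x
    unfolding poly_mult PQ[symmetric] by (simp add: power_add mult_ac)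
  then show ?case
    by blast
next
  case (PNeg t)
  then obtain P m where "\<forall>x. (1 + x\<^sup>2) ^ m * peval \<kappa> (flat (a(n := circle_point p w x))) t = poly P x"
    by blast
  then have "\<forall>x. (1 + x\<^sup>2) ^ m * peval \<kappa> (flat (a(n := circle_point p w x))) (PNeg t) = poly (- P) x"
    by simp
  then show ?case
    by blast
qed

text \<open>Clearing the positive denominator leaves a polynomial with infinitely many
  roots.\<close>

lemma peval_circle_point_zero:
  assumes "infinite X" "\<And>x. x \<in> X \<Longrightarrow> peval \<kappa> (flat (a(n := circle_point p w x))) t = 0"
  shows "peval \<kappa> (flat (a(n := circle_point p w y))) t = 0"
proof -
  obtain P m where P: "\<And>x. (1 + x\<^sup>2) ^ m * peval \<kappa> (flat (a(n := circle_point p w x))) t = poly P x"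
    using peval_circle_point by metis
  have "X \<subseteq> {x. poly P x = 0}"
    using P assms(2) by (metis (mono_tags, lifting) mem_Collect_eq mult_zero_right subsetI)
  then have "P = 0"
    using assms(1) poly_roots_finite finite_subset by blast
  then have "(1 + y\<^sup>2) ^ m * peval \<kappa> (flat (a(n := circle_point p w y))) t = 0"
    using P by simp
  then show ?thesis
    using one_plus_square_pos[of y] by auto
qed

lemma circle_point_in_sphere:
  assumes "r > 0" "p \<in> sphere 0 r" "w \<in> sphere 0 r" "p \<bullet> w = 0"
  shows "circle_point p w t \<in> sphere 0 r"
proof -
  let ?u = "1 + t\<^sup>2"
  have pp: "p \<bullet> p = r\<^sup>2" "w \<bullet> w = r\<^sup>2"
    using assms by (simp_all add: dot_square_norm)
  have "circle_point p w t \<bullet> circle_point p w t = (((1 - t\<^sup>2) / ?u)\<^sup>2 + (2 * t / ?u)\<^sup>2) * r\<^sup>2"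
    using pp assms(4)
    by (simp add: circle_point_def inner_add_left inner_add_right inner_commute[of w p] power2_eq_square distrib_right)
  also have "((1 - t\<^sup>2) / ?u)\<^sup>2 + (2 * t / ?u)\<^sup>2 = ((1 - t\<^sup>2)\<^sup>2 + (2 * t)\<^sup>2) / ?u\<^sup>2"
    by (simp add: power_divide add_divide_distrib)
  also have "(1 - t\<^sup>2)\<^sup>2 + (2 * t)\<^sup>2 = ?u\<^sup>2"
    by (simp add: power2_eq_square algebra_simps)
  finally show ?thesis
    using assms(1) one_plus_square_pos[of t] by (simp add: norm_eq_sqrt_inner)
qed

lemma circle_point_neq:
  assumes "r > 0" "w \<in> sphere 0 r" "p \<bullet> w = 0" "t \<noteq> 0"
  shows "circle_point p w t \<noteq> p"
proof
  assume "circle_point p w t = p"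
  then have "w \<bullet> circle_point p w t = 0"
    using assms(3) by (simp add: inner_commute)
  then have "2 * t / (1 + t\<^sup>2) * (w \<bullet> w) = 0"
    using assms(3) by (simp add: circle_point_def inner_add_right inner_commute)
  moreover have "w \<noteq> 0"
    using assms(1,2) by auto
  ultimately show False
    using assms(4) one_plus_square_pos[of t] by auto
qed

text \<open>\<open>sin \<theta> / (1 + cos \<theta>)\<close> is \<open>tan (\<theta> / 2)\<close>;
  the excluded angle belongs to \<open>- p\<close>, which the parametrisation does not
  reach.\<close>

lemma circle_point_half_angle:
  assumes "cos \<theta> \<noteq> - 1"
  shows "circle_point p w (sin \<theta> / (1 + cos \<theta>)) = cos \<theta> *\<^sub>R p + sin \<theta> *\<^sub>R w"
proof -
  define c s where "c = cos \<theta>" and "s = sin \<theta>"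
  have cs: "s\<^sup>2 = (1 - c) * (1 + c)" "1 + c \<noteq> 0"
    using assms by (auto simp: c_def s_def sin_squared_eq power2_eq_square algebra_simps add_eq_0_iff)
  have sq: "(s / (1 + c))\<^sup>2 = (1 - c) / (1 + c)"
    using cs by (simp add: power_divide power2_eq_square)
  have u: "1 + (s / (1 + c))\<^sup>2 = 2 / (1 + c)"
    unfolding sq using cs(2) by (simp add: divide_simps)
  have v: "1 - (s / (1 + c))\<^sup>2 = 2 * c / (1 + c)"
    unfolding sq using cs(2) by (simp add: divide_simps)
  have "(2 * c / (1 + c)) / (2 / (1 + c)) = c" "2 * (s / (1 + c)) / (2 / (1 + c)) = s"
    using cs(2) by simp_all
  then show ?thesis
    unfolding circle_point_def c_def[symmetric] s_def[symmetric] u v by simp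
qed

text \<open>An identity theorem along great circles: every point except \<open>- p\<close> is
  reached from \<open>p\<close> on a parametrised circle, on which the term vanishes near
  \<open>p\<close>. The antipode is then reached on a circle through it, on which other points are
  already settled.\<close>

lemma peval_zero_on_sphere:
  assumes r: "r > 0" and p: "p \<in> sphere 0 r" and "\<epsilon> > 0"
    and zero: "\<And>w. w \<in> sphere 0 r \<Longrightarrow> dist w p < \<epsilon> \<Longrightarrow> peval \<kappa> (flat (a(n := w))) t = 0"
    and q: "q \<in> sphere 0 r"
  shows "peval \<kappa> (flat (a(n := q))) t = 0"
proof -
  have main: "peval \<kappa> (flat (a(n := q))) t = 0" if q: "q \<in> sphere 0 r" "q \<noteq> - p" for q
  proof -
    obtain w \<theta> where w: "w \<in> sphere 0 r" "p \<bullet> w = 0" "q = cos \<theta> *\<^sub>R p + sin \<theta> *\<^sub>R w"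
      using sphere_polar[OF r p q(1)] by metis
    have "cos \<theta> \<noteq> -1"
    proof
      assume "cos \<theta> = -1"
      moreover from this have "sin \<theta> = 0"
        using sin_cos_squared_add[of \<theta>] by simp
      ultimately show False
        using w(3) q(2) by simp
    qed
    have "isCont (circle_point p w) 0"
      unfolding circle_point_def using one_plus_square_pos by (intro continuous_intros) (simp_all add: less_imp_neq[symmetric])
    moreover have "circle_point p w 0 = p"
      by (simp add: circle_point_def)
    ultimately obtain \<delta> where \<delta>: "\<delta> > 0" "\<And>x. dist x 0 < \<delta> \<Longrightarrow> dist (circle_point p w x) p < \<epsilon>"
      using \<open>\<epsilon> > 0\<close> unfolding continuous_at_eps_delta by metis
    have "infinite {0<..<\<delta>}"
      using \<delta>(1) by (simp add: infinite_Ioo)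
    moreover have "peval \<kappa> (flat (a(n := circle_point p w x))) t = 0" if "x \<in> {0<..<\<delta>}" for x
      using that by (intro zero circle_point_in_sphere[OF r p w(1,2)] \<delta>(2)) auto
    ultimately have "peval \<kappa> (flat (a(n := circle_point p w (sin \<theta> / (1 + cos \<theta>))))) t = 0"
      by (rule peval_circle_point_zero)
    then show ?thesis
      using circle_point_half_angle[OF \<open>cos \<theta> \<noteq> -1\<close>] w(3) by simp
  qed
  show ?thesis
  proof (cases "q = - p")
    case True
    obtain w \<theta> where w: "w \<in> sphere 0 r" "- p \<bullet> w = 0"
      using sphere_polar[OF r _ p, of "- p"] p by (metis dist_0_norm mem_sphere norm_minus_cancel)
    have "- p \<in> sphere 0 r"
      using p by simp
    have *: "peval \<kappa> (flat (a(n := circle_point (- p) w x))) t = 0" if "x \<in> {0<..<1}" for x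
    proof (rule main)
      show "circle_point (- p) w x \<in> sphere 0 r"
        by (rule circle_point_in_sphere[OF r \<open>- p \<in> sphere 0 r\<close> w])
      show "circle_point (- p) w x \<noteq> - p"
        using that by (intro circle_point_neq[OF r w]) simp
    qed
    have "infinite {0<..<1::real}"
      by (simp add: infinite_Ioo)
    then have "peval \<kappa> (flat (a(n := circle_point (- p) w 0))) t = 0"
      using * by (rule peval_circle_point_zero)
    then show ?thesis
      using True by (simp add: circle_point_def)
  qed (use main q in blast)
qed

text \<open>Baire category: there are countably many terms, and the nonzeros of each one that is not
  identically 0 are open and dense in the sphere.\<close>

lemma sphere_avoid_zeros:
  fixes \<kappa> :: "nat \<Rightarrow> real" and n :: nat
  assumes r: "r > 0" and p: "p \<in> sphere 0 r" and "\<epsilon> > 0"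
  shows "\<exists>v\<in>sphere 0 r. geodesic_dist r p v < \<epsilon> \<and>
    (\<forall>t. peval \<kappa> (flat (a(n := v))) t = 0 \<longrightarrow> (\<forall>q\<in>sphere 0 r. peval \<kappa> (flat (a(n := q))) t = 0))"
proof -
  define g where "g t w = peval \<kappa> (flat (a(n := w))) t" for t w
  define T where "T = {t. \<exists>q\<in>sphere 0 r. g t q \<noteq> 0}"
  \<comment> \<open>The sphere itself is included so that the intersection stays inside it.\<close>
  define G where "G = insert (sphere 0 r) ((\<lambda>t. {w \<in> sphere 0 r. g t w \<noteq> 0}) ` T)"
  have "countable G"
    unfolding G_def by (intro countable_insert countable_image countableI_type)
  moreover have "openin (top_of_set (sphere 0 r)) A \<and> sphere 0 r \<subseteq> closure A" if "A \<in> G" for A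
  proof (cases "A = sphere 0 r")
    case True
    then show ?thesis
      using closure_subset by auto
  next
    case False
    then obtain t where t: "t \<in> T" "A = {w \<in> sphere 0 r. g t w \<noteq> 0}"
      using \<open>A \<in> G\<close> by (auto simp: G_def)
    have "openin (top_of_set (sphere 0 r)) (sphere 0 r \<inter> g t -` (- {0}))"
      unfolding g_def by (intro continuous_openin_preimage_gen continuous_peval_flat) auto
    moreover have "sphere 0 r \<inter> g t -` (- {0}) = A"
      using t(2) by auto
    moreover have "x \<in> closure A" if x: "x \<in> sphere 0 r" for x
      unfolding closure_approachable
    proof (intro allI impI, rule ccontr)
      fix e :: real assume "e > 0" and "\<not> (\<exists>y\<in>A. dist y x < e)"
      then have "g t w = 0" if "w \<in> sphere 0 r" "dist w x < e" for w
        using t(2) that by blast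
      then have "g t q = 0" if "q \<in> sphere 0 r" for q
        unfolding g_def using peval_zero_on_sphere[OF r x \<open>e > 0\<close> _ that] by blast
      with t(1) show False
        by (auto simp: T_def)
    qed
    ultimately show ?thesis
      by auto
  qed
  ultimately have "sphere 0 r \<subseteq> closure (\<Inter>G)"
    by (rule Baire[OF closed_sphere])
  then have "p \<in> closure (\<Inter>G)"
    using p by blast
  obtain \<delta> where \<delta>: "\<delta> > 0" "\<And>y. y \<in> sphere 0 r \<Longrightarrow> dist y p < \<delta> \<Longrightarrow>
      dist (geodesic_dist r p y) (geodesic_dist r p p) < \<epsilon>"
    using continuous_geodesic_dist[OF r p] p \<open>\<epsilon> > 0\<close> unfolding continuous_on_iff by blast
  obtain v where v: "v \<in> \<Inter>G" "dist v p < \<delta>"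
    using \<open>p \<in> closure (\<Inter>G)\<close> \<delta>(1) unfolding closure_approachable by blast
  then have "v \<in> sphere 0 r"
    by (auto simp: G_def)
  moreover have "geodesic_dist r p p = 0"
    using Metric_space.zero[OF Metric_space_sphere[OF r] p p] by simp
  then have "geodesic_dist r p v < \<epsilon>"
    using \<delta>(2)[OF \<open>v \<in> sphere 0 r\<close> v(2)] by (simp add: dist_real_def)
  moreover have "\<forall>q\<in>sphere 0 r. g t q = 0" if "g t v = 0" for t
    using v(1) that by (auto simp: G_def T_def)
  ultimately show ?thesis
    unfolding g_def by blast
qed

section \<open>Generic sequences and independent sets\<close>

lemma concat_coords_nth:
  assumes "i < 3 * length xs"
  shows "concat (map coords xs) ! i = coords (xs ! (i div 3)) ! (i mod 3)"
  using assms
proof (induction xs arbitrary: i)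
  case (Cons x xs)
  have len: "length (coords x) = 3"
    by (simp add: coords_def)
  show ?case
  proof (cases "i < 3")
    case True
    then show ?thesis
      using len by (simp add: nth_append)
  next
    case False
    then obtain j where j: "i = j + 3"
      by (metis le_add_diff_inverse2 not_less)
    then have "concat (map coords xs) ! j = coords (xs ! (j div 3)) ! (j mod 3)"
      using Cons by simp
    then show ?thesis
      using len j by (simp add: nth_append)
  qed
qed simp

text \<open>
  Generic sequences are built point by point, avoiding the zero sets of countably many terms. Terms
  may use the coordinates of a countable dense set as constants; hence a term that vanishes
  identically in the last point gives, by specialisation of that point, vanishing terms in fewer
  variables.
\<close>

definition generic_seq :: "(nat \<Rightarrow> real) \<Rightarrow> real \<Rightarrow> (nat \<Rightarrow> real ^ 3) \<Rightarrow> bool" where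
  "generic_seq \<kappa> r s \<longleftrightarrow> range s \<subseteq> sphere 0 r \<and>
     (\<forall>t. peval \<kappa> (flat s) t = 0 \<longrightarrow> (\<forall>a. range a \<subseteq> sphere 0 r \<longrightarrow> peval \<kappa> (flat a) t = 0))"

lemma peval_flat_cong:
  assumes "pvars t \<subseteq> {..<3 * n}" "\<And>i. i < n \<Longrightarrow> f i = g i"
  shows "peval \<kappa> (flat f) t = peval \<kappa> (flat g) t"
proof (rule peval_cong)
  fix i assume "i \<in> pvars t"
  then have "i div 3 < n"
    using assms(1) by (auto simp: less_mult_imp_div_less mult.commute)
  with assms(2) show "flat f i = flat g i"
    by (simp add: flat_def)
qed

theorem sphere_generic_gec_graph_exists:
  assumes r: "r > 0" and C: "C \<subseteq> sphere 0 r" "sphere 0 r \<subseteq> closure C"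
    and \<kappa>: "\<And>w. w \<in> C \<Longrightarrow> set (coords w) \<subseteq> range \<kappa>"
  shows "\<exists>s E. gec_graph (sphere 0 r) (geodesic_dist r) (range s) E \<and> generic_seq \<kappa> r s \<and> inj s"
proof -
  interpret Metric_space "sphere 0 r" "geodesic_dist r"
    by (rule Metric_space_sphere[OF r])
  define P where "P f n v \<longleftrightarrow> v \<in> sphere 0 r \<and> (\<forall>t. pvars t \<subseteq> {..<3 * Suc n} \<longrightarrow>
    peval \<kappa> (flat (f(n := v))) t = 0 \<longrightarrow> (\<forall>a. range a \<subseteq> sphere 0 r \<longrightarrow> peval \<kappa> (flat a) t = 0))"
    for f :: "nat \<Rightarrow> real ^ 3" and n v
  \<comment> \<open>The condition at the last point already covers all terms in the first
    \<open>n\<close> points; for \<open>n = 0\<close> the term is constant.\<close>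
  have gen: "peval \<kappa> (flat a) t = 0"
    if f: "\<And>i. i < n \<Longrightarrow> P f i (f i)" and t: "pvars t \<subseteq> {..<3 * n}" "peval \<kappa> (flat f) t = 0"
      and a: "range a \<subseteq> sphere 0 r" for f n t a
  proof (cases n)
    case 0
    then show ?thesis
      using t peval_flat_cong[of t 0 f a] by simp
  next
    case (Suc m)
    have "f(m := f m) = f"
      by simp
    then show ?thesis
      using f[of m] t a Suc unfolding P_def by (metis lessI)
  qed
  have "\<exists>s E. gec_graph (sphere 0 r) (geodesic_dist r) (range s) E \<and> (\<forall>n. P s n (s n)) \<and> inj s"
  proof (rule gec_graph_exists)
    show "P f n v = P g n v" if "\<And>i. i < n \<Longrightarrow> f i = g i" for f g n v
    proof -
      have "peval \<kappa> (flat (f(n := v))) t = peval \<kappa> (flat (g(n := v))) t" if "pvars t \<subseteq> {..<3 * Suc n}" for t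
        using that \<open>\<And>i. i < n \<Longrightarrow> f i = g i\<close> by (intro peval_flat_cong[of t "Suc n"]) (auto simp: less_Suc_eq)
      then show ?thesis
        unfolding P_def by auto
    qed
    show "v \<noteq> f i" if "P f n v" "i < n" for f n v i
    proof
      assume "v = f i"
      \<comment> \<open>A difference of coordinates that vanishes if \<open>v = f i\<close>, yet not
        identically, as two opposite points show.\<close>
      define t where "t = PAdd (PVar (3 * n)) (PNeg (PVar (3 * i)))"
      have "peval \<kappa> (flat (f(n := v))) t = 0"
        using \<open>v = f i\<close> \<open>i < n\<close> by (simp add: t_def flat_def)
      moreover have "pvars t \<subseteq> {..<3 * Suc n}"
        using \<open>i < n\<close> by (auto simp: t_def)
      moreover define a :: "nat \<Rightarrow> real ^ 3" where "a k = (if k = n then axis 1 r else axis 1 (- r))" for k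
      have "range a \<subseteq> sphere 0 r"
        using r by (auto simp: a_def norm_axis_1 norm_eq_sqrt_inner inner_axis_axis)
      ultimately have "peval \<kappa> (flat a) t = 0"
        using \<open>P f n v\<close> unfolding P_def by blast
      then show False
        using r \<open>i < n\<close> by (simp add: t_def flat_def a_def coords_def axis_def)
    qed
    show "\<exists>v\<in>sphere 0 r. geodesic_dist r p v < \<epsilon> \<and> P f n v"
      if f: "\<And>i. i < n \<Longrightarrow> f i \<in> sphere 0 r \<and> P f i (f i)" and p: "p \<in> sphere 0 r" and "\<epsilon> > 0" for f n p \<epsilon>
    proof -
      obtain v where v: "v \<in> sphere 0 r" "geodesic_dist r p v < \<epsilon>"
        "\<And>t q. peval \<kappa> (flat (f(n := v))) t = 0 \<Longrightarrow> q \<in> sphere 0 r \<Longrightarrow> peval \<kappa> (flat (f(n := q))) t = 0"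
        using sphere_avoid_zeros[OF r p \<open>\<epsilon> > 0\<close>] by metis
      have "peval \<kappa> (flat a) t = 0"
        if t: "pvars t \<subseteq> {..<3 * Suc n}" "peval \<kappa> (flat (f(n := v))) t = 0" and a: "range a \<subseteq> sphere 0 r" for t a
      proof -
        \<comment> \<open>The coordinates of \<open>w\<close> are constants, so substituting
          \<open>w\<close> for the last point leaves a term in the first \<open>n\<close> points. It
          vanishes at \<open>f\<close> by the choice of \<open>v\<close>, hence identically; density
          of \<open>C\<close> does the rest.\<close>
        have "peval \<kappa> (flat (a(n := w))) t = 0" if w: "w \<in> C" for w
        proof -
          have "\<exists>k. \<kappa> k = coords w ! (i mod 3)" for i
          proof -
            have "coords w ! (i mod 3) \<in> set (coords w)"
              by (rule nth_mem) (simp add: coords_def)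
            with \<kappa>[OF w] show ?thesis
              by (metis imageE subsetD)
          qed
          then obtain idx where idx: "\<And>i. \<kappa> (idx i) = coords w ! (i mod 3)"
            by metis
          define u where "u = psubst (\<lambda>i. if i div 3 = n then PConst (idx i) else PVar i) t"
          have u: "peval \<kappa> (flat b) u = peval \<kappa> (flat (b(n := w))) t" for b
            unfolding u_def peval_psubst by (rule peval_cong) (simp add: idx flat_def)
          have "pvars u \<subseteq> {..<3 * n}"
          proof
            fix i assume "i \<in> pvars u"
            then have "i \<in> pvars t" "i div 3 \<noteq> n"
              by (auto simp: u_def pvars_psubst split: if_splits)
            moreover from this have "i < 3 * Suc n"
              using t(1) by auto
            ultimately have "i < 3 * n"
              by presburger
            then show "i \<in> {..<3 * n}"
              by simp
          qed
          moreover have "w \<in> sphere 0 r"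
            using C(1) w by blast
          then have "peval \<kappa> (flat f) u = 0"
            unfolding u by (rule v(3)[OF t(2)])
          moreover have "P f i (f i)" if "i < n" for i
            using f[OF that] by simp
          ultimately have "peval \<kappa> (flat a) u = 0"
            using gen[of n f u a] a by blast
          then show ?thesis
            by (simp only: u)
        qed
        then have "C \<subseteq> {w. peval \<kappa> (flat (a(n := w))) t = 0}"
          by blast
        moreover have "closed {w. peval \<kappa> (flat (a(n := w))) t = 0}"
          by (intro closed_Collect_eq continuous_peval_flat continuous_intros)
        ultimately have "closure C \<subseteq> {w. peval \<kappa> (flat (a(n := w))) t = 0}"
          by (rule closure_minimal)
        moreover have "a n \<in> closure C"
          using a C(2) by blast
        ultimately have "peval \<kappa> (flat (a(n := a n))) t = 0"
          by blast
        then show ?thesis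
          by simp
      qed
      with v(1,2) show ?thesis
        unfolding P_def by blast
    qed
  qed (use r sphere_separable_perfect[OF r] in auto)
  then obtain s E where s: "gec_graph (sphere 0 r) (geodesic_dist r) (range s) E" "\<And>n. P s n (s n)" "inj s"
    by blast
  have "peval \<kappa> (flat a) t = 0" if "peval \<kappa> (flat s) t = 0" "range a \<subseteq> sphere 0 r" for t a
  proof (rule gen)
    show "pvars t \<subseteq> {..<3 * Suc (Max (insert 0 (pvars t)))}"
    proof
      fix i assume "i \<in> pvars t"
      then have "i \<le> Max (insert 0 (pvars t))"
        using finite_pvars by (intro Max_ge) auto
      then show "i \<in> {..<3 * Suc (Max (insert 0 (pvars t)))}"
        by auto
    qed
  qed (use s(2) that in auto)
  moreover have "range s \<subseteq> sphere 0 r"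
    using s(2) by (auto simp: P_def)
  ultimately show ?thesis
    using s(1,3) unfolding generic_seq_def by blast
qed

text \<open>
  A formula that holds at a generic point holds nearby: the finitely many terms that decide it either
  vanish identically on the sphere or keep their signs.
\<close>

lemma sphere_independent_generic:
  assumes r: "r > 0" and \<kappa>: "{1, r, cos (1 / r)} \<subseteq> range \<kappa>"
    and gen: "generic_seq \<kappa> r s" and inj: "inj s"
  shows "sphere_independent r (range s)"
  unfolding sphere_independent_def
proof (intro conjI allI impI)
  show sr: "range s \<subseteq> sphere 0 r"
    using gen by (simp add: generic_seq_def)
  fix \<phi> bs
  assume fv: "fvars real_atom_vars \<phi> \<subseteq> {..<3 + 3 * length bs}" and bs: "set bs \<subseteq> range s"
    and noball: "\<not> (\<exists>c\<in>sphere 0 r. \<exists>\<epsilon>>0.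
      Metric_space.mball (sphere 0 r) (geodesic_dist r) c \<epsilon> \<subseteq> sphere_definable r \<phi> bs)"
  show "range s \<inter> sphere_definable r \<phi> bs \<subseteq> set bs"
  proof (rule ccontr)
    assume "\<not> ?thesis"
    then obtain k0 where k0: "s k0 \<in> sphere_definable r \<phi> bs" "s k0 \<notin> set bs"
      by blast
    \<comment> \<open>Positions in \<open>s\<close> of the points the formula speaks of, the defined
      point first. As \<open>s k0\<close> is no parameter, changing \<open>s\<close> at
      \<open>k0\<close> moves only the first.\<close>
    define ks where "ks = k0 # map (inv s) bs"
    define N where "N = 3 * length ks"
    have N: "N = 3 + 3 * length bs"
      by (simp add: N_def ks_def)
    have ks: "(s(k0 := x)) (ks ! j) = (x # bs) ! j" if "j < length ks" for x j
    proof (cases j)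
      case 0
      then show ?thesis
        by (simp add: ks_def)
    next
      case (Suc i)
      then have i: "i < length bs" "ks ! j = inv s (bs ! i)"
        using that by (auto simp: ks_def)
      then have "s (ks ! j) = bs ! i"
        using bs f_inv_into_f[of "bs ! i" s UNIV] by (metis nth_mem subsetD)
      moreover have "ks ! j \<noteq> k0"
        using k0(2) i(1) \<open>s (ks ! j) = bs ! i\<close> nth_mem by metis
      ultimately show ?thesis
        using Suc by simp
    qed
    define e where "e a i = (if i < N then coords (a (ks ! (i div 3))) ! (i mod 3) else 0)" for a i
    have def_iff: "x \<in> sphere_definable r \<phi> bs \<longleftrightarrow> sat (real_atom_holds r) UNIV \<phi> (e (s(k0 := x)))"
      if "x \<in> sphere 0 r" for x
    proof -
      have rtm: "rtm_val r f u = rtm_val r g u" if "\<And>i. i \<in> rtm_vars u \<Longrightarrow> f i = g i" for f g u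
        using that by (induction u) auto
      have "sat (real_atom_holds r) UNIV \<phi> (\<lambda>i. concat (map coords (x # bs)) ! i) =
          sat (real_atom_holds r) UNIV \<phi> (e (s(k0 := x)))"
      proof (rule sat_cong_fvars)
        show "real_atom_holds r a f = real_atom_holds r a g" if "\<And>i. i \<in> real_atom_vars a \<Longrightarrow> f i = g i" for a f g
          using that rtm[of _ f g] by (cases a) auto
        fix i assume "i \<in> fvars real_atom_vars \<phi>"
        then have "i < N"
          using fv N by auto
        then have "i div 3 < length ks" "i < 3 * length (x # bs)"
          using N by (auto simp: N_def)
        then show "concat (map coords (x # bs)) ! i = e (s(k0 := x)) i"
          using concat_coords_nth[of i "x # bs"] ks[of "i div 3" x] \<open>i < N\<close> by (simp add: e_def)
      qed
      with that show ?thesis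
        by (simp add: sphere_definable_def)
    qed
    obtain \<Phi> where \<Phi>: "finite \<Phi>" "\<And>f g. (\<And>t. t \<in> \<Phi> \<Longrightarrow> sgn (peval \<kappa> f t) = sgn (peval \<kappa> g t)) \<Longrightarrow>
        sat (real_atom_holds r) UNIV \<phi> f = sat (real_atom_holds r) UNIV \<phi> g"
      using sat_determined_by_signs[OF \<kappa>, of \<phi>] by metis
    \<comment> \<open>Rewrites a term in the variables of the formula as one in the coordinates of
      the whole sequence. Variables from \<open>N\<close> on, which terms in \<open>\<Phi>\<close>
      may contain, become 0 as in \<open>e\<close>.\<close>
    define \<tau> where "\<tau> = psubst (\<lambda>i. if i < N then PVar (3 * (ks ! (i div 3)) + i mod 3)
      else PAdd (PConst 0) (PNeg (PConst 0)))"
    have \<tau>: "peval \<kappa> (flat a) (\<tau> t) = peval \<kappa> (e a) t" for a t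
      unfolding \<tau>_def peval_psubst by (rule peval_cong) (simp add: e_def flat_def)
    have "\<exists>\<delta>>0. \<forall>x\<in>sphere 0 r. dist x (s k0) < \<delta> \<longrightarrow>
        sgn (peval \<kappa> (e (s(k0 := x))) t) = sgn (peval \<kappa> (e s) t)" for t
    proof (cases "peval \<kappa> (flat s) (\<tau> t) = 0")
      case True
      have "peval \<kappa> (e (s(k0 := x))) t = 0" if "x \<in> sphere 0 r" for x
      proof -
        have "range (s(k0 := x)) \<subseteq> sphere 0 r"
          using that sr by auto
        then have "peval \<kappa> (flat (s(k0 := x))) (\<tau> t) = 0"
          using gen True unfolding generic_seq_def by blast
        then show ?thesis
          by (simp only: \<tau>)
      qed
      moreover have "peval \<kappa> (e s) t = 0"
        using True by (simp only: \<tau>)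
      ultimately show ?thesis
        by (intro exI[of _ 1]) simp
    next
      case False
      let ?g = "\<lambda>x. peval \<kappa> (flat (s(k0 := x))) (\<tau> t)"
      have "isCont ?g (s k0)"
        using continuous_peval_flat[of UNIV] by (simp add: continuous_on_eq_continuous_at)
      moreover have g0: "?g (s k0) = peval \<kappa> (flat s) (\<tau> t)"
        by simp
      ultimately obtain \<delta> where \<delta>: "\<delta> > 0" "\<And>x. dist x (s k0) < \<delta> \<Longrightarrow> dist (?g x) (?g (s k0)) < \<bar>?g (s k0)\<bar>"
        using False unfolding continuous_at_eps_delta by (metis zero_less_abs_iff)
      have sgn: "sgn u = sgn v" if "dist u v < \<bar>v\<bar>" for u v :: real
        using that by (auto simp: dist_real_def sgn_if abs_if split: if_splits)
      have "sgn (?g x) = sgn (?g (s k0))" if "dist x (s k0) < \<delta>" for x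
        by (rule sgn[OF \<delta>(2)[OF that]])
      with \<delta>(1) show ?thesis
        unfolding \<tau> fun_upd_triv by blast
    qed
    then obtain \<delta> where \<delta>: "\<And>t. \<delta> t > 0" "\<And>t x. x \<in> sphere 0 r \<Longrightarrow> dist x (s k0) < \<delta> t \<Longrightarrow>
        sgn (peval \<kappa> (e (s(k0 := x))) t) = sgn (peval \<kappa> (e s) t)"
      by metis
    define d where "d = Min (insert 1 (\<delta> ` \<Phi>))"
    have "d > 0"
      unfolding d_def using \<Phi>(1) \<delta>(1) by simp
    have d: "d \<le> \<delta> t" if "t \<in> \<Phi>" for t
      unfolding d_def using \<Phi>(1) that by (intro Min_le) auto
    have k0r: "s k0 \<in> sphere 0 r"
      using sr by blast
    have sat0: "sat (real_atom_holds r) UNIV \<phi> (e s)"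
      using def_iff[OF k0r] k0(1) by simp
    have "x \<in> sphere_definable r \<phi> bs" if x: "x \<in> sphere 0 r" "geodesic_dist r (s k0) x < d" for x
    proof -
      have "dist x (s k0) < d"
        using chord_le_geodesic_dist[OF r k0r x(1)] x(2) by (simp add: dist_commute)
      then have "sat (real_atom_holds r) UNIV \<phi> (e (s(k0 := x))) = sat (real_atom_holds r) UNIV \<phi> (e s)"
        using d x(1) by (intro \<Phi>(2) \<delta>(2)) force+
      with sat0 show ?thesis
        using def_iff[OF x(1)] by simp
    qed
    then have "Metric_space.mball (sphere 0 r) (geodesic_dist r) (s k0) d \<subseteq> sphere_definable r \<phi> bs"
      by (auto simp: Metric_space.in_mball[OF Metric_space_sphere[OF r]])
    with noball k0r \<open>d > 0\<close> show False
      by blast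
  qed
qed

theorem sphere_gec_graph_exists:
  assumes r: "r > 0"
  shows "\<exists>S E. gec_graph (sphere 0 r) (geodesic_dist r) S E \<and> sphere_independent r S \<and> S \<noteq> {}"
proof -
  obtain C :: "(real ^ 3) set" where C: "countable C" "C \<subseteq> sphere 0 r" "sphere 0 r \<subseteq> closure C"
    using separable by blast
  \<comment> \<open>The constants of the real structure serve the formulas, and the coordinates of a
    countable dense set serve to specialise points.\<close>
  define K where "K = {1, r, cos (1 / r)} \<union> (\<Union>w\<in>C. set (coords w))"
  have "countable (\<Union>w\<in>C. set (coords w))"
    using C(1) by (rule countable_UN) (simp add: countable_finite)
  then have "countable K" "K \<noteq> {}"
    by (auto simp: K_def)
  then have \<kappa>: "range (from_nat_into K) = K"
    by (rule range_from_nat_into[rotated])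
  have "set (coords w) \<subseteq> range (from_nat_into K)" if "w \<in> C" for w
    unfolding \<kappa> using that by (auto simp: K_def)
  from sphere_generic_gec_graph_exists[OF r C(2,3) this]
  obtain s E where s: "gec_graph (sphere 0 r) (geodesic_dist r) (range s) E"
    "generic_seq (from_nat_into K) r s" "inj s"
    by blast
  moreover have "{1, r, cos (1 / r)} \<subseteq> range (from_nat_into K)"
    unfolding \<kappa> by (auto simp: K_def)
  then have "sphere_independent r (range s)"
    using s(2,3) by (rule sphere_independent_generic[OF r])
  ultimately show ?thesis
    by blast
qed

theorem sphere_graph_theory_determines_radius:
  assumes "r\<^sub>1 > 1 / pi" "r\<^sub>2 > 1 / pi" "sphere_graph_theory r\<^sub>1 = sphere_graph_theory r\<^sub>2"
  shows "r\<^sub>1 = r\<^sub>2"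
proof -
  define C where "C r = (\<lambda>S E. gec_graph (sphere 0 r) (geodesic_dist r) S E \<and> sphere_independent r S)" for r
  have pos: "r\<^sub>1 > 0" "r\<^sub>2 > 0"
    using assms(1,2) by (auto intro: less_trans[of 0 "1 / pi"])
  obtain S\<^sub>1 E\<^sub>1 where 1: "C r\<^sub>1 S\<^sub>1 E\<^sub>1" "S\<^sub>1 \<noteq> {}"
    using sphere_gec_graph_exists[OF pos(1)] by (auto simp: C_def)
  obtain S\<^sub>2 E\<^sub>2 where 2: "C r\<^sub>2 S\<^sub>2 E\<^sub>2" "S\<^sub>2 \<noteq> {}"
    using sphere_gec_graph_exists[OF pos(2)] by (auto simp: C_def)
  have "pi * r\<^sub>1 = pi * r\<^sub>2"
  proof (rule round_spaces_same_diameter[of _ _ _ _ _ _ "C r\<^sub>1" "C r\<^sub>2", OF _ _ _ _ 1 2])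
    show "common_graph_theory (C r\<^sub>1) = common_graph_theory (C r\<^sub>2)"
      using assms(3) by (simp add: C_def sphere_graph_theory_def)
  qed (use assms in \<open>auto simp: C_def intro: round_space_sphere\<close>)
  then show ?thesis
    by simp
qed

theorem corollary4p10:
  shows "(\<forall>L\<^sub>1 L\<^sub>2 :: real. L\<^sub>1 > 2 \<and> L\<^sub>2 > 2 \<and> L\<^sub>1 \<noteq> L\<^sub>2 \<longrightarrow>
            circle_graph_theory L\<^sub>1 \<noteq> circle_graph_theory L\<^sub>2) \<and>
         (\<forall>r\<^sub>1 r\<^sub>2 :: real. r\<^sub>1 > 1 / pi \<and> r\<^sub>2 > 1 / pi \<and> r\<^sub>1 \<noteq> r\<^sub>2 \<longrightarrow>
            sphere_graph_theory r\<^sub>1 \<noteq> sphere_graph_theory r\<^sub>2)"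
  using circle_graph_theory_determines_length sphere_graph_theory_determines_radius by blast

end
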